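(* Let $n\ge 2$, let $\Omega\subset\mathbb{R}^n$ be a bounded open set with smooth boundary such that $m=\inf_{x\in\Omega}|x|$ and $M=\sup_{x\in\Omega}|x|$ satisfy $0\le m<M<+\infty$, and let $\mathcal{D}_S=(1+|x|^2)\sum_{i=1}^ne_i\partial_{x_i}-nx$ be the Dirac operator on the spherical space, where $x=\sum_{i=1}^nx_ie_i$. Let $s=s_0+\underline s\in\mathbb{R}^{n+1}$ be such that $$|s|^2+n^2-2|s_0|nM+(1+m^2)^2>0$$ and $$|\underline s|^2(1+m^2)^2-s_0^2\Big(n(1+M^2)^2-(1+m^2)^2\Big)-2nM\Big((3+n)(1+M^2)^2+(1+m^2)^2\Big)|s_0|>n(3+n)^2M^2(1+M^2)^2-n^2(1+m^2)^2.$$ Then for every $f\in L^2(\Omega,\mathbb{R}_n)$ there exists a unique $F_f\in H^1_0(\Omega,\mathbb{R}_n)$ such that $$q_s(F_f,G)=\langle f,G\rangle_2\qquad\text{for all }G\in H_0^1(\Omega,\mathbb{R}_n).$$ Moreover, writing $Q_s(\mathcal{D}_S)^{-1}f:=F_f$, this solution satisfies $$\|Q_s(\mathcal{D}_S)^{-1}f\|_2\le\frac{1}{H_{n,m,M}(s)}\|f\|_2\qquad\text{and}\qquad\|Q_s(\mathcal{D}_S)^{-1}f\|_D\le\frac{1}{H_{n,m,M}(s)}\|f\|_2,$$ where $$H_{n,m,M}(s)=\tfrac12\Big(|s|^2+n^2-2|s_0|nM+(1+m^2)^2\Big)-\tfrac12\sqrt{\Big(|s|^2+n^2-2|s_0|nM-(1+m^2)^2\Big)^2+4\Big(\sqrt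 n(1+M^2)\big((3+n)M+|s_0|\big)\Big)^2}.$$
   Context: $\mathbb{R}_n$ is the real Clifford algebra generated by $e_1,\dots,e_n$ with $e_i^2=-1$, $e_ie_j=-e_je_i$ for $i\ne j$, with basis $e_A=e_{i_1}\cdots e_{i_r}$, $A=(i_1<\dots<i_r)$, $e_\emptyset=1$. For $x=\sum_Ax_Ae_A$: $\mathrm{Sc}(x)=x_\emptyset$, conjugation is $\overline x=\sum_Ax_A\overline{e_A}$ with $\overline{e_A}=\overline{e_{i_r}}\cdots\overline{e_{i_1}}$, $\overline{e_i}=-e_i$, and $|x|=(\sum_A|x_A|^2)^{1/2}$. $\mathbb{R}^{n+1}$ is identified with the paravectors $s=s_0+\underline s$, $\underline s=s_1e_1+\dots+s_ne_n$, $s_i\in\mathbb{R}$. A point $x=(x_1,\dots,x_n)\in\mathbb{R}^n$ is identified with $x=\sum_{i=1}^nx_ie_i\in\mathbb{R}_n$, acting by left multiplication on functions, as do the $e_i$. Functions take values in $\mathbb{R}_n$; $L^2(\Omega,\mathbb{R}_n)=L^2(\Omega,\mathbb{R})\otimes\mathbb{R}_n$ and $H^1_0(\Omega,\mathbb{R}_n)=H^1_0(\Omega,\mathbb{R})\otimes\mathbb{R}_n$ (Lebesgue measure), conjugation and derivatives being applied pointwise/componentwise. $\langle F,G\rangle_2=\int_\Omega\overline FG\,dx\in\mathbb{R}_n$, $\|F\|_2^2=\mathrm{Sc}\langle F,F\rangle_2$, $\|F\|_D^2=\sum_{i=1}^n\|\partial_{x_i}F\|_2^2$. Let $\mathcal{D}_e=\sum_{i=1}^ne_i\partial_{x_i}$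 (Euclidean Dirac operator) and $E=\sum_{i=1}^nx_i\partial_{x_i}$ (Euler operator). The sesquilinear form on $H^1_0(\Omega,\mathbb{R}_n)\times H^1_0(\Omega,\mathbb{R}_n)$, associated with the Dirichlet problem $Q_s(\mathcal{D}_S)F=f$ in $\Omega$, $F|_{\partial\Omega}=0$, where $Q_s(\mathcal{D}_S)=\mathcal{D}_S^2-2s_0\mathcal{D}_S+|s|^2$, is $$q_s(F,G)=\sum_{i=1}^n\langle(1+|x|^2)^2\partial_{x_i}F,\partial_{x_i}G\rangle_2+2(2+n)\langle(1+|x|^2)EF,G\rangle_2+2\langle(1+|x|^2)x\mathcal{D}_eF,G\rangle_2-2s_0\langle\mathcal{D}_SF,G\rangle_2+(|s|^2+n^2)\langle F,G\rangle_2.$$ $Q_s(\mathcal{D}_S)^{-1}f$ denotes the weak solution $F_f$. *)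

theory Defs
  imports "HOL-Analysis.Analysis"
begin

section \<open>The Clifford algebra with negative definite generators\<close>

text \<open>
  An element is the family of its coefficients \<open>x $ A\<close>, indexed by the subsets \<open>A\<close> of the
  linearly ordered index type; \<open>norm\<close> on this type is the norm
  \<open>(\<Sum>\<^sub>A \<bar>x\<^sub>A\<bar>\<^sup>2)\<^sup>1\<^sup>/\<^sup>2\<close>.  Beware that \<open>*\<close> and \<open>1\<close> on this type are the componentwise ones;
  the Clifford product is \<open>\<odot>\<close>, with unit \<open>cblade {}\<close>.
\<close>

type_synonym 'n clifford = "real ^ ('n set)"

type_synonym 'n point = "real ^ 'n"

definition cblade :: "'n::{finite,linorder} set \<Rightarrow> 'n clifford" where
  "cblade A = axis A 1"

abbreviation cgen :: "'n::{finite,linorder} \<Rightarrow> 'n clifford" where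
  "cgen i \<equiv> cblade {i}"

text \<open>
  Bringing \<open>e\<^sub>A e\<^sub>B\<close> into increasing order costs one sign for every pair \<open>i \<in> A\<close>, \<open>j \<in> B\<close>
  with \<open>j < i\<close> (anticommutation), and one for every \<open>i \<in> A \<inter> B\<close> (because \<open>e\<^sub>i\<^sup>2 = -1\<close>).
\<close>

definition csign :: "'n::{finite,linorder} set \<Rightarrow> 'n set \<Rightarrow> real" where
  "csign A B = (- 1) ^ card {(i, j). i \<in> A \<and> j \<in> B \<and> j \<le> i}"

definition cmult :: "'n::{finite,linorder} clifford \<Rightarrow> 'n clifford \<Rightarrow> 'n clifford"
    (infixl "\<odot>" 70) where
  "x \<odot> y = (\<Sum>A\<in>UNIV. \<Sum>B\<in>UNIV. (x $ A * y $ B * csign A B) *\<^sub>R cblade (sym_diff A B))"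

definition cprod_list :: "'n::{finite,linorder} clifford list \<Rightarrow> 'n clifford" where
  "cprod_list xs = foldr (\<odot>) xs (cblade {})"

definition cconj :: "'n::{finite,linorder} clifford \<Rightarrow> 'n clifford" where
  "cconj x = (\<Sum>A\<in>UNIV. x $ A *\<^sub>R
     cprod_list (map (\<lambda>i. - cgen i) (rev (sorted_list_of_set A))))"

definition Sc :: "'n::{finite,linorder} clifford \<Rightarrow> real" where
  "Sc x = x $ {}"

definition cvec :: "'n::{finite,linorder} point \<Rightarrow> 'n clifford" where
  "cvec x = (\<Sum>i\<in>UNIV. x $ i *\<^sub>R cgen i)"

definition paravectors :: "'n::{finite,linorder} clifford set" where
  "paravectors = {t *\<^sub>R cblade {} + cvec v | t v. True}"

definition nonscalar_part :: "'n::{finite,linorder} clifford \<Rightarrow> 'n clifford" where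
  "nonscalar_part x = x - Sc x *\<^sub>R cblade {}"


subsection \<open>The defining relations\<close>

lemma csign_prod:
  "csign A B = (\<Prod>i\<in>A. \<Prod>j\<in>B. if j \<le> i then - 1 else 1)"
proof -
  have eq: "{(i, j). i \<in> A \<and> j \<in> B \<and> j \<le> i} = {p \<in> A \<times> B. snd p \<le> fst p}"
    by auto
  have "(\<Prod>i\<in>A. \<Prod>j\<in>B. if j \<le> i then - 1 else 1) =
        (\<Prod>p\<in>A \<times> B. if snd p \<le> fst p then - 1 else (1::real))"
    by (simp add: prod.cartesian_product case_prod_unfold)
  also have "\<dots> = (\<Prod>p\<in>{p \<in> A \<times> B. snd p \<le> fst p}. - 1)"
    by (rule prod.inter_filter[symmetric]) simp
  also have "\<dots> = csign A B"
    by (simp add: csign_def eq)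
  finally show ?thesis by simp
qed

lemma prod_sym_diff:
  fixes f :: "'a::finite \<Rightarrow> real"
  assumes "\<And>i. f i * f i = 1"
  shows "prod f (sym_diff A B) = prod f A * prod f B"
proof -
  have A: "prod f A = prod f (A - B) * prod f (A \<inter> B)"
    by (subst prod.union_disjoint[symmetric]) (auto intro: prod.cong)
  have B: "prod f B = prod f (B - A) * prod f (A \<inter> B)"
    by (subst prod.union_disjoint[symmetric]) (auto intro: prod.cong)
  have I: "prod f (A \<inter> B) * prod f (A \<inter> B) = 1"
    using assms by (simp add: prod.distrib[symmetric])
  have "prod f (sym_diff A B) = prod f (A - B) * prod f (B - A)"
    by (rule prod.union_disjoint) auto
  also have "\<dots> = prod f (A - B) * prod f (B - A) * (prod f (A \<inter> B) * prod f (A \<inter> B))"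
    by (simp add: I)
  finally show ?thesis by (simp add: A B mult_ac)
qed

lemma csign_sq [simp]: "csign A B * csign A B = 1"
  by (simp add: csign_def power_add[symmetric] mult_2[symmetric])

lemma csign_sym_diff_left: "csign (sym_diff A B) C = csign A C * csign B C"
  unfolding csign_prod
  by (rule prod_sym_diff) (simp add: prod.distrib[symmetric] if_distrib cong: if_cong)

lemma csign_sym_diff_right: "csign A (sym_diff B C) = csign A B * csign A C"
  unfolding csign_prod
  by (simp add: prod.distrib[symmetric] prod_sym_diff if_distrib cong: if_cong)

lemma clifford_expansion: "x = (\<Sum>A\<in>UNIV. x $ A *\<^sub>R cblade A)"
  by (simp add: vec_eq_iff cblade_def axis_def if_distrib cong: if_cong)

lemma cmult_blade: "cblade A \<odot> cblade B = csign A B *\<^sub>R cblade (sym_diff A B)"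
proof -
  have "cblade A \<odot> cblade B =
    (\<Sum>A'\<in>UNIV. \<Sum>B'\<in>UNIV. if B' = B then
       (if A' = A then csign A' B' *\<^sub>R cblade (sym_diff A' B') else 0) else 0)"
    unfolding cmult_def by (intro sum.cong refl) (auto simp: cblade_def axis_def)
  then show ?thesis by simp
qed

lemma bilinear_cmult: "bilinear (\<odot>)"
  unfolding bilinear_def
  by (auto intro!: linearI simp: cmult_def algebra_simps sum.distrib scaleR_sum_right
      scaleR_left_distrib)

lemma cmult_assoc: "(x \<odot> y) \<odot> z = x \<odot> (y \<odot> z)"
proof -
  note bl = bilinear_cmult
  have blade: "(cblade A \<odot> cblade B) \<odot> cblade C = cblade A \<odot> (cblade B \<odot> cblade C)"
    for A B C :: "'a set"
  proof -
    have "sym_diff (sym_diff A B) C = sym_diff A (sym_diff B C)" by auto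
    then show ?thesis
      by (simp only: cmult_blade bilinear_lmul[OF bl] bilinear_rmul[OF bl]
          csign_sym_diff_left csign_sym_diff_right scaleR_scaleR mult_ac)
  qed
  have lin: "linear (\<lambda>x. x \<odot> y)" "linear (\<lambda>y. x \<odot> y)" for x y :: "'a clifford"
    using bl by (auto simp: bilinear_def)
  have "(\<Sum>A\<in>UNIV. x $ A *\<^sub>R cblade A) \<odot> (\<Sum>B\<in>UNIV. y $ B *\<^sub>R cblade B)
          \<odot> (\<Sum>C\<in>UNIV. z $ C *\<^sub>R cblade C)
      = (\<Sum>A\<in>UNIV. x $ A *\<^sub>R cblade A) \<odot> ((\<Sum>B\<in>UNIV. y $ B *\<^sub>R cblade B)
          \<odot> (\<Sum>C\<in>UNIV. z $ C *\<^sub>R cblade C))"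
    by (simp only: linear_sum[OF lin(1)] linear_sum[OF lin(2)] bilinear_lmul[OF bl]
        bilinear_rmul[OF bl] blade)
  then show ?thesis by (simp only: clifford_expansion[symmetric])
qed

lemma cmult_one_left [simp]: "cblade {} \<odot> x = x"
proof -
  have lin: "linear (\<lambda>y. cblade {} \<odot> y)"
    using bilinear_cmult by (auto simp: bilinear_def)
  have "cblade {} \<odot> (\<Sum>B\<in>UNIV. x $ B *\<^sub>R cblade B) = (\<Sum>B\<in>UNIV. x $ B *\<^sub>R cblade B)"
    by (simp add: linear_sum[OF lin] bilinear_rmul[OF bilinear_cmult] cmult_blade csign_def)
  then show ?thesis by (simp only: clifford_expansion[symmetric])
qed

lemma cmult_one_right [simp]: "x \<odot> cblade {} = x"
proof -
  have lin: "linear (\<lambda>y. y \<odot> cblade {})"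
    using bilinear_cmult by (auto simp: bilinear_def)
  have "(\<Sum>B\<in>UNIV. x $ B *\<^sub>R cblade B) \<odot> cblade {} = (\<Sum>B\<in>UNIV. x $ B *\<^sub>R cblade B)"
    by (simp add: linear_sum[OF lin] bilinear_lmul[OF bilinear_cmult] cmult_blade csign_def)
  then show ?thesis by (simp only: clifford_expansion[symmetric])
qed

lemma cgen_sq: "cgen i \<odot> cgen i = - cblade {}"
proof -
  have "{(k, l). k \<in> {i} \<and> l \<in> {i} \<and> l \<le> k} = {(i, i)}" by auto
  then have "csign {i} {i} = - 1" by (simp only: csign_def) simp
  then show ?thesis by (simp add: cmult_blade)
qed

lemma cgen_anticommute:
  assumes "i \<noteq> j"
  shows "cgen i \<odot> cgen j = - (cgen j \<odot> cgen i)"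
proof -
  have "sym_diff {i} {j} = sym_diff {j} {i}" by auto
  moreover have "csign {i} {j} = - csign {j} {i}"
    using assms by (auto simp: csign_prod)
  ultimately show ?thesis by (simp add: cmult_blade)
qed

lemma cblade_insert:
  assumes "\<And>j. j \<in> A \<Longrightarrow> i < j"
  shows "cblade (insert i A) = cgen i \<odot> cblade A"
proof -
  have "csign {i} A = 1"
    unfolding csign_prod by (simp, rule prod.neutral) (use assms in \<open>auto simp: not_le\<close>)
  moreover have "sym_diff {i} A = insert i A" using assms by auto
  ultimately show ?thesis by (simp add: cmult_blade)
qed

lemma cblade_eq_product:
  "cblade A = cprod_list (map cgen (sorted_list_of_set A))"
proof -
  have "sorted_wrt (<) xs \<Longrightarrow> cblade (set xs) = cprod_list (map cgen xs)"
    for xs :: "'a list"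
    by (induction xs) (auto simp: cprod_list_def cblade_insert)
  from this[of "sorted_list_of_set A"] show ?thesis by simp
qed


lemma cprod_list_append: "cprod_list (xs @ ys) = cprod_list xs \<odot> cprod_list ys"
  by (induction xs) (simp_all add: cprod_list_def cmult_assoc)

lemma cconj_cblade:
  "cconj (cblade A) = cprod_list (map (\<lambda>i. - cgen i) (rev (sorted_list_of_set A)))"
proof -
  have "cconj (cblade A) = (\<Sum>B\<in>UNIV. if B = A then
      cprod_list (map (\<lambda>i. - cgen i) (rev (sorted_list_of_set B))) else 0)"
    unfolding cconj_def by (intro sum.cong refl) (auto simp: cblade_def axis_def)
  then show ?thesis by simp
qed

lemma cconj_cblade_mult: "cconj (cblade A) \<odot> cblade A = cblade {}"
proof -
  have "cprod_list (map (\<lambda>i. - cgen i) (rev xs)) \<odot> cprod_list (map cgen xs) = cblade {}"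
    for xs :: "'a list"
  proof (induction xs)
    case Nil
    then show ?case by (simp add: cprod_list_def)
  next
    case (Cons i xs)
    have gen: "(- cgen i) \<odot> (cgen i \<odot> y) = y" for y :: "'a clifford"
      by (simp add: cmult_assoc[symmetric] bilinear_lneg[OF bilinear_cmult] cgen_sq)
    have "cprod_list (map (\<lambda>i. - cgen i) (rev (i # xs))) \<odot> cprod_list (map cgen (i # xs)) =
      cprod_list (map (\<lambda>i. - cgen i) (rev xs)) \<odot> ((- cgen i) \<odot> (cgen i \<odot> cprod_list (map cgen xs)))"
      by (simp add: cprod_list_append cmult_assoc) (simp add: cprod_list_def)
    then show ?case by (simp add: gen Cons.IH)
  qed
  then show ?thesis
    by (subst cconj_cblade, subst cblade_eq_product)
qed


section \<open>Smooth functions and test functions\<close>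

definition partial_deriv ::
    "'n::finite \<Rightarrow> (real ^ 'n \<Rightarrow> real) \<Rightarrow> real ^ 'n \<Rightarrow> real" where
  "partial_deriv i f x = frechet_derivative f (at x) (axis i 1)"

primrec Ck_on :: "nat \<Rightarrow> (real ^ 'n::finite) set \<Rightarrow> (real ^ 'n \<Rightarrow> real) \<Rightarrow> bool" where
  "Ck_on 0 U f \<longleftrightarrow> continuous_on U f"
| "Ck_on (Suc k) U f \<longleftrightarrow>
     (\<forall>x\<in>U. f differentiable (at x)) \<and> (\<forall>i. Ck_on k U (partial_deriv i f))"

definition smooth_fun_on :: "(real ^ 'n::finite) set \<Rightarrow> (real ^ 'n \<Rightarrow> real) \<Rightarrow> bool" where
  "smooth_fun_on U f \<longleftrightarrow> open U \<and> (\<forall>k. Ck_on k U f)"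

text \<open>Near each boundary point, \<open>\<Omega>\<close> is a sublevel set of a smooth function without critical
  points; in particular \<open>\<Omega>\<close> lies locally on one side of its boundary.\<close>

definition smooth_boundary :: "(real ^ 'n::finite) set \<Rightarrow> bool" where
  "smooth_boundary \<Omega> \<longleftrightarrow>
     (\<forall>p\<in>frontier \<Omega>. \<exists>U \<rho>. p \<in> U \<and> smooth_fun_on U \<rho>
        \<and> (\<forall>x\<in>U. \<exists>i. partial_deriv i \<rho> x \<noteq> 0)
        \<and> \<Omega> \<inter> U = {x \<in> U. \<rho> x < 0})"

definition test_functions :: "(real ^ 'n::finite) set \<Rightarrow> (real ^ 'n \<Rightarrow> real) set" where
  "test_functions \<Omega> = {\<phi>. smooth_fun_on UNIV \<phi> \<and> compact (closure {x. \<phi> x \<noteq> 0})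
     \<and> closure {x. \<phi> x \<noteq> 0} \<subseteq> \<Omega>}"


section \<open>Real-valued Lebesgue and Sobolev spaces\<close>

text \<open>Elements are represented by functions on the whole space, of which only the
  values in \<open>\<Omega>\<close> matter; equality in these spaces is equality almost everywhere in \<open>\<Omega>\<close>.\<close>

definition L2_real :: "(real ^ 'n::finite) set \<Rightarrow> (real ^ 'n \<Rightarrow> real) set" where
  "L2_real \<Omega> = {u \<in> borel_measurable (lebesgue_on \<Omega>). integrable (lebesgue_on \<Omega>) (\<lambda>x. (u x)\<^sup>2)}"

definition has_weak_partial ::
    "(real ^ 'n::finite) set \<Rightarrow> 'n \<Rightarrow> (real ^ 'n \<Rightarrow> real) \<Rightarrow> (real ^ 'n \<Rightarrow> real) \<Rightarrow> bool" where
  "has_weak_partial \<Omega> i u g \<longleftrightarrow>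
     (\<forall>\<phi>\<in>test_functions \<Omega>.
        (LINT x|lebesgue_on \<Omega>. u x * partial_deriv i \<phi> x) = - (LINT x|lebesgue_on \<Omega>. g x * \<phi> x))"

definition H1_real :: "(real ^ 'n::finite) set \<Rightarrow> (real ^ 'n \<Rightarrow> real) set" where
  "H1_real \<Omega> = {u \<in> L2_real \<Omega>. \<forall>i. \<exists>g\<in>L2_real \<Omega>. has_weak_partial \<Omega> i u g}"

text \<open>The square-integrable weak derivative is determined up to a null set; a
  representative is chosen.\<close>

definition weak_partial ::
    "(real ^ 'n::finite) set \<Rightarrow> 'n \<Rightarrow> (real ^ 'n \<Rightarrow> real) \<Rightarrow> real ^ 'n \<Rightarrow> real" where
  "weak_partial \<Omega> i u = (SOME g. g \<in> L2_real \<Omega> \<and> has_weak_partial \<Omega> i u g)"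

definition H1_norm :: "(real ^ 'n::finite) set \<Rightarrow> (real ^ 'n \<Rightarrow> real) \<Rightarrow> real" where
  "H1_norm \<Omega> u = sqrt ((LINT x|lebesgue_on \<Omega>. (u x)\<^sup>2)
     + (\<Sum>i\<in>UNIV. LINT x|lebesgue_on \<Omega>. (weak_partial \<Omega> i u x)\<^sup>2))"

definition H10_real :: "(real ^ 'n::finite) set \<Rightarrow> (real ^ 'n \<Rightarrow> real) set" where
  "H10_real \<Omega> = {u \<in> H1_real \<Omega>. \<exists>\<phi>. (\<forall>k. \<phi> k \<in> test_functions \<Omega>)
     \<and> (\<lambda>k. H1_norm \<Omega> (\<lambda>x. \<phi> k x - u x)) \<longlonglongrightarrow> 0}"


section \<open>Clifford-valued functions\<close>

text \<open>The tensor products with the finite-dimensional algebra are taken componentwise.\<close>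

definition L2_cl ::
    "'n::{finite,linorder} point set \<Rightarrow> ('n point \<Rightarrow> 'n clifford) set" where
  "L2_cl \<Omega> = {F. \<forall>A. (\<lambda>x. F x $ A) \<in> L2_real \<Omega>}"

definition H10_cl ::
    "'n::{finite,linorder} point set \<Rightarrow> ('n point \<Rightarrow> 'n clifford) set" where
  "H10_cl \<Omega> = {F. \<forall>A. (\<lambda>x. F x $ A) \<in> H10_real \<Omega>}"

definition weak_partial_cl ::
    "'n::{finite,linorder} point set \<Rightarrow> 'n \<Rightarrow> ('n point \<Rightarrow> 'n clifford)
      \<Rightarrow> 'n point \<Rightarrow> 'n clifford" where
  "weak_partial_cl \<Omega> i F x = (\<chi> A. weak_partial \<Omega> i (\<lambda>y. F y $ A) x)"

definition cl_inner ::
    "'n::{finite,linorder} point set \<Rightarrow> ('n point \<Rightarrow> 'n clifford)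
      \<Rightarrow> ('n point \<Rightarrow> 'n clifford) \<Rightarrow> 'n clifford" where
  "cl_inner \<Omega> F G = (LINT x|lebesgue_on \<Omega>. cconj (F x) \<odot> G x)"

definition cl_norm2 ::
    "'n::{finite,linorder} point set \<Rightarrow> ('n point \<Rightarrow> 'n clifford) \<Rightarrow> real" where
  "cl_norm2 \<Omega> F = sqrt (Sc (cl_inner \<Omega> F F))"

definition cl_normD ::
    "'n::{finite,linorder} point set \<Rightarrow> ('n point \<Rightarrow> 'n clifford) \<Rightarrow> real" where
  "cl_normD \<Omega> F = sqrt (\<Sum>i\<in>UNIV. (cl_norm2 \<Omega> (weak_partial_cl \<Omega> i F))\<^sup>2)"


section \<open>Dirac operators and the sesquilinear form\<close>

definition dirac_euclid ::
    "'n::{finite,linorder} point set \<Rightarrow> ('n point \<Rightarrow> 'n clifford)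
      \<Rightarrow> 'n point \<Rightarrow> 'n clifford" where
  "dirac_euclid \<Omega> F x = (\<Sum>i\<in>UNIV. cgen i \<odot> weak_partial_cl \<Omega> i F x)"

definition euler_op ::
    "'n::{finite,linorder} point set \<Rightarrow> ('n point \<Rightarrow> 'n clifford)
      \<Rightarrow> 'n point \<Rightarrow> 'n clifford" where
  "euler_op \<Omega> F x = (\<Sum>i\<in>UNIV. x $ i *\<^sub>R weak_partial_cl \<Omega> i F x)"

definition dirac_sphere ::
    "'n::{finite,linorder} point set \<Rightarrow> ('n point \<Rightarrow> 'n clifford)
      \<Rightarrow> 'n point \<Rightarrow> 'n clifford" where
  "dirac_sphere \<Omega> F x =
     (1 + (norm x)\<^sup>2) *\<^sub>R dirac_euclid \<Omega> F x - real CARD('n) *\<^sub>R (cvec x \<odot> F x)"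

definition q_form ::
    "'n::{finite,linorder} point set \<Rightarrow> 'n clifford \<Rightarrow> ('n point \<Rightarrow> 'n clifford)
      \<Rightarrow> ('n point \<Rightarrow> 'n clifford) \<Rightarrow> 'n clifford" where
  "q_form \<Omega> s F G =
     (\<Sum>i\<in>UNIV. cl_inner \<Omega> (\<lambda>x. (1 + (norm x)\<^sup>2)\<^sup>2 *\<^sub>R weak_partial_cl \<Omega> i F x)
                          (weak_partial_cl \<Omega> i G))
     + (2 * (2 + real CARD('n))) *\<^sub>R
         cl_inner \<Omega> (\<lambda>x. (1 + (norm x)\<^sup>2) *\<^sub>R euler_op \<Omega> F x) G
     + 2 *\<^sub>R cl_inner \<Omega> (\<lambda>x. (1 + (norm x)\<^sup>2) *\<^sub>R (cvec x \<odot> dirac_euclid \<Omega> F x)) G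
     - (2 * Sc s) *\<^sub>R cl_inner \<Omega> (dirac_sphere \<Omega> F) G
     + ((norm s)\<^sup>2 + (real CARD('n))\<^sup>2) *\<^sub>R cl_inner \<Omega> F G"

definition weak_solution ::
    "'n::{finite,linorder} point set \<Rightarrow> 'n clifford \<Rightarrow> ('n point \<Rightarrow> 'n clifford)
      \<Rightarrow> ('n point \<Rightarrow> 'n clifford) \<Rightarrow> bool" where
  "weak_solution \<Omega> s f F \<longleftrightarrow>
     F \<in> H10_cl \<Omega> \<and> (\<forall>G\<in>H10_cl \<Omega>. q_form \<Omega> s F G = cl_inner \<Omega> f G)"

definition Q_inverse ::
    "'n::{finite,linorder} point set \<Rightarrow> 'n clifford \<Rightarrow> ('n point \<Rightarrow> 'n clifford)
      \<Rightarrow> 'n point \<Rightarrow> 'n clifford" where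
  "Q_inverse \<Omega> s f = (SOME F. weak_solution \<Omega> s f F)"

definition H_const :: "nat \<Rightarrow> real \<Rightarrow> real \<Rightarrow> 'n::{finite,linorder} clifford \<Rightarrow> real" where
  "H_const n m M s =
     1/2 * ((norm s)\<^sup>2 + (real n)\<^sup>2 - 2 * \<bar>Sc s\<bar> * real n * M + (1 + m\<^sup>2)\<^sup>2)
     - 1/2 * sqrt (((norm s)\<^sup>2 + (real n)\<^sup>2 - 2 * \<bar>Sc s\<bar> * real n * M - (1 + m\<^sup>2)\<^sup>2)\<^sup>2
         + 4 * (sqrt (real n) * (1 + M\<^sup>2) * ((3 + real n) * M + \<bar>Sc s\<bar>))\<^sup>2)"

end

theory Submission
  imports Defs "HOL-Library.Function_Algebras"
begin

text \<open>The scalar part of the sesquilinear form is a bounded real bilinear form on \<open>H10_cl \<Omega>\<close>, and the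
theorem is the Lax-Milgram theorem for it.  The scalar part of \<open>cconj x \<odot> y\<close> is the Euclidean inner
product of the coefficient vectors, so \<open>Sc (q_form \<Omega> s F F)\<close> is the integral over \<open>\<Omega>\<close> of an expression
in the value \<open>v\<close> and the gradient \<open>p\<close> of \<open>F\<close> at the point \<open>x\<close>.  Left multiplication by \<open>x\<close> multiplies norms
by \<open>norm x\<close>, the Euler operator is bounded by \<open>norm x * norm p\<close>, and the Dirac operator by
\<open>sqrt n * norm p\<close>.  Since \<open>m \<le> norm x \<le> M\<close>, the expression is pointwise at least
\<open>a * (norm v)\<^sup>2 - 2 * c * norm v * norm p + b * (norm p)\<^sup>2\<close> with
\<open>a = (norm s)\<^sup>2 + n\<^sup>2 - 2 * \<bar>Sc s\<bar> * n * M\<close>, \<open>b = (1 + m\<^sup>2)\<^sup>2\<close> and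
\<open>c = sqrt n * (1 + M\<^sup>2) * ((3 + n) * M + \<bar>Sc s\<bar>)\<close>.  The smaller eigenvalue of this quadratic form is
\<open>H_const n m M s\<close>, and the two inequalities assumed for \<open>s\<close> say that its trace and determinant are
positive (\<open>form_density_coercive\<close>, \<open>H_const_pos\<close>).

Hence the scalar equation has a unique solution, and testing with \<open>F\<close> itself bounds
\<open>(cl_norm2 \<Omega> F)\<^sup>2 + (cl_normD \<Omega> F)\<^sup>2\<close> by \<open>(cl_norm2 \<Omega> f / H_const n m M s)\<^sup>2\<close>, which contains both estimates.
The form is right linear in its second argument, so testing with \<open>G \<odot> cblade A\<close> for all \<open>A\<close> upgrades the
scalar equation to the Clifford-valued one (\<open>weak_solution_iff_Sc\<close>).

The Lax-Milgram theorem needs the completeness of \<open>H10_cl \<Omega>\<close>.  It rests on the completeness of \<open>L\<^sup>2\<close>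
(\<open>complete_L2\<close>), on integration by parts for test functions (\<open>test_function_has_weak_partial\<close>), which
places them in \<open>H1_real \<Omega>\<close>, and on the uniqueness of weak derivatives (\<open>weak_partial_unique\<close>), which
follows from the fundamental lemma of the calculus of variations
(\<open>AE_zero_if_orthogonal_test_functions\<close>).\<close>


section \<open>Functions as a real vector space\<close>

instantiation "fun" :: (type, real_vector) real_vector
begin
definition scaleR_fun_def: "c *\<^sub>R f = (\<lambda>x. c *\<^sub>R f x)"
instance
  by standard (simp_all add: scaleR_fun_def fun_eq_iff algebra_simps)
end

lemma scaleR_fun_apply [simp]: "(c *\<^sub>R f) x = c *\<^sub>R f x"
  by (simp add: scaleR_fun_def)

section \<open>The Lax-Milgram theorem for semi-inner products\<close>

text \<open>A semi-inner product on a subspace \<open>V\<close>: \<open>ip u u = 0\<close> does not force \<open>u = 0\<close>.  This allows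
function spaces to be used directly, without passing to classes of functions that agree almost
everywhere.\<close>

locale semi_inner_space =
  fixes V :: "'v::real_vector set" and ip :: "'v \<Rightarrow> 'v \<Rightarrow> real"
  assumes subspace: "subspace V"
    and ip_commute: "\<And>u v. u \<in> V \<Longrightarrow> v \<in> V \<Longrightarrow> ip u v = ip v u"
    and ip_add: "\<And>u v w. u \<in> V \<Longrightarrow> v \<in> V \<Longrightarrow> w \<in> V \<Longrightarrow> ip (u + v) w = ip u w + ip v w"
    and ip_scale: "\<And>c u v. u \<in> V \<Longrightarrow> v \<in> V \<Longrightarrow> ip (c *\<^sub>R u) v = c * ip u v"
    and ip_nonneg: "\<And>u. u \<in> V \<Longrightarrow> 0 \<le> ip u u"
begin

definition nrm :: "'v \<Rightarrow> real" where "nrm u = sqrt (ip u u)"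

lemma closed_ops [simp, intro]:
  "0 \<in> V" "u \<in> V \<Longrightarrow> v \<in> V \<Longrightarrow> u + v \<in> V" "u \<in> V \<Longrightarrow> c *\<^sub>R u \<in> V"
  "u \<in> V \<Longrightarrow> v \<in> V \<Longrightarrow> u - v \<in> V"
  using subspace by (auto simp: subspace_0 subspace_add subspace_scale subspace_diff)

lemma ip_diff: "u \<in> V \<Longrightarrow> v \<in> V \<Longrightarrow> w \<in> V \<Longrightarrow> ip (u - v) w = ip u w - ip v w"
  using ip_add[of u "- v" w] ip_scale[of v w "-1"] subspace_neg[OF subspace, of v] by simp

lemma ip_add_right: "u \<in> V \<Longrightarrow> v \<in> V \<Longrightarrow> w \<in> V \<Longrightarrow> ip w (u + v) = ip w u + ip w v"
  by (simp add: ip_commute[of w] ip_add)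

lemma ip_scale_right: "u \<in> V \<Longrightarrow> w \<in> V \<Longrightarrow> ip w (c *\<^sub>R u) = c * ip w u"
  by (simp add: ip_commute[of w] ip_scale)

lemma ip_diff_right: "u \<in> V \<Longrightarrow> v \<in> V \<Longrightarrow> w \<in> V \<Longrightarrow> ip w (u - v) = ip w u - ip w v"
  by (simp add: ip_commute[of w] ip_diff)

lemmas ip_simps = ip_add ip_scale ip_diff ip_add_right ip_scale_right ip_diff_right

lemma nrm_nonneg [simp]: "u \<in> V \<Longrightarrow> 0 \<le> nrm u"
  by (simp add: nrm_def ip_nonneg)

lemma nrm_sq: "u \<in> V \<Longrightarrow> (nrm u)\<^sup>2 = ip u u"
  by (simp add: nrm_def ip_nonneg)

lemma nrm_zero [simp]: "nrm 0 = 0"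
  using ip_scale[of 0 0 0] by (simp add: nrm_def)

lemma Cauchy_Schwarz:
  assumes u: "u \<in> V" and v: "v \<in> V"
  shows "\<bar>ip u v\<bar> \<le> nrm u * nrm v"
proof -
  have quad: "0 \<le> ip u u + 2 * t * ip u v + t\<^sup>2 * ip v v" for t
    using ip_nonneg[of "u + t *\<^sub>R v"] u v
    by (simp add: ip_simps ip_commute[of v u] algebra_simps power2_eq_square)
  have "(ip u v)\<^sup>2 \<le> ip u u * ip v v"
  proof (cases "ip v v = 0")
    case True
    have "ip u v = 0"
    proof (rule ccontr)
      assume "ip u v \<noteq> 0"
      then show False
        using quad[of "- (ip u u + 1) / (2 * ip u v)"] True by (simp add: field_simps)
    qed
    then show ?thesis by (simp add: True)
  next
    case False
    then have "0 < ip v v" using ip_nonneg[OF v] by simp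
    then show ?thesis
      using quad[of "- ip u v / ip v v"] by (simp add: field_simps power2_eq_square)
  qed
  then have "\<bar>ip u v\<bar> \<le> sqrt (ip u u * ip v v)"
    by (intro real_le_rsqrt) simp
  then show ?thesis by (simp add: nrm_def real_sqrt_mult)
qed

lemma nrm_triangle:
  assumes u: "u \<in> V" and v: "v \<in> V"
  shows "nrm (u + v) \<le> nrm u + nrm v"
proof (rule power2_le_imp_le)
  show "(nrm (u + v))\<^sup>2 \<le> (nrm u + nrm v)\<^sup>2"
    using Cauchy_Schwarz[OF u v] u v
    by (simp add: nrm_sq ip_simps power2_sum ip_commute[of v u])
qed (use u v in auto)

lemma nrm_minus_commute: "u \<in> V \<Longrightarrow> v \<in> V \<Longrightarrow> nrm (u - v) = nrm (v - u)"
  by (simp add: nrm_def ip_simps)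

lemma nrm_telescope:
  assumes X: "\<And>n. X n \<in> V"
  shows "nrm (X (n + k) - X n) \<le> (\<Sum>i=n..<n + k. nrm (X (Suc i) - X i))"
proof (induction k)
  case (Suc k)
  have "nrm (X (n + Suc k) - X n) = nrm ((X (Suc (n + k)) - X (n + k)) + (X (n + k) - X n))"
    by simp
  also have "\<dots> \<le> nrm (X (Suc (n + k)) - X (n + k)) + nrm (X (n + k) - X n)"
    by (intro nrm_triangle closed_ops X)
  finally show ?case using Suc.IH by simp
qed simp

text \<open>The tail of the series of increments bounds the distance to every later term.\<close>

lemma nrm_tail:
  assumes X: "\<And>n. X n \<in> V" and sm: "summable (\<lambda>i. nrm (X (Suc i) - X i))" and "n \<le> k"
  shows "nrm (X k - X n) \<le> (\<Sum>i. nrm (X (Suc (i + n)) - X (i + n)))"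
proof -
  have "nrm (X k - X n) \<le> (\<Sum>i=n..<n + (k - n). nrm (X (Suc i) - X i))"
    using nrm_telescope[of X n "k - n", OF X] \<open>n \<le> k\<close> by simp
  also have "\<dots> = (\<Sum>i<k - n. nrm (X (Suc (i + n)) - X (i + n)))"
    by (rule sum.reindex_bij_witness[of _ "\<lambda>i. i + n" "\<lambda>i. i - n"]) auto
  also have "\<dots> \<le> (\<Sum>i. nrm (X (Suc (i + n)) - X (i + n)))"
    using summable_iff_shift[of "\<lambda>i. nrm (X (Suc i) - X i)" n] sm
    by (intro sum_le_suminf) (auto intro!: nrm_nonneg closed_ops X)
  finally show ?thesis .
qed

end

text \<open>Completeness is stated for sequences with absolutely summable increments.  Every Cauchy sequence has
such a subsequence, so nothing is lost, and no subsequence has to be extracted below.\<close>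

locale complete_semi_inner_space = semi_inner_space +
  assumes complete: "\<And>X. (\<And>n. X n \<in> V) \<Longrightarrow> summable (\<lambda>n. nrm (X (Suc n) - X n)) \<Longrightarrow>
    \<exists>L\<in>V. (\<lambda>n. nrm (X n - L)) \<longlonglongrightarrow> 0"
begin

text \<open>The representing vector minimizes the quadratic functional \<open>J v = ip v v - 2 * l v\<close>.\<close>

lemma Riesz:
  assumes l_add: "\<And>u v. u \<in> V \<Longrightarrow> v \<in> V \<Longrightarrow> l (u + v) = l u + l v"
    and l_scale: "\<And>c u. u \<in> V \<Longrightarrow> l (c *\<^sub>R u) = c * (l u :: real)"
    and l_bd: "\<And>u. u \<in> V \<Longrightarrow> \<bar>l u\<bar> \<le> C * nrm u"
  shows "\<exists>u\<in>V. \<forall>v\<in>V. ip u v = l v"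
proof -
  define J where "J v = ip v v - 2 * l v" for v
  define d where "d = (INF v\<in>V. J v)"
  have J_exp: "J (u + t *\<^sub>R v) = J u + 2 * t * (ip u v - l v) + t\<^sup>2 * ip v v"
    if "u \<in> V" "v \<in> V" for u v t
    using that by (simp add: J_def ip_simps l_add l_scale ip_commute[of v u] power2_eq_square
        algebra_simps)
  have "- C\<^sup>2 \<le> J v" if v: "v \<in> V" for v
  proof -
    have "0 \<le> (nrm v - C)\<^sup>2" by simp
    then show ?thesis using l_bd[OF v] v
      by (simp add: J_def nrm_sq[symmetric] power2_diff algebra_simps)
  qed
  then have bdd: "bdd_below (J ` V)" by (auto intro!: bdd_belowI2)
  have d_le: "d \<le> J v" if "v \<in> V" for v
    unfolding d_def by (rule cINF_lower[OF bdd that])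
  have "\<exists>v\<in>V. J v < d + (1/4) ^ n" for n :: nat
  proof -
    have "Inf (J ` V) < d + (1/4) ^ n" by (simp add: d_def)
    then show ?thesis using cInf_lessD[of "J ` V"] closed_ops(1) by blast
  qed
  then obtain X where X: "\<And>n. X n \<in> V" and JX: "\<And>n. J (X n) < d + (1/4) ^ n"
    by metis
  \<comment> \<open>Parallelogram identity: a minimizing sequence is automatically a Cauchy sequence.\<close>
  have par: "ip (u - v) (u - v) = 2 * J u + 2 * J v - 4 * J ((1/2) *\<^sub>R (u + v))"
    if "u \<in> V" "v \<in> V" for u v
    using that by (simp add: J_def ip_simps l_add l_scale ip_commute[of v u]
        scaleR_add_right algebra_simps)
  have step: "nrm (X (Suc n) - X n) \<le> 2 * (1/2) ^ n" for n
  proof (rule power2_le_imp_le)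
    have pw: "(1/4::real) ^ Suc n \<le> (1/4) ^ n" "((1/2::real) ^ n)\<^sup>2 = (1/4) ^ n"
      by (simp_all add: power_mult_distrib[symmetric] power2_eq_square)
    have "(nrm (X (Suc n) - X n))\<^sup>2 \<le> 2 * (J (X (Suc n)) - d) + 2 * (J (X n) - d)"
      using d_le[of "(1/2) *\<^sub>R (X (Suc n) + X n)"] X by (simp add: nrm_sq par)
    also have "\<dots> \<le> 4 * (1/4) ^ n"
    proof -
      have "J (X (Suc n)) < d + (1/4) ^ n"
        by (rule less_le_trans[OF JX]) (rule add_left_mono[OF pw(1)])
      then show ?thesis using JX[of n] by argo
    qed
    also have "\<dots> = (2 * (1/2) ^ n)\<^sup>2" by (simp add: power_mult_distrib pw(2))
    finally show "(nrm (X (Suc n) - X n))\<^sup>2 \<le> (2 * (1/2) ^ n)\<^sup>2" .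
  qed simp
  have "summable (\<lambda>n. nrm (X (Suc n) - X n))"
  proof (rule summable_comparison_test')
    show "summable (\<lambda>n. 2 * (1/2::real) ^ n)" by (intro summable_mult summable_geometric) simp
    show "norm (nrm (X (Suc n) - X n)) \<le> 2 * (1/2) ^ n" if "n \<ge> 0" for n
      using step[of n] X by simp
  qed
  from complete[OF X this] obtain u where u: "u \<in> V" and lim: "(\<lambda>n. nrm (X n - u)) \<longlonglongrightarrow> 0"
    by blast
  have Ju: "J u \<le> d"
  proof -
    define w where "w n = X n - u" for n
    have w: "w n \<in> V" for n using X u by (simp add: w_def)
    have wlim: "(\<lambda>n. nrm (w n)) \<longlonglongrightarrow> 0" using lim by (simp add: w_def)
    have "(\<lambda>n. ip u (w n)) \<longlonglongrightarrow> 0"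
      by (rule Lim_null_comparison[of _ "\<lambda>n. nrm u * nrm (w n)"])
         (auto intro!: always_eventually Cauchy_Schwarz u w tendsto_mult_right_zero wlim)
    moreover have "(\<lambda>n. l (w n)) \<longlonglongrightarrow> 0"
      by (rule Lim_null_comparison[of _ "\<lambda>n. C * nrm (w n)"])
         (auto intro!: always_eventually l_bd w tendsto_mult_right_zero wlim)
    moreover have "(\<lambda>n. ip (w n) (w n)) \<longlonglongrightarrow> 0"
      using tendsto_power[OF wlim, of 2] w by (simp add: nrm_sq)
    ultimately have "(\<lambda>n. J u + 2 * 1 * (ip u (w n) - l (w n)) + 1\<^sup>2 * ip (w n) (w n))
        \<longlonglongrightarrow> J u + 2 * 1 * (0 - 0) + 1\<^sup>2 * 0"
      by (intro tendsto_intros)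
    moreover have "J u + 2 * 1 * (ip u (w n) - l (w n)) + 1\<^sup>2 * ip (w n) (w n) = J (X n)" for n
      using J_exp[OF u w, of 1 n] by (simp add: w_def)
    ultimately have "(\<lambda>n. J (X n)) \<longlonglongrightarrow> J u" by simp
    moreover have "(\<lambda>n. d + (1/4) ^ n) \<longlonglongrightarrow> d + 0"
      by (intro tendsto_intros) simp
    ultimately show ?thesis
      using LIMSEQ_le[of "\<lambda>n. J (X n)" "J u" "\<lambda>n. d + (1/4) ^ n" d] JX less_imp_le by auto
  qed
  have "ip u v = l v" if v: "v \<in> V" for v
  proof (rule ccontr)
    assume ne: "ip u v \<noteq> l v"
    define b where "b = ip u v - l v"
    \<comment> \<open>\<open>- b / ip v v\<close> would be the optimal step; the summand 1 avoids a division by zero.\<close>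
    define c where "c = ip v v + 1"
    have c: "c > 0" using ip_nonneg[OF v] by (simp add: c_def)
    have "0 \<le> 2 * (- b / c) * b + (- b / c)\<^sup>2 * ip v v"
      using d_le[of "u + (- b / c) *\<^sub>R v"] Ju u v J_exp[OF u v, of "- b / c"]
      by (simp add: b_def)
    also have "\<dots> \<le> 2 * (- b / c) * b + (- b / c)\<^sup>2 * c"
      by (intro add_left_mono mult_left_mono) (auto simp: c_def)
    also have "\<dots> = - b\<^sup>2 / c" using c by (simp add: field_simps power2_eq_square)
    finally have "b\<^sup>2 / c \<le> 0" by simp
    with c have "b = 0" by (simp add: divide_le_0_iff)
    then show False using ne by (simp add: b_def)
  qed
  then show ?thesis using u by blast
qed

text \<open>The form \<open>a\<close> need not be symmetric.  Let \<open>R u\<close> and \<open>g\<close> represent \<open>a u\<close> and \<open>l\<close>; the equation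
\<open>R u = g\<close> is solved by iterating \<open>T u = u - \<rho> (R u - g)\<close>.  Since
\<open>\<parallel>u - \<rho> R u\<parallel>\<^sup>2 \<le> (1 - 2 \<rho> H + \<rho>\<^sup>2 K\<^sup>2) \<parallel>u\<parallel>\<^sup>2\<close>, the choice \<open>\<rho> = H / K\<^sup>2\<close> makes \<open>T\<close> a contraction
with constant \<open>\<surd>(1 - H\<^sup>2 / K\<^sup>2)\<close>.\<close>

theorem Lax_Milgram:
  assumes a_add: "\<And>u v w. u \<in> V \<Longrightarrow> v \<in> V \<Longrightarrow> w \<in> V \<Longrightarrow> a (u + v) w = a u w + a v w"
    and a_scale: "\<And>c u v. u \<in> V \<Longrightarrow> v \<in> V \<Longrightarrow> a (c *\<^sub>R u) v = c * (a u v :: real)"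
    and a_add_right: "\<And>u v w. u \<in> V \<Longrightarrow> v \<in> V \<Longrightarrow> w \<in> V \<Longrightarrow> a w (u + v) = a w u + a w v"
    and a_scale_right: "\<And>c u v. u \<in> V \<Longrightarrow> v \<in> V \<Longrightarrow> a v (c *\<^sub>R u) = c * a v u"
    and a_bd: "\<And>u v. u \<in> V \<Longrightarrow> v \<in> V \<Longrightarrow> \<bar>a u v\<bar> \<le> K * nrm u * nrm v"
    and coercive: "\<And>u. u \<in> V \<Longrightarrow> H * ip u u \<le> a u u" and H: "H > 0"
    and l_add: "\<And>u v. u \<in> V \<Longrightarrow> v \<in> V \<Longrightarrow> l (u + v) = l u + l v"
    and l_scale: "\<And>c u. u \<in> V \<Longrightarrow> l (c *\<^sub>R u) = c * (l u :: real)"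
    and l_bd: "\<And>u. u \<in> V \<Longrightarrow> \<bar>l u\<bar> \<le> C * nrm u"
  shows "\<exists>u\<in>V. \<forall>v\<in>V. a u v = l v"
proof -
  \<comment> \<open>If \<open>ip\<close> vanishes on \<open>V\<close>, the given bound \<open>K\<close> may be smaller than \<open>H\<close>.\<close>
  define K' where "K' = max K H"
  have K': "K' \<ge> H" "K' > 0" using H by (auto simp: K'_def)
  have a_bd': "\<bar>a u v\<bar> \<le> K' * nrm u * nrm v" if "u \<in> V" "v \<in> V" for u v
  proof -
    have "K * (nrm u * nrm v) \<le> K' * (nrm u * nrm v)"
      using that by (intro mult_right_mono) (auto simp: K'_def)
    then show ?thesis using a_bd[OF that] by (simp add: mult.assoc)
  qed
  have "\<exists>r\<in>V. \<forall>v\<in>V. ip r v = a u v" if u: "u \<in> V" for u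
    by (rule Riesz[of "a u" "K' * nrm u"]) (use u a_bd' in \<open>auto simp: a_add_right a_scale_right\<close>)
  then obtain R where R: "\<And>u. u \<in> V \<Longrightarrow> R u \<in> V"
    and R_ip: "\<And>u v. u \<in> V \<Longrightarrow> v \<in> V \<Longrightarrow> ip (R u) v = a u v" by metis
  obtain g where g: "g \<in> V" and g_ip: "\<And>v. v \<in> V \<Longrightarrow> ip g v = l v"
  proof -
    have "\<exists>u\<in>V. \<forall>v\<in>V. ip u v = l v"
      by (rule Riesz[of l C]) (fact l_add l_scale l_bd)+
    then show thesis using that by blast
  qed
  define \<rho> where "\<rho> = H / K'\<^sup>2"
  define \<theta> where "\<theta> = sqrt (1 - H\<^sup>2 / K'\<^sup>2)"
  have q: "H\<^sup>2 / K'\<^sup>2 \<le> 1" using K' H by (simp add: power_mono)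
  have \<theta>: "0 \<le> \<theta>" "\<theta> < 1" using q H K' by (auto simp: \<theta>_def)
  define T where "T u = u - \<rho> *\<^sub>R (R u - g)" for u
  have T: "T u \<in> V" if "u \<in> V" for u using that R g by (simp add: T_def)
  have contr: "nrm (T u - T v) \<le> \<theta> * nrm (u - v)" if u: "u \<in> V" and v: "v \<in> V" for u v
  proof (rule power2_le_imp_le)
    define w r where "w = u - v" and "r = R u - R v"
    have wr: "w \<in> V" "r \<in> V" using u v R by (auto simp: w_def r_def)
    have a_diff: "a u z - a v z = a w z" if z: "z \<in> V" for z
      using a_add[of w v z] u v z by (simp add: w_def)
    have r_ip: "ip r z = a w z" if z: "z \<in> V" for z
      using z u v R by (simp add: r_def ip_diff R_ip a_diff)
    have "(nrm r)\<^sup>2 \<le> K' * nrm w * nrm r"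
      using a_bd'[OF wr] r_ip[OF wr(2)] wr by (simp add: nrm_sq)
    then have r_le: "nrm r \<le> K' * nrm w"
      using wr nrm_nonneg[OF wr(2)] nrm_nonneg[OF wr(1)] K'
      by (cases "nrm r = 0") (auto simp: power2_eq_square)
    have eq: "T u - T v = w - \<rho> *\<^sub>R r" by (simp add: T_def w_def r_def algebra_simps)
    have "(nrm (T u - T v))\<^sup>2 = ip (w - \<rho> *\<^sub>R r) (w - \<rho> *\<^sub>R r)"
      using wr by (simp add: eq nrm_sq)
    also have "\<dots> = ip w w - 2 * \<rho> * ip r w + \<rho>\<^sup>2 * ip r r"
      using wr by (simp add: ip_simps ip_commute[of w r] power2_eq_square algebra_simps)
    also have "\<dots> \<le> ip w w - 2 * \<rho> * (H * ip w w) + \<rho>\<^sup>2 * (K'\<^sup>2 * ip w w)"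
    proof -
      have "\<rho> * (H * ip w w) \<le> \<rho> * ip r w"
        using coercive[OF wr(1)] r_ip[OF wr(1)] H K'
        by (intro mult_left_mono) (auto simp: \<rho>_def)
      moreover have "ip r r \<le> K'\<^sup>2 * ip w w"
        using power_mono[OF r_le, of 2] wr by (simp add: nrm_sq power_mult_distrib)
      then have "\<rho>\<^sup>2 * ip r r \<le> \<rho>\<^sup>2 * (K'\<^sup>2 * ip w w)" by (intro mult_left_mono) auto
      ultimately show ?thesis by linarith
    qed
    also have "\<dots> = (1 - H\<^sup>2 / K'\<^sup>2) * ip w w"
      using K' by (simp add: \<rho>_def field_simps power2_eq_square)
    also have "\<dots> = (\<theta> * nrm (u - v))\<^sup>2"
      using q wr by (simp add: \<theta>_def power_mult_distrib nrm_sq w_def)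
    finally show "(nrm (T u - T v))\<^sup>2 \<le> (\<theta> * nrm (u - v))\<^sup>2" .
  qed (use \<theta> u v in auto)
  define X where "X n = (T ^^ n) 0" for n
  have X: "X n \<in> V" for n by (induction n) (auto simp: X_def T)
  have XS: "X (Suc n) = T (X n)" for n by (simp add: X_def)
  have step: "nrm (X (Suc n) - X n) \<le> nrm (X 1 - X 0) * \<theta> ^ n" for n
  proof (induction n)
    case (Suc n)
    have "nrm (X (Suc (Suc n)) - X (Suc n)) \<le> \<theta> * nrm (X (Suc n) - X n)"
      unfolding XS[of "Suc n"] XS[of n] using contr[OF X[of "Suc n"] X[of n]] by (simp add: XS)
    also have "\<dots> \<le> \<theta> * (nrm (X 1 - X 0) * \<theta> ^ n)" using Suc \<theta> by (intro mult_left_mono)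
    finally show ?case by (simp add: algebra_simps)
  qed simp
  have "summable (\<lambda>n. nrm (X (Suc n) - X n))"
  proof (rule summable_comparison_test')
    show "summable (\<lambda>n. nrm (X 1 - X 0) * \<theta> ^ n)"
      using \<theta> by (intro summable_mult summable_geometric) simp
    show "norm (nrm (X (Suc n) - X n)) \<le> nrm (X 1 - X 0) * \<theta> ^ n" if "n \<ge> 0" for n
      using step[of n] X by simp
  qed
  from complete[OF X this] obtain u where u: "u \<in> V" and lim: "(\<lambda>n. nrm (X n - u)) \<longlonglongrightarrow> 0"
    by blast
  have "nrm (T u - u) \<le> nrm (X n - u) + nrm (X (Suc n) - u)" for n
  proof -
    have "nrm (T u - u) = nrm ((T u - T (X n)) + (X (Suc n) - u))" by (simp add: XS)
    also have "\<dots> \<le> nrm (T u - T (X n)) + nrm (X (Suc n) - u)"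
      by (intro nrm_triangle closed_ops T u X)
    also have "nrm (T u - T (X n)) \<le> \<theta> * nrm (u - X n)" by (rule contr[OF u X])
    also have "\<dots> \<le> 1 * nrm (u - X n)" using \<theta> u X by (intro mult_right_mono) auto
    finally show ?thesis using u X by (simp add: nrm_minus_commute)
  qed
  moreover have "(\<lambda>n. nrm (X n - u) + nrm (X (Suc n) - u)) \<longlonglongrightarrow> 0 + 0"
    by (intro tendsto_add lim LIMSEQ_Suc[OF lim])
  ultimately have "nrm (T u - u) \<le> 0"
    by (intro LIMSEQ_le_const[of _ 0]) auto
  then have 0: "nrm (T u - u) = 0" using T u by (simp add: antisym)
  have "a u v = l v" if v: "v \<in> V" for v
  proof -
    have "ip (T u - u) v = 0" using Cauchy_Schwarz[of "T u - u" v] T u v 0 by simp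
    moreover have "ip (T u - u) v = ip (T u) v - ip u v"
      using u v T by (simp add: ip_diff)
    moreover have "ip (T u) v = ip u v - \<rho> * (a u v - l v)"
      using u v R g by (simp add: T_def ip_simps R_ip g_ip)
    moreover have "\<rho> \<noteq> 0" using H K' by (simp add: \<rho>_def)
    ultimately show ?thesis by simp
  qed
  then show ?thesis using u by blast
qed

end


section \<open>Smooth bump functions on boxes\<close>

lemma partial_deriv_eqI: "(f has_derivative f') (at x) \<Longrightarrow> partial_deriv i f x = f' (axis i 1)"
  unfolding partial_deriv_def by (simp add: frechet_derivative_at[symmetric])

lemma Ck_on_imp_continuous: "Ck_on k UNIV f \<Longrightarrow> continuous_on UNIV f"
  by (cases k) (auto intro!: continuous_at_imp_continuous_on differentiable_imp_continuous_within)

lemma partial_deriv_add: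
  assumes "\<And>x. f differentiable (at x)" "\<And>x. g differentiable (at x)"
  shows "partial_deriv i (\<lambda>x. f x + g x) = (\<lambda>x. partial_deriv i f x + partial_deriv i g x)"
proof
  fix x
  have "((\<lambda>x. f x + g x) has_derivative
      (\<lambda>h. frechet_derivative f (at x) h + frechet_derivative g (at x) h)) (at x)"
    using assms by (intro has_derivative_add) (auto simp: frechet_derivative_works[symmetric])
  from partial_deriv_eqI[OF this, of i]
  show "partial_deriv i (\<lambda>x. f x + g x) x = partial_deriv i f x + partial_deriv i g x"
    by (simp add: partial_deriv_def)
qed

lemma partial_deriv_cmult:
  assumes "\<And>x. f differentiable (at x)"
  shows "partial_deriv i (\<lambda>x. c * f x) = (\<lambda>x. c * partial_deriv i f x)"
proof
  fix x
  have "((\<lambda>x. c * f x) has_derivative (\<lambda>h. c * frechet_derivative f (at x) h)) (at x)"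
    using assms by (intro has_derivative_mult_right) (auto simp: frechet_derivative_works[symmetric])
  from partial_deriv_eqI[OF this, of i]
  show "partial_deriv i (\<lambda>x. c * f x) x = c * partial_deriv i f x"
    by (simp add: partial_deriv_def)
qed

lemma partial_deriv_mult:
  assumes "\<And>x. f differentiable (at x)" "\<And>x. g differentiable (at x)"
  shows "partial_deriv i (\<lambda>x. f x * g x) = (\<lambda>x. f x * partial_deriv i g x + partial_deriv i f x * g x)"
proof
  fix x
  have "((\<lambda>x. f x * g x) has_derivative
      (\<lambda>h. f x * frechet_derivative g (at x) h + frechet_derivative f (at x) h * g x)) (at x)"
    using assms by (intro has_derivative_mult) (auto simp: frechet_derivative_works[symmetric])
  from partial_deriv_eqI[OF this, of i]
  show "partial_deriv i (\<lambda>x. f x * g x) x = f x * partial_deriv i g x + partial_deriv i f x * g x"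
    by (simp add: partial_deriv_def)
qed

lemma Ck_on_add: "Ck_on k UNIV f \<Longrightarrow> Ck_on k UNIV g \<Longrightarrow> Ck_on k UNIV (\<lambda>x. f x + g x)"
  by (induction k arbitrary: f g)
     (auto intro!: continuous_on_add differentiable_add simp: partial_deriv_add)

lemma Ck_on_cmult: "Ck_on k UNIV f \<Longrightarrow> Ck_on k UNIV (\<lambda>x. c * f x)"
  by (induction k arbitrary: f)
     (auto intro!: continuous_on_mult differentiable_mult simp: partial_deriv_cmult)

text \<open>The functions \<open>t\<^sup>-\<^sup>k exp (-1/t)\<close>, extended by \<open>0\<close> to \<open>t \<le> 0\<close>.  The derivative of one of them is a linear
combination of two others, so all of them are smooth.\<close>

definition flat_exp :: "nat \<Rightarrow> real \<Rightarrow> real" where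
  "flat_exp k t = (if t > 0 then (1 / t) ^ k * exp (- (1 / t)) else 0)"

lemma flat_exp_quotient_at_0:
  "((\<lambda>h. flat_exp k h / h) \<longlongrightarrow> 0) (at 0)"
proof -
  have l: "((\<lambda>h. flat_exp k h / h) \<longlongrightarrow> 0) (at_left 0)"
    by (rule tendsto_eventually) (auto simp: eventually_at_filter flat_exp_def)
  have "((\<lambda>h::real. inverse h ^ Suc k / exp (inverse h)) \<longlongrightarrow> 0) (at_right 0)"
    by (rule filterlim_compose[OF tendsto_power_div_exp_0 filterlim_inverse_at_top_right])
  moreover have "\<forall>\<^sub>F h in at_right 0. inverse h ^ Suc k / exp (inverse h) = flat_exp k h / h"
    by (auto simp: eventually_at_filter flat_exp_def exp_minus field_simps)
  ultimately have r: "((\<lambda>h. flat_exp k h / h) \<longlongrightarrow> 0) (at_right 0)"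
    by (rule Lim_transform_eventually)
  show ?thesis using l r by (simp add: filterlim_at_split)
qed

lemma flat_exp_deriv:
  "(flat_exp k has_real_derivative (flat_exp (k + 2) t - real k * flat_exp (k + 1) t)) (at t)"
proof -
  consider "t > 0" | "t < 0" | "t = 0" by linarith
  then show ?thesis
  proof cases
    case 1
    have d: "((\<lambda>t. 1 / t) has_real_derivative - ((1 / t) ^ 2)) (at t)"
      using 1 by (auto intro!: derivative_eq_intros simp: power2_eq_square)
    have "((\<lambda>t. (1 / t) ^ k) has_real_derivative - (real k * (1 / t) ^ (k + 1))) (at t)"
      using DERIV_power[OF d, of k] 1 by (cases k) (auto simp: power2_eq_square mult_ac)
    moreover have "((\<lambda>t. exp (- (1 / t))) has_real_derivative (1 / t) ^ 2 * exp (- (1 / t))) (at t)"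
      by (rule derivative_eq_intros d refl)+ simp
    ultimately have "((\<lambda>t. (1 / t) ^ k * exp (- (1 / t))) has_real_derivative
        - (real k * (1 / t) ^ (k + 1)) * exp (- (1 / t))
        + (1 / t) ^ 2 * exp (- (1 / t)) * (1 / t) ^ k) (at t)"
      by (rule DERIV_mult)
    also have "- (real k * (1 / t) ^ (k + 1)) * exp (- (1 / t))
        + (1 / t) ^ 2 * exp (- (1 / t)) * (1 / t) ^ k = flat_exp (k + 2) t - real k * flat_exp (k + 1) t"
      using 1 by (simp add: flat_exp_def power_add power2_eq_square field_simps)
    finally have "((\<lambda>t. (1 / t) ^ k * exp (- (1 / t))) has_real_derivative
        (flat_exp (k + 2) t - real k * flat_exp (k + 1) t)) (at t)" .
    then show ?thesis
      by (rule has_field_derivative_transform_within_open[of _ _ _ "{0<..}"])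
         (use 1 in \<open>auto simp: flat_exp_def\<close>)
  next
    case 2
    have "((\<lambda>t. 0) has_real_derivative (flat_exp (k + 2) t - real k * flat_exp (k + 1) t)) (at t)"
      using 2 by (simp add: flat_exp_def)
    then show ?thesis
      by (rule has_field_derivative_transform_within_open[of _ _ _ "{..<0}"])
         (use 2 in \<open>auto simp: flat_exp_def\<close>)
  next
    case 3
    then show ?thesis using flat_exp_quotient_at_0[of k] by (simp add: DERIV_def flat_exp_def)
  qed
qed

text \<open>Products of such functions of the distances to the faces of the box with corners \<open>a\<close> and \<open>b\<close>; the
exponents \<open>k\<close> and \<open>l\<close> belong to the lower and upper faces, and \<open>c\<close> controls the steepness.  Partial
derivatives are again linear combinations of such products.\<close>

definition box_bump :: "real \<Rightarrow> real ^ 'n \<Rightarrow> real ^ 'n \<Rightarrow> ('n \<Rightarrow> nat) \<Rightarrow> ('n \<Rightarrow> nat)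
    \<Rightarrow> real ^ 'n::finite \<Rightarrow> real" where
  "box_bump c a b k l x =
     (\<Prod>i\<in>UNIV. flat_exp (k i) (c * (x $ i - a $ i)) * flat_exp (l i) (c * (b $ i - x $ i)))"

lemma box_bump_split:
  "box_bump c a b k l x = flat_exp (k j) (c * (x $ j - a $ j)) * flat_exp (l j) (c * (b $ j - x $ j))
     * (\<Prod>i\<in>UNIV - {j}. flat_exp (k i) (c * (x $ i - a $ i)) * flat_exp (l i) (c * (b $ i - x $ i)))"
  unfolding box_bump_def by (rule prod.remove) auto

lemma box_bump_has_derivative:
  fixes a b :: "real ^ 'n::finite" and c :: real
  defines "h \<equiv> \<lambda>k l i t. flat_exp (k i) (c * (t - a $ i)) * flat_exp (l i) (c * (b $ i - t))"
  defines "h' \<equiv> \<lambda>k l i t.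
     c * (flat_exp (k i + 2) (c * (t - a $ i)) - real (k i) * flat_exp (k i + 1) (c * (t - a $ i)))
       * flat_exp (l i) (c * (b $ i - t))
     - c * (flat_exp (l i + 2) (c * (b $ i - t)) - real (l i) * flat_exp (l i + 1) (c * (b $ i - t)))
       * flat_exp (k i) (c * (t - a $ i))"
  shows "(box_bump c a b k l has_derivative
    (\<lambda>y. \<Sum>i\<in>UNIV. (h' k l i (x $ i) * y $ i) * (\<Prod>j\<in>UNIV - {i}. h k l j (x $ j)))) (at x)"
proof -
  have 1: "(h k l i has_real_derivative h' k l i t) (at t)" for i t
    unfolding h_def h'_def
    by (rule derivative_eq_intros DERIV_chain2[OF flat_exp_deriv] refl)+
       (simp add: algebra_simps)
  have "((\<lambda>x. h k l i (x $ i)) has_derivative (\<lambda>y. h' k l i (x $ i) * y $ i)) (at x)" for i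
  proof -
    have "(h k l i has_derivative (\<lambda>u. h' k l i (x $ i) * u)) (at (x $ i))"
      using 1[of i "x $ i"] by (simp add: has_field_derivative_def)
    moreover have "((\<lambda>x. x $ i) has_derivative (\<lambda>y. y $ i)) (at x)"
      by (intro bounded_linear_imp_has_derivative bounded_linear_vec_nth)
    ultimately show ?thesis
      using has_derivative_compose[of "\<lambda>x. x $ i" "\<lambda>y. y $ i" x UNIV "h k l i"] by simp
  qed
  then have "((\<lambda>x. \<Prod>i\<in>UNIV. h k l i (x $ i)) has_derivative
    (\<lambda>y. \<Sum>i\<in>UNIV. (h' k l i (x $ i) * y $ i) * (\<Prod>j\<in>UNIV - {i}. h k l j (x $ j)))) (at x)"
    by (intro has_derivative_prod) auto
  then show ?thesis by (simp add: h_def box_bump_def[abs_def])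
qed

lemma partial_deriv_box_bump:
  "partial_deriv j (box_bump c a b k l) x =
     c * box_bump c a b (k(j := k j + 2)) l x
     + (- c * real (k j)) * box_bump c a b (k(j := k j + 1)) l x
     + (- c) * box_bump c a b k (l(j := l j + 2)) x
     + c * real (l j) * box_bump c a b k (l(j := l j + 1)) x"
proof -
  have rest: "(\<Prod>i\<in>UNIV - {j}. flat_exp ((k'(j := u)) i) (c * (x $ i - a $ i)) *
        flat_exp ((l'(j := v)) i) (c * (b $ i - x $ i)))
    = (\<Prod>i\<in>UNIV - {j}. flat_exp (k' i) (c * (x $ i - a $ i)) * flat_exp (l' i) (c * (b $ i - x $ i)))"
    for k' l' u v by (rule prod.cong) auto
  note rest' = rest[where l' = l and v = "l j", simplified] rest[where k' = k and u = "k j", simplified]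
  have axis: "(\<Sum>i\<in>UNIV. (f i * axis j 1 $ i) * g i) = f j * g j" for f g :: "'a \<Rightarrow> real"
    by (subst sum.remove[of _ j]) (auto simp: axis_def)
  show ?thesis
    unfolding partial_deriv_eqI[OF box_bump_has_derivative] axis
    unfolding box_bump_split[of c a b _ _ x j] rest'
    by (simp add: algebra_simps)
qed

lemma Ck_on_box_bump: "Ck_on K UNIV (box_bump c a b k l)"
proof (induction K arbitrary: k l)
  case 0
  show ?case
    using box_bump_has_derivative has_derivative_continuous
    by (fastforce intro: continuous_at_imp_continuous_on)
next
  case (Suc K)
  have eq: "partial_deriv j (box_bump c a b k l) = (\<lambda>x.
     c * box_bump c a b (k(j := k j + 2)) l x
     + (- c * real (k j)) * box_bump c a b (k(j := k j + 1)) l x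
     + (- c) * box_bump c a b k (l(j := l j + 2)) x
     + c * real (l j) * box_bump c a b k (l(j := l j + 1)) x)" for j
    by (rule ext) (rule partial_deriv_box_bump)
  have "Ck_on K UNIV (partial_deriv j (box_bump c a b k l))" for j
    unfolding eq by (intro Ck_on_add Ck_on_cmult Suc.IH)
  moreover have "box_bump c a b k l differentiable (at x)" for x
    using box_bump_has_derivative unfolding differentiable_def by blast
  ultimately show ?case by simp
qed

text \<open>With all exponents \<open>0\<close> this is a test function with values in \<open>[0, 1]\<close>, positive exactly in the open
box, and it converges to the indicator function of the box as \<open>c\<close> tends to infinity.\<close>

abbreviation bump :: "real \<Rightarrow> real ^ 'n \<Rightarrow> real ^ 'n \<Rightarrow> real ^ 'n::finite \<Rightarrow> real" where
  "bump c a b \<equiv> box_bump c a b (\<lambda>_. 0) (\<lambda>_. 0)"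

lemma bump_bounds: "0 \<le> bump c a b x" "bump c a b x \<le> 1"
  unfolding box_bump_def flat_exp_def
  by (intro prod_nonneg prod_le_1; auto intro!: mult_nonneg_nonneg mult_le_one)+

lemma bump_nonzero_iff:
  assumes "c > 0" shows "bump c a b x \<noteq> 0 \<longleftrightarrow> x \<in> box a b"
  using assms by (auto simp: box_bump_def flat_exp_def mem_box_cart zero_less_mult_iff
      split: if_splits)

lemma bump_test_function:
  assumes "c > 0" "cbox a b \<subseteq> \<Omega>"
  shows "bump c a b \<in> test_functions \<Omega>"
proof -
  have "closure {x. bump c a b x \<noteq> 0} \<subseteq> cbox a b"
    using assms(1) by (intro closure_minimal) (auto simp: bump_nonzero_iff closed_cbox
        intro: box_subset_cbox[THEN subsetD])
  moreover have "compact (closure {x. bump c a b x \<noteq> 0})"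
    using assms(1) bounded_box by (simp add: bump_nonzero_iff)
  ultimately show ?thesis
    using assms(2) by (auto simp: test_functions_def smooth_fun_on_def Ck_on_box_bump)
qed

lemma bump_limit: "(\<lambda>n. bump (real (Suc n)) a b x) \<longlonglongrightarrow> indicator (box a b) x"
proof (cases "x \<in> box a b")
  case True
  have e: "(\<lambda>n. flat_exp 0 (real (Suc n) * d)) \<longlonglongrightarrow> 1" if d: "d > 0" for d
  proof -
    have "(\<lambda>n. exp (- ((1 / d) * (1 / real (Suc n))))) \<longlonglongrightarrow> exp (- ((1 / d) * 0))"
      by (intro tendsto_intros LIMSEQ_Suc lim_1_over_n)
    then show ?thesis using d by (simp add: flat_exp_def mult.commute)
  qed
  have "(\<lambda>n. bump (real (Suc n)) a b x) \<longlonglongrightarrow> (\<Prod>i\<in>(UNIV :: 'a set). 1 * 1)"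
    unfolding box_bump_def
    by (intro tendsto_prod tendsto_mult e) (use True in \<open>auto simp: mem_box_cart\<close>)
  then show ?thesis using True by simp
next
  case False
  then show ?thesis using bump_nonzero_iff[of "real (Suc n)" a b x for n] by simp
qed


section \<open>Integration by parts and the fundamental lemma of the calculus of variations\<close>

lemma partial_deriv_zero_outside:
  assumes "closed K" "\<And>x. x \<notin> K \<Longrightarrow> h x = 0" "x \<notin> K"
  shows "partial_deriv i h x = 0"
proof -
  have "((\<lambda>_. 0) has_derivative (\<lambda>_. 0)) (at x)" by simp
  then have "(h has_derivative (\<lambda>_. 0)) (at x)"
    by (rule has_derivative_transform_within_open[of _ _ _ UNIV "- K"])
       (use assms in \<open>auto simp: open_Compl\<close>)
  from partial_deriv_eqI[OF this] show ?thesis .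
qed

lemma DERIV_along_axis:
  assumes "\<And>x. h differentiable (at x)"
  shows "((\<lambda>t. h (x + t *\<^sub>R axis i 1)) has_real_derivative partial_deriv i h (x + t *\<^sub>R axis i 1)) (at t)"
proof -
  have "(h has_derivative frechet_derivative h (at (x + t *\<^sub>R axis i 1))) (at (x + t *\<^sub>R axis i 1))"
    using assms by (simp add: frechet_derivative_works[symmetric])
  moreover have "((\<lambda>t. x + t *\<^sub>R axis i 1) has_derivative (\<lambda>u. u *\<^sub>R axis i 1)) (at t)"
    by (auto intro!: derivative_eq_intros)
  ultimately have *: "((\<lambda>t. h (x + t *\<^sub>R axis i 1)) has_derivative
      (\<lambda>u. frechet_derivative h (at (x + t *\<^sub>R axis i 1)) (u *\<^sub>R axis i 1))) (at t)"
    using has_derivative_compose[of "\<lambda>t. x + t *\<^sub>R axis i 1" _ t UNIV h] by auto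
  have "linear (frechet_derivative h (at (x + t *\<^sub>R axis i 1)))"
    using assms by (intro linear_frechet_derivative) auto
  then show ?thesis
    using * by (simp add: has_field_derivative_def linear_cmul partial_deriv_def mult.commute[of _ "frechet_derivative h _ _"])
qed

lemma integrable_continuous_compact_support:
  fixes h :: "'a::euclidean_space \<Rightarrow> real"
  assumes "continuous_on UNIV h" "compact K" "\<And>x. x \<notin> K \<Longrightarrow> h x = 0"
  shows "integrable lborel h"
proof -
  have "integrable lborel (\<lambda>x. indicator K x *\<^sub>R h x)"
    using borel_integrable_compact[OF assms(2), of h] assms(1)
    by (auto intro: continuous_on_subset simp: set_integrable_def)
  moreover have "(\<lambda>x. indicator K x *\<^sub>R h x) = h"
    by (rule ext) (use assms(3) in \<open>auto simp: indicator_def\<close>)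
  ultimately show ?thesis by simp
qed

text \<open>The integral of a partial derivative of a compactly supported function vanishes, because the
  integrals of its difference quotients do, by translation invariance.\<close>

lemma integral_partial_deriv_zero:
  fixes h :: "real ^ 'n::finite \<Rightarrow> real"
  assumes diff: "\<And>x. h differentiable (at x)" and cont: "continuous_on UNIV (partial_deriv i h)"
    and K: "compact K" and supp: "\<And>x. x \<notin> K \<Longrightarrow> h x = 0"
  shows "(LINT x|lborel. partial_deriv i h x) = 0"
proof -
  let ?e = "axis i 1 :: real ^ 'n"
  define t where "t n = 1 / real (Suc n)" for n
  have t: "0 < t n" "t n \<le> 1" for n by (auto simp: t_def)
  have tlim: "t \<longlonglongrightarrow> 0" unfolding t_def using LIMSEQ_Suc[OF lim_1_over_n] by simp
  define q where "q n x = (h (x + t n *\<^sub>R ?e) - h x) / t n" for n x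
  have hc: "continuous_on UNIV h"
    using diff by (intro continuous_at_imp_continuous_on) (auto intro: differentiable_imp_continuous_within)
  have hb [measurable]: "h \<in> borel_measurable borel" by (rule borel_measurable_continuous_onI[OF hc])
  have int: "integrable lborel h" by (rule integrable_continuous_compact_support[OF hc K supp])
  obtain R where R: "\<And>x. x \<in> K \<Longrightarrow> norm x \<le> R" using compact_imp_bounded[OF K] by (auto simp: bounded_iff)
  obtain L where L: "\<And>x. x \<in> cball 0 (R + 2) \<Longrightarrow> \<bar>partial_deriv i h x\<bar> \<le> L"
  proof -
    have "compact (partial_deriv i h ` cball 0 (R + 2))"
      by (intro compact_continuous_image continuous_on_subset[OF cont]) auto
    from compact_imp_bounded[OF this] obtain L where
      "\<forall>y\<in>partial_deriv i h ` cball 0 (R + 2). norm y \<le> L" unfolding bounded_iff by blast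
    then show thesis by (intro that[of L]) auto
  qed
  have q0: "(LINT x|lborel. q n x) = 0" for n
  proof -
    have "(LINT x|lborel. h x) = (LINT x|distr lborel borel ((+) (t n *\<^sub>R ?e)). h x)"
      by (simp add: lborel_distr_plus)
    also have "\<dots> = (LINT x|lborel. h (t n *\<^sub>R ?e + x))" by (intro integral_distr) auto
    finally have eq: "(LINT x|lborel. h (x + t n *\<^sub>R ?e)) = (LINT x|lborel. h x)"
      by (simp add: add.commute)
    have "integrable (distr lborel borel ((+) (t n *\<^sub>R ?e))) h"
      using int by (simp add: lborel_distr_plus)
    then have "integrable lborel (\<lambda>x. h (t n *\<^sub>R ?e + x))"
      by (subst (asm) integrable_distr_eq) auto
    then show ?thesis using eq int by (simp add: q_def add.commute)
  qed
  have qlim: "(\<lambda>n. q n x) \<longlonglongrightarrow> partial_deriv i h x" for x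
  proof -
    have "((\<lambda>u. (h (x + (0 + u) *\<^sub>R ?e) - h (x + 0 *\<^sub>R ?e)) / u) \<longlongrightarrow> partial_deriv i h x) (at 0)"
      using DERIV_along_axis[OF diff, of x i 0] by (simp add: DERIV_def)
    moreover have "filterlim t (at 0) sequentially"
      using tlim t(1) by (auto simp: filterlim_at less_imp_neq[symmetric] intro!: always_eventually)
    ultimately show ?thesis using filterlim_compose by (fastforce simp: q_def)
  qed
  have qbd: "\<bar>q n x\<bar> \<le> indicator (cball 0 (R + 1)) x * L" for n x
  proof (cases "x \<in> cball 0 (R + 1)")
    case True
    obtain z where z: "0 < z" "z < t n"
      "h (x + t n *\<^sub>R ?e) - h (x + 0 *\<^sub>R ?e) = (t n - 0) * partial_deriv i h (x + z *\<^sub>R ?e)"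
      using MVT2[of 0 "t n" "\<lambda>u. h (x + u *\<^sub>R ?e)" "\<lambda>u. partial_deriv i h (x + u *\<^sub>R ?e)"]
        t(1) DERIV_along_axis[OF diff] by auto
    have "norm (x + z *\<^sub>R ?e) \<le> norm x + norm (z *\<^sub>R ?e)" by (rule norm_triangle_ineq)
    also have "\<dots> \<le> R + 2" using True z t(2)[of n] by (simp add: norm_axis_1)
    finally have "\<bar>partial_deriv i h (x + z *\<^sub>R ?e)\<bar> \<le> L" by (intro L) simp
    moreover have "q n x = partial_deriv i h (x + z *\<^sub>R ?e)" using z(3) t(1)[of n] by (simp add: q_def field_simps)
    ultimately show ?thesis using True by simp
  next
    case False
    have "norm x \<le> norm (x + t n *\<^sub>R ?e) + norm (t n *\<^sub>R ?e)"
      using norm_triangle_ineq4[of "x + t n *\<^sub>R ?e" "t n *\<^sub>R ?e"] by simp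
    then have "norm x \<le> norm (x + t n *\<^sub>R ?e) + 1" using t[of n] by (simp add: norm_axis_1)
    then have "h x = 0" "h (x + t n *\<^sub>R ?e) = 0"
      using False R[of x] R[of "x + t n *\<^sub>R ?e"] by (auto intro!: supp)
    then show ?thesis using False by (simp add: q_def)
  qed
  have "(\<lambda>n. LINT x|lborel. q n x) \<longlonglongrightarrow> (LINT x|lborel. partial_deriv i h x)"
  proof (rule integral_dominated_convergence)
    show "partial_deriv i h \<in> borel_measurable lborel"
      using borel_measurable_continuous_onI[OF cont] by simp
    show "q n \<in> borel_measurable lborel" for n unfolding q_def[abs_def] by measurable
    show "integrable lborel (\<lambda>x. indicator (cball 0 (R + 1)) x * L)"
      by (intro integrable_mult_left integrable_real_indicator emeasure_bounded_finite) auto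
  qed (use qlim qbd in auto)
  then show ?thesis using LIMSEQ_unique[OF _ tendsto_const[of 0]] by (simp add: q0)
qed

lemma test_functionD:
  assumes "\<phi> \<in> test_functions \<Omega>"
  obtains K where "compact K" "K \<subseteq> \<Omega>" "\<And>x. x \<notin> K \<Longrightarrow> \<phi> x = 0"
    "\<And>i x. x \<notin> K \<Longrightarrow> partial_deriv i \<phi> x = 0"
proof
  let ?K = "closure {x. \<phi> x \<noteq> 0}"
  show "compact ?K" "?K \<subseteq> \<Omega>" using assms by (auto simp: test_functions_def)
  show 0: "\<phi> x = 0" if "x \<notin> ?K" for x
    using that closure_subset[of "{x. \<phi> x \<noteq> 0}"] by auto
  show "partial_deriv i \<phi> x = 0" if "x \<notin> ?K" for i x
    by (rule partial_deriv_zero_outside[OF closed_closure 0 that])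
qed

lemma test_function_differentiable: "\<phi> \<in> test_functions \<Omega> \<Longrightarrow> \<phi> differentiable (at x)"
  and test_function_continuous_deriv: "\<phi> \<in> test_functions \<Omega> \<Longrightarrow> continuous_on UNIV (partial_deriv i \<phi>)"
  and test_function_continuous: "\<phi> \<in> test_functions \<Omega> \<Longrightarrow> continuous_on UNIV \<phi>"
proof -
  assume "\<phi> \<in> test_functions \<Omega>"
  then have k: "Ck_on k UNIV \<phi>" for k by (simp add: test_functions_def smooth_fun_on_def)
  show "\<phi> differentiable (at x)" "continuous_on UNIV (partial_deriv i \<phi>)"
    using k[of "Suc 0"] by auto
  show "continuous_on UNIV \<phi>" using k[of 0] by simp
qed

lemma zero_test_function: "(\<lambda>_. 0) \<in> test_functions \<Omega>"
proof -
  have 0: "partial_deriv i (\<lambda>_. 0) = (\<lambda>_::real^'a. 0)" for i :: 'a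
    by (rule ext) (rule partial_deriv_eqI[OF has_derivative_const, simplified])
  have "Ck_on k UNIV (\<lambda>_::real^'a. 0)" for k by (induction k) (auto simp: 0)
  then show ?thesis by (simp add: test_functions_def smooth_fun_on_def)
qed

lemma test_function_lincomb:
  assumes f: "\<phi> \<in> test_functions \<Omega>" and g: "\<psi> \<in> test_functions \<Omega>"
  shows "(\<lambda>x. a * \<phi> x + b * \<psi> x) \<in> test_functions \<Omega>"
proof -
  let ?K = "closure {x. \<phi> x \<noteq> 0} \<union> closure {x. \<psi> x \<noteq> 0}"
  have K: "compact ?K" "?K \<subseteq> \<Omega>" using f g by (auto simp: test_functions_def)
  have "\<phi> x \<noteq> 0 \<Longrightarrow> x \<in> ?K" "\<psi> x \<noteq> 0 \<Longrightarrow> x \<in> ?K" for x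
    using closure_subset[of "{x. \<phi> x \<noteq> 0}"] closure_subset[of "{x. \<psi> x \<noteq> 0}"] by blast+
  then have "{x. a * \<phi> x + b * \<psi> x \<noteq> 0} \<subseteq> ?K"
    by (intro subsetI) (metis (mono_tags) add.right_neutral mem_Collect_eq mult_zero_right)
  then have sub: "closure {x. a * \<phi> x + b * \<psi> x \<noteq> 0} \<subseteq> ?K"
    using K by (intro closure_minimal) (auto intro: compact_imp_closed)
  then have "compact (closure {x. a * \<phi> x + b * \<psi> x \<noteq> 0})"
    using K(1) by (meson bounded_subset closed_closure compact_eq_bounded_closed)
  then show ?thesis using f g sub K(2)
    by (auto simp: test_functions_def smooth_fun_on_def intro!: Ck_on_add Ck_on_cmult)
qed

lemma integral_lebesgue_on_zero_outside:
  fixes f :: "real ^ 'n::finite \<Rightarrow> real"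
  assumes "open \<Omega>" "continuous_on UNIV f" "\<And>x. x \<notin> \<Omega> \<Longrightarrow> f x = 0"
  shows "(LINT x|lebesgue_on \<Omega>. f x) = (LINT x|lborel. f x)"
proof -
  have "\<Omega> \<in> sets lebesgue" using assms(1) by simp
  then have "(LINT x|lebesgue_on \<Omega>. f x) = (LINT x|lebesgue. indicator \<Omega> x *\<^sub>R f x)"
    by (subst integral_restrict_space) auto
  also have "(\<lambda>x. indicator \<Omega> x *\<^sub>R f x) = f"
    by (rule ext) (use assms(3) in \<open>auto simp: indicator_def\<close>)
  also have "(LINT x|lebesgue. f x) = (LINT x|lborel. f x)"
    by (rule integral_completion) (simp add: borel_measurable_continuous_onI[OF assms(2)])
  finally show ?thesis .
qed

lemma integrable_lebesgue_on_continuous: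
  fixes f :: "real ^ 'n::finite \<Rightarrow> real"
  assumes "open \<Omega>" "continuous_on UNIV f" "compact K" "\<And>x. x \<notin> K \<Longrightarrow> f x = 0"
  shows "integrable (lebesgue_on \<Omega>) f"
proof -
  have "integrable lebesgue f"
    using integrable_continuous_compact_support[OF assms(2-4)]
      borel_measurable_continuous_onI[OF assms(2)] by (subst integrable_completion) auto
  then have "integrable lebesgue (\<lambda>x. indicator \<Omega> x *\<^sub>R f x)"
    using assms(1) by (intro integrable_mult_indicator) auto
  then show ?thesis using assms(1) by (subst integrable_restrict_space) auto
qed

text \<open>Integration by parts.\<close>

lemma test_function_has_weak_partial:
  assumes \<Omega>: "open \<Omega>" and f: "\<phi> \<in> test_functions \<Omega>"
  shows "has_weak_partial \<Omega> i \<phi> (partial_deriv i \<phi>)"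
  unfolding has_weak_partial_def
proof
  fix \<psi> assume g: "\<psi> \<in> test_functions \<Omega>"
  note c = test_function_continuous[OF f] test_function_continuous[OF g]
    test_function_continuous_deriv[OF f, of i] test_function_continuous_deriv[OF g, of i]
  obtain K where K: "compact K" "K \<subseteq> \<Omega>" "\<And>x. x \<notin> K \<Longrightarrow> \<phi> x = 0"
    "\<And>x. x \<notin> K \<Longrightarrow> partial_deriv i \<phi> x = 0" using test_functionD[OF f] by metis
  have K': "\<phi> x = 0" "partial_deriv i \<phi> x = 0" if "x \<notin> \<Omega>" for x
    using K(2-4) that by blast+
  have p: "partial_deriv i (\<lambda>x. \<phi> x * \<psi> x) = (\<lambda>x. \<phi> x * partial_deriv i \<psi> x + partial_deriv i \<phi> x * \<psi> x)"
    by (intro partial_deriv_mult test_function_differentiable[OF f] test_function_differentiable[OF g])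
  have "(LINT x|lborel. partial_deriv i (\<lambda>x. \<phi> x * \<psi> x) x) = 0"
    by (rule integral_partial_deriv_zero[OF _ _ K(1)])
       (auto simp: p K(3) intro!: differentiable_mult test_function_differentiable[OF f]
        test_function_differentiable[OF g] continuous_intros c)
  then have "(LINT x|lebesgue_on \<Omega>. \<phi> x * partial_deriv i \<psi> x + partial_deriv i \<phi> x * \<psi> x) = 0"
    unfolding p by (subst integral_lebesgue_on_zero_outside[OF \<Omega>])
      (use K' in \<open>auto intro!: continuous_intros c\<close>)
  moreover have "integrable (lebesgue_on \<Omega>) (\<lambda>x. \<phi> x * partial_deriv i \<psi> x)"
    "integrable (lebesgue_on \<Omega>) (\<lambda>x. partial_deriv i \<phi> x * \<psi> x)"
    by (rule integrable_lebesgue_on_continuous[OF \<Omega> _ K(1)]; use K in \<open>auto intro!: continuous_intros c\<close>)+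
  ultimately show "(LINT x|lebesgue_on \<Omega>. \<phi> x * partial_deriv i \<psi> x) =
      - (LINT x|lebesgue_on \<Omega>. partial_deriv i \<phi> x * \<psi> x)"
    by simp
qed

text \<open>Bump functions show that the integral of \<open>g\<close> vanishes on every open box whose closure lies in \<open>\<Omega>\<close>.
Inside a fixed such box \<open>B\<close> a Dynkin argument extends this to all Borel sets, then to all measurable
sets, among them \<open>B \<inter> {x. g x > 0}\<close>; finally \<open>\<Omega>\<close> is a countable union of closed boxes.\<close>

lemma AE_nonpos_if_orthogonal_test_functions:
  fixes g :: "real ^ 'n::finite \<Rightarrow> real"
  assumes \<Omega>: "open \<Omega>" and g: "integrable (lebesgue_on \<Omega>) g"
    and orth: "\<And>\<phi>. \<phi> \<in> test_functions \<Omega> \<Longrightarrow> (LINT x|lebesgue_on \<Omega>. g x * \<phi> x) = 0"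
  shows "AE x in lebesgue_on \<Omega>. g x \<le> 0"
proof -
  let ?M = "lebesgue_on \<Omega>"
  have gm [measurable]: "g \<in> borel_measurable ?M" using g by auto
  have int_A: "integrable ?M (\<lambda>x. g x * indicator A x)" if "A \<in> sets lebesgue" for A
  proof -
    have "A \<inter> \<Omega> \<in> sets ?M" using that \<Omega> by (auto simp: sets_restrict_space)
    from integrable_mult_indicator[OF this g] show ?thesis
      by (rule Bochner_Integration.integrable_cong[THEN iffD1, rotated 2]) (auto simp: indicator_def)
  qed
  have box0: "(LINT x|?M. g x * indicator (box a b) x) = 0" if ab: "cbox a b \<subseteq> \<Omega>" for a b
  proof -
    have "(\<lambda>n. LINT x|?M. g x * bump (real (Suc n)) a b x) \<longlonglongrightarrow> (LINT x|?M. g x * indicator (box a b) x)"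
    proof (rule integral_dominated_convergence[where w = "\<lambda>x. \<bar>g x\<bar>"])
      show "(\<lambda>x. g x * indicator (box a b) x) \<in> borel_measurable ?M"
        using int_A[of "box a b"] by auto
      show "(\<lambda>x. g x * bump (real (Suc n)) a b x) \<in> borel_measurable ?M" for n
      proof -
        have "bump (real (Suc n)) a b \<in> borel_measurable lebesgue"
          using borel_measurable_continuous_onI[OF Ck_on_imp_continuous[OF Ck_on_box_bump]]
          by (intro measurable_completion) auto
        then show ?thesis by (intro borel_measurable_times gm measurable_restrict_space1)
      qed
      show "AE x in ?M. norm (g x * bump (real (Suc n)) a b x) \<le> \<bar>g x\<bar>" for n
        using bump_bounds[of "real (Suc n)" a b] by (auto simp: abs_mult intro!: mult_left_le)
      show "AE x in ?M. (\<lambda>n. g x * bump (real (Suc n)) a b x) \<longlonglongrightarrow> g x * indicator (box a b) x"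
        by (intro AE_I2 tendsto_mult_left bump_limit)
    qed (use g in auto)
    moreover have "(LINT x|?M. g x * bump (real (Suc n)) a b x) = 0" for n
      by (intro orth bump_test_function ab) simp
    ultimately show ?thesis
      using LIMSEQ_unique[OF _ tendsto_const[of 0]] by simp
  qed
  have borel0: "(LINT x|?M. g x * indicator (A \<inter> box u v) x) = 0"
    if uv: "cbox u v \<subseteq> \<Omega>" and A: "A \<in> sets borel" for A u v
  proof -
    have "Int_stable (range (\<lambda>(a, b). box a b :: (real ^ 'n) set))"
      by (auto simp: Int_stable_def box_Int_box)
    moreover have "range (\<lambda>(a, b). box a b :: (real ^ 'n) set) \<subseteq> Pow UNIV" by simp
    moreover have "A \<in> sigma_sets UNIV (range (\<lambda>(a, b). box a b :: (real ^ 'n) set))"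
      using A by (simp add: borel_eq_box)
    ultimately have "A \<in> sets borel \<and> (LINT x|?M. g x * indicator (A \<inter> box u v) x) = 0"
    proof (induction rule: sigma_sets_induct_disjoint)
      case (basic A)
      then obtain a b where A: "A = box a b" by auto
      obtain c d where cd: "box a b \<inter> box u v = box c d" "cbox c d \<subseteq> cbox u v"
        using box_Int_box[of a b u v] Int_interval[of a b u v] by blast
      then show ?case using box0[of c d] uv by (auto simp: A)
    next
      case (compl A)
      have "A \<inter> box u v \<in> sets borel" using compl by (intro sets.Int) auto
      then have Ab: "A \<inter> box u v \<in> sets lebesgue" by simp
      have "(LINT x|?M. g x * indicator ((UNIV - A) \<inter> box u v) x)
          = (LINT x|?M. g x * indicator (box u v) x - g x * indicator (A \<inter> box u v) x)"
        by (intro Bochner_Integration.integral_cong) (auto simp: indicator_def)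
      also have "\<dots> = 0"
        using compl int_A[of "box u v"] int_A[of "A \<inter> box u v"] Ab box0[OF uv] by simp
      finally show ?case using compl by auto
    next
      case (union A)
      have A: "A i \<in> sets borel" "(LINT x|?M. g x * indicator (A i \<inter> box u v) x) = 0" for i
        using union.IH by auto
      have Ab: "(\<Union>i. A i) \<inter> box u v \<in> sets lebesgue" "(\<Union>i<n. A i) \<inter> box u v \<in> sets lebesgue"
        "A n \<inter> box u v \<in> sets lebesgue" for n
        using A(1) by (auto intro!: sets_completionI_sets sets.Int sets.countable_UN)
      have "(\<lambda>n. LINT x|?M. g x * indicator ((\<Union>i<n. A i) \<inter> box u v) x)
          \<longlonglongrightarrow> (LINT x|?M. g x * indicator ((\<Union>i. A i) \<inter> box u v) x)"
      proof (rule integral_dominated_convergence[where w = "\<lambda>x. \<bar>g x\<bar>"])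
        show "(\<lambda>x. g x * indicator ((\<Union>i. A i) \<inter> box u v) x) \<in> borel_measurable ?M"
          using int_A[OF Ab(1)] by auto
        show "(\<lambda>x. g x * indicator ((\<Union>i<n. A i) \<inter> box u v) x) \<in> borel_measurable ?M" for n
          using int_A[OF Ab(2)] by auto
        show "AE x in ?M. (\<lambda>n. g x * indicator ((\<Union>i<n. A i) \<inter> box u v) x)
            \<longlonglongrightarrow> g x * indicator ((\<Union>i. A i) \<inter> box u v) x"
          unfolding indicator_inter_arith
          by (intro AE_I2 tendsto_mult tendsto_const LIMSEQ_indicator_UN)
      qed (use g in \<open>auto simp: indicator_def\<close>)
      moreover have "(LINT x|?M. g x * indicator ((\<Union>i<n. A i) \<inter> box u v) x) = 0" for n
      proof -
        have eq: "g x * indicator ((\<Union>i<n. A i) \<inter> box u v) x = (\<Sum>i<n. g x * indicator (A i \<inter> box u v) x)" for x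
        proof -
          have "disjoint_family_on A {..<n}" using union.hyps(1) by (auto simp: disjoint_family_on_def)
          then have "indicator (\<Union>i<n. A i) x = (\<Sum>i<n. indicator (A i) x :: real)"
            by (intro indicator_UN_disjoint) auto
          then show ?thesis by (simp only: indicator_inter_arith sum_distrib_left sum_distrib_right mult.assoc)
        qed
        have "(LINT x|?M. g x * indicator ((\<Union>i<n. A i) \<inter> box u v) x)
            = (LINT x|?M. (\<Sum>i<n. g x * indicator (A i \<inter> box u v) x))"
          by (rule Bochner_Integration.integral_cong[OF refl eq])
        also have "\<dots> = (\<Sum>i<n. (LINT x|?M. g x * indicator (A i \<inter> box u v) x))"
          by (rule Bochner_Integration.integral_sum) (rule int_A[OF Ab(3)])
        finally show ?thesis by (simp add: A(2))
      qed
      ultimately have "(LINT x|?M. g x * indicator ((\<Union>i. A i) \<inter> box u v) x) = 0"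
        using LIMSEQ_unique[OF _ tendsto_const[of 0]] by simp
      then show ?case using A by auto
    qed simp
    then show ?thesis by simp
  qed
  have box_AE: "AE x in ?M. x \<in> cbox u v \<longrightarrow> g x \<le> 0" if uv: "cbox u v \<subseteq> \<Omega>" for u v
  proof -
    define P where "P = {x \<in> space ?M. g x > 0}"
    have "P \<in> sets ?M" unfolding P_def by measurable
    then have P: "P \<in> sets lebesgue" using \<Omega> by (auto simp: sets_restrict_space_iff)
    have Pb: "P \<inter> box u v \<in> sets lebesgue" using P by (intro sets.Int) auto
    obtain C T where C: "fsigma C" "negligible T" "C \<union> T = P"
      using lebesgue_set_almost_fsigma[OF P] by (metis negligible_iff_null_sets)
    have neg: "AE x in ?M. x \<notin> S" if "negligible S" for S
      using that \<Omega> AE_not_in[of S lebesgue]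
      by (auto simp: AE_restrict_space_iff negligible_iff_null_sets elim: eventually_mono)
    have Cb: "C \<in> sets borel" using C(1) by (auto simp: fsigma.simps)
    have "(LINT x|?M. g x * indicator (P \<inter> box u v) x) = (LINT x|?M. g x * indicator (C \<inter> box u v) x)"
    proof (rule integral_cong_AE)
      show "AE x in ?M. g x * indicator (P \<inter> box u v) x = g x * indicator (C \<inter> box u v) x"
        using neg[OF C(2)] by eventually_elim (use C(3) in \<open>auto simp: indicator_def\<close>)
    qed (use int_A[OF Pb] int_A[of "C \<inter> box u v"] Cb in auto)
    also have "\<dots> = 0" by (rule borel0[OF uv Cb])
    finally have "AE x in ?M. g x * indicator (P \<inter> box u v) x = 0"
      using int_A[OF Pb]
      by (subst (asm) integral_nonneg_eq_0_iff_AE) (auto simp: P_def indicator_def)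
    moreover have "AE x in ?M. x \<notin> cbox u v - box u v"
      using negligible_frontier_interval(1)[of u v] by (rule neg)
    ultimately show ?thesis
      using AE_space by eventually_elim (auto simp: P_def indicator_def split: if_splits)
  qed
  obtain D where D: "countable D" "D \<subseteq> Pow \<Omega>" "\<And>X. X \<in> D \<Longrightarrow> \<exists>a b. X = cbox a b" "\<Union>D = \<Omega>"
    using open_countable_Union_open_cbox[OF \<Omega>] by metis
  have "AE x in ?M. \<forall>X\<in>D. x \<in> X \<longrightarrow> g x \<le> 0"
    unfolding AE_ball_countable[OF D(1)]
  proof
    fix X assume X: "X \<in> D"
    then obtain a b where "X = cbox a b" using D(3) by blast
    then show "AE x in ?M. x \<in> X \<longrightarrow> g x \<le> 0" using box_AE[of a b] D(2) X by auto
  qed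
  then show ?thesis using AE_space
    by eventually_elim (use D(4) in auto)
qed

lemma AE_zero_if_orthogonal_test_functions:
  fixes g :: "real ^ 'n::finite \<Rightarrow> real"
  assumes \<Omega>: "open \<Omega>" and g: "integrable (lebesgue_on \<Omega>) g"
    and orth: "\<And>\<phi>. \<phi> \<in> test_functions \<Omega> \<Longrightarrow> (LINT x|lebesgue_on \<Omega>. g x * \<phi> x) = 0"
  shows "AE x in lebesgue_on \<Omega>. g x = 0"
proof -
  have "AE x in lebesgue_on \<Omega>. g x \<le> 0"
    using assms by (rule AE_nonpos_if_orthogonal_test_functions)
  moreover have "AE x in lebesgue_on \<Omega>. - g x \<le> 0"
    by (rule AE_nonpos_if_orthogonal_test_functions[OF \<Omega>]) (use g orth in auto)
  ultimately show ?thesis by eventually_elim simp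
qed


section \<open>Completeness of the space of square-integrable functions\<close>

text \<open>Square-integrable real functions on a measure space, without identification of functions that agree
almost everywhere.\<close>

definition L2_space :: "'a measure \<Rightarrow> ('a \<Rightarrow> real) set" where
  "L2_space M = {u \<in> borel_measurable M. integrable M (\<lambda>x. (u x)\<^sup>2)}"

lemma L2_space_measurable [measurable_dest]: "u \<in> L2_space M \<Longrightarrow> u \<in> borel_measurable M"
  by (simp add: L2_space_def)

lemma L2_space_integrable_mult:
  assumes "u \<in> L2_space M" "v \<in> L2_space M"
  shows "integrable M (\<lambda>x. u x * v x)"
proof (rule Bochner_Integration.integrable_bound)
  show "integrable M (\<lambda>x. (u x)\<^sup>2 + (v x)\<^sup>2)" using assms by (simp add: L2_space_def)
  show "(\<lambda>x. u x * v x) \<in> borel_measurable M" using assms by measurable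
  show "AE x in M. norm (u x * v x) \<le> norm ((u x)\<^sup>2 + (v x)\<^sup>2)"
  proof (rule AE_I2)
    fix x
    have "2 * (\<bar>u x\<bar> * \<bar>v x\<bar>) \<le> (u x)\<^sup>2 + (v x)\<^sup>2"
      using sum_squares_bound[of "\<bar>u x\<bar>" "\<bar>v x\<bar>"] by simp
    moreover have "0 \<le> \<bar>u x\<bar> * \<bar>v x\<bar>" by simp
    ultimately have "\<bar>u x\<bar> * \<bar>v x\<bar> \<le> (u x)\<^sup>2 + (v x)\<^sup>2" by linarith
    then show "norm (u x * v x) \<le> norm ((u x)\<^sup>2 + (v x)\<^sup>2)" by (simp add: abs_mult)
  qed
qed

lemma L2_space_bounded_mult:
  assumes u: "u \<in> L2_space M" and b [measurable]: "b \<in> borel_measurable M"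
    and le: "AE x in M. \<bar>b x\<bar> \<le> C"
  shows "(\<lambda>x. b x * u x) \<in> L2_space M"
proof -
  have [measurable]: "u \<in> borel_measurable M" using u by measurable
  have "integrable M (\<lambda>x. (b x * u x)\<^sup>2)"
  proof (rule Bochner_Integration.integrable_bound)
    show "integrable M (\<lambda>x. C\<^sup>2 * (u x)\<^sup>2)" using u by (simp add: L2_space_def)
    show "AE x in M. norm ((b x * u x)\<^sup>2) \<le> norm (C\<^sup>2 * (u x)\<^sup>2)"
      using le
    proof eventually_elim
      case (elim x)
      have "(b x)\<^sup>2 \<le> C\<^sup>2" using elim by (metis abs_ge_zero order_trans power2_abs power_mono)
      then show ?case by (simp add: power_mult_distrib mult_right_mono)
    qed
  qed measurable
  then show ?thesis by (simp add: L2_space_def)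
qed

lemma subspace_L2_space: "subspace (L2_space M)"
proof (rule subspaceI)
  show "0 \<in> L2_space M" by (simp add: L2_space_def zero_fun_def)
next
  fix u v assume uv: "u \<in> L2_space M" "v \<in> L2_space M"
  have "integrable M (\<lambda>x. (u x)\<^sup>2 + 2 * (u x * v x) + (v x)\<^sup>2)"
    using uv L2_space_integrable_mult[OF uv] by (simp add: L2_space_def)
  then have "integrable M (\<lambda>x. (u x + v x)\<^sup>2)" by (simp add: power2_sum algebra_simps)
  then show "u + v \<in> L2_space M" using uv by (auto simp: L2_space_def plus_fun_def)
next
  fix c u assume "u \<in> L2_space M"
  then show "c *\<^sub>R u \<in> L2_space M" by (auto simp: L2_space_def scaleR_fun_def power_mult_distrib)
qed

lemma semi_inner_space_L2: "semi_inner_space (L2_space M) (\<lambda>u v. LINT x|M. u x * v x)"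
proof
  show "subspace (L2_space M)" by (rule subspace_L2_space)
  show "(LINT x|M. (u + v) x * w x) = (LINT x|M. u x * w x) + (LINT x|M. v x * w x)"
    if "u \<in> L2_space M" "v \<in> L2_space M" "w \<in> L2_space M" for u v w
    using that by (simp add: distrib_right L2_space_integrable_mult)
  show "(LINT x|M. (c *\<^sub>R u) x * v x) = c * (LINT x|M. u x * v x)" for c u v
    by (simp add: mult.assoc)
  show "(LINT x|M. u x * v x) = (LINT x|M. v x * u x)" for u v :: "'a \<Rightarrow> real"
    by (intro Bochner_Integration.integral_cong refl mult.commute)
qed simp

lemma tendsto_suminf_shift:
  fixes f :: "nat \<Rightarrow> real"
  assumes "summable f" shows "(\<lambda>n. \<Sum>i. f (i + n)) \<longlonglongrightarrow> 0"
proof -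
  have "(\<lambda>n. suminf f - (\<Sum>i<n. f i)) \<longlonglongrightarrow> suminf f - suminf f"
    by (intro tendsto_intros summable_LIMSEQ assms)
  then show ?thesis using assms by (simp add: suminf_minus_initial_segment)
qed

text \<open>Riesz-Fischer theorem on a finite measure space.  The increments are summable in \<open>L\<^sup>1\<close>, hence almost
everywhere, and Fatou's lemma turns the pointwise limit into a limit in \<open>L\<^sup>2\<close>.\<close>

lemma complete_L2:
  assumes "finite_measure M"
  shows "complete_semi_inner_space (L2_space M) (\<lambda>u v. LINT x|M. u x * v x)"
proof -
  interpret finite_measure M by fact
  interpret semi_inner_space "L2_space M" "\<lambda>u v. LINT x|M. u x * v x" by (rule semi_inner_space_L2)
  show ?thesis
  proof (unfold_locales, goal_cases)
    case (1 X)
    then have X: "\<And>n. X n \<in> L2_space M" and sm: "summable (\<lambda>n. nrm (X (Suc n) - X n))" by auto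
    have Xm [measurable]: "X n \<in> borel_measurable M" for n using X by measurable
    have one: "(\<lambda>_. 1) \<in> L2_space M" by (simp add: L2_space_def)
    define d where "d n x = \<bar>X (Suc n) x - X n x\<bar>" for n x
    have dm [measurable]: "d n \<in> borel_measurable M" for n unfolding d_def[abs_def] by measurable
    have dL: "d n \<in> L2_space M" for n
      using closed_ops(4)[OF X[of "Suc n"] X[of n]] by (simp add: L2_space_def d_def fun_diff_def)
    have dn: "nrm (d n) = nrm (X (Suc n) - X n)" for n by (simp add: nrm_def d_def)
    have dint: "integrable M (d n)" for n using L2_space_integrable_mult[OF dL one] by simp
    have dle: "(LINT x|M. d n x) \<le> nrm (X (Suc n) - X n) * nrm (\<lambda>_. 1)" for n
      using Cauchy_Schwarz[OF dL one, of n] by (simp add: dn)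
    have dnn: "0 \<le> (LINT x|M. d n x)" for n by (simp add: d_def)
    have dsum: "summable (\<lambda>n. LINT x|M. d n x)"
      by (rule summable_comparison_test'[OF summable_mult2[OF sm, of "nrm (\<lambda>_. 1)"]])
         (use dle dnn in auto)
    have "(\<integral>\<^sup>+x. (\<Sum>n. ennreal (d n x)) \<partial>M) = (\<Sum>n. \<integral>\<^sup>+x. ennreal (d n x) \<partial>M)"
      by (intro nn_integral_suminf) measurable
    also have "\<dots> = (\<Sum>n. ennreal (LINT x|M. d n x))"
      by (intro suminf_cong nn_integral_eq_integral dint) (simp add: d_def)
    also have "\<dots> \<noteq> \<infinity>" using dsum dnn by (simp add: suminf_ennreal2)
    finally have "AE x in M. (\<Sum>n. ennreal (d n x)) \<noteq> \<infinity>"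
      by (intro nn_integral_noteq_infinite) measurable
    then have conv: "AE x in M. convergent (\<lambda>n. X n x)"
    proof eventually_elim
      case (elim x)
      then have "summable (\<lambda>n. d n x)"
        by (intro summable_suminf_not_top) (auto simp: d_def)
      then have "summable (\<lambda>n. X (Suc n) x - X n x)"
        unfolding d_def by (rule summable_rabs_cancel)
      then have "convergent (\<lambda>n. \<Sum>i<n. X (Suc i) x - X i x)" by (simp add: summable_iff_convergent)
      then have "convergent (\<lambda>n. X n x - X 0 x)"
        by (simp only: sum_lessThan_telescope[of "\<lambda>n. X n x"])
      then have "convergent (\<lambda>n. (X n x - X 0 x) + X 0 x)"
        by (intro convergent_add convergent_const)
      then show ?case by simp
    qed
    define u where "u x = lim (\<lambda>n. X n x)" for x
    have um [measurable]: "u \<in> borel_measurable M" unfolding u_def[abs_def] by measurable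
    have ulim: "AE x in M. (\<lambda>n. X n x) \<longlonglongrightarrow> u x"
      using conv by eventually_elim (simp add: u_def convergent_LIMSEQ_iff)
    define T where "T n = (\<Sum>i. nrm (X (Suc (i + n)) - X (i + n)))" for n
    have Fatou: "(\<integral>\<^sup>+x. ennreal ((X n x - u x)\<^sup>2) \<partial>M) \<le> ennreal ((T n)\<^sup>2)" for n
    proof -
      have "(\<integral>\<^sup>+x. ennreal ((X n x - u x)\<^sup>2) \<partial>M) = (\<integral>\<^sup>+x. liminf (\<lambda>k. ennreal ((X n x - X k x)\<^sup>2)) \<partial>M)"
      proof (rule nn_integral_cong_AE)
        show "AE x in M. ennreal ((X n x - u x)\<^sup>2) = liminf (\<lambda>k. ennreal ((X n x - X k x)\<^sup>2))"
          using ulim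
        proof eventually_elim
          case (elim x)
          have "(\<lambda>k. ennreal ((X n x - X k x)\<^sup>2)) \<longlonglongrightarrow> ennreal ((X n x - u x)\<^sup>2)"
            by (intro tendsto_intros tendsto_ennrealI elim)
          then show ?case by (rule lim_imp_Liminf[OF trivial_limit_sequentially, symmetric])
        qed
      qed
      also have "\<dots> \<le> liminf (\<lambda>k. \<integral>\<^sup>+x. ennreal ((X n x - X k x)\<^sup>2) \<partial>M)"
        by (intro nn_integral_liminf) measurable
      also have "\<dots> \<le> ennreal ((T n)\<^sup>2)"
      proof (rule Liminf_le)
        show "\<forall>\<^sub>F k in sequentially. (\<integral>\<^sup>+x. ennreal ((X n x - X k x)\<^sup>2) \<partial>M) \<le> ennreal ((T n)\<^sup>2)"
          using eventually_ge_at_top[of n]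
        proof eventually_elim
          case (elim k)
          have L: "X n - X k \<in> L2_space M" using X by blast
          then have "(\<integral>\<^sup>+x. ennreal ((X n x - X k x)\<^sup>2) \<partial>M) = ennreal (LINT x|M. (X n x - X k x)\<^sup>2)"
            by (intro nn_integral_eq_integral) (auto simp: L2_space_def)
          also have "(LINT x|M. (X n x - X k x)\<^sup>2) = (nrm (X n - X k))\<^sup>2"
            using nrm_sq[OF L] by (simp add: power2_eq_square)
          also have "\<dots> \<le> (T n)\<^sup>2"
            using nrm_tail[OF X sm elim] nrm_minus_commute[OF X X, of n k] nrm_nonneg[OF L]
            by (intro power_mono) (auto simp: T_def)
          finally show ?case by (simp add: ennreal_leI)
        qed
      qed simp
      finally show ?thesis .
    qed
    have diffL: "X n - u \<in> L2_space M" for n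
    proof -
      have "(\<integral>\<^sup>+x. ennreal (norm ((X n x - u x)\<^sup>2)) \<partial>M) < \<infinity>"
        using Fatou[of n] by (simp add: order_le_less_trans)
      then have "integrable M (\<lambda>x. (X n x - u x)\<^sup>2)" by (intro integrableI_bounded) measurable
      then show ?thesis by (simp add: L2_space_def fun_diff_def)
    qed
    have "u = X 0 - (X 0 - u)" by simp
    then have uL: "u \<in> L2_space M" using closed_ops(4)[OF X[of 0] diffL[of 0]] by simp
    have Tn: "0 \<le> T n" for n
      unfolding T_def using sm summable_iff_shift[of "\<lambda>i. nrm (X (Suc i) - X i)" n]
      by (intro suminf_nonneg) (auto intro!: nrm_nonneg closed_ops X)
    have le: "nrm (X n - u) \<le> T n" for n
    proof (rule power2_le_imp_le)
      have "ennreal ((nrm (X n - u))\<^sup>2) = ennreal (LINT x|M. (X n x - u x)\<^sup>2)"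
        using nrm_sq[OF diffL] by (simp add: power2_eq_square)
      also have "\<dots> = (\<integral>\<^sup>+x. ennreal ((X n x - u x)\<^sup>2) \<partial>M)"
        using diffL[of n] by (intro nn_integral_eq_integral[symmetric]) (auto simp: L2_space_def)
      also note Fatou[of n]
      finally show "(nrm (X n - u))\<^sup>2 \<le> (T n)\<^sup>2" by simp
    qed (rule Tn)
    have "(\<lambda>n. nrm (X n - u)) \<longlonglongrightarrow> 0"
    proof (rule tendsto_sandwich[OF _ _ tendsto_const])
      show "T \<longlonglongrightarrow> 0" unfolding T_def using tendsto_suminf_shift[OF sm] by simp
    qed (use le diffL in auto)
    then show ?case using uL by blast
  qed
qed


section \<open>Real Sobolev spaces on a bounded open set\<close>

lemma L2_real_eq: "L2_real \<Omega> = L2_space (lebesgue_on \<Omega>)"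
  by (simp add: L2_real_def L2_space_def)

locale bounded_domain =
  fixes \<Omega> :: "(real ^ 'n::finite) set"
  assumes domain_open: "open \<Omega>" and domain_bounded: "bounded \<Omega>"
begin

abbreviation M where "M \<equiv> lebesgue_on \<Omega>"

lemma finite_measure_M: "finite_measure M"
  using lmeasurable_open[OF domain_bounded domain_open]
  by (intro finite_measure_lebesgue_on)

sublocale L2: complete_semi_inner_space "L2_real \<Omega>" "\<lambda>u v. LINT x|M. u x * v x"
  unfolding L2_real_eq by (intro complete_L2 finite_measure_M)

lemma L2_measurable [measurable_dest]: "u \<in> L2_real \<Omega> \<Longrightarrow> u \<in> borel_measurable M"
  by (simp add: L2_real_def)

lemma L2_integrable_mult: "u \<in> L2_real \<Omega> \<Longrightarrow> v \<in> L2_real \<Omega> \<Longrightarrow> integrable M (\<lambda>x. u x * v x)"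
  unfolding L2_real_eq by (rule L2_space_integrable_mult)

lemma L2_nrm: "L2.nrm u = sqrt (LINT x|M. (u x)\<^sup>2)"
  by (simp add: L2.nrm_def power2_eq_square)

lemma ip_cong_AE:
  fixes u u' v v' :: "real ^ 'n \<Rightarrow> real"
  assumes "u \<in> borel_measurable M" "u' \<in> borel_measurable M" "v \<in> borel_measurable M"
    "v' \<in> borel_measurable M" "AE x in M. u x = u' x" "AE x in M. v x = v' x"
  shows "(LINT x|M. u x * v x) = (LINT x|M. u' x * v' x)"
proof (rule integral_cong_AE)
  show "AE x in M. u x * v x = u' x * v' x" using assms(5,6) by eventually_elim simp
qed (intro borel_measurable_times assms)+

lemma L2_nrm_cong_AE:
  assumes "u \<in> borel_measurable M" "v \<in> borel_measurable M" "AE x in M. u x = v x"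
  shows "L2.nrm u = L2.nrm v"
  unfolding L2.nrm_def using ip_cong_AE[OF assms(1,2,1,2,3,3)] by simp

lemma L2_nrm_zero_AE:
  assumes "u \<in> L2_real \<Omega>" "L2.nrm u = 0"
  shows "AE x in M. u x = 0"
proof -
  have "(LINT x|M. (u x)\<^sup>2) = 0" using assms by (simp add: L2_nrm)
  then have "AE x in M. (u x)\<^sup>2 = 0"
    using assms(1) by (subst (asm) integral_nonneg_eq_0_iff_AE) (auto simp: L2_real_def)
  then show ?thesis by simp
qed

lemma test_function_L2:
  assumes "\<phi> \<in> test_functions \<Omega>"
  shows "\<phi> \<in> L2_real \<Omega>" "partial_deriv i \<phi> \<in> L2_real \<Omega>"
proof -
  obtain K where K: "compact K" "K \<subseteq> \<Omega>" "\<And>x. x \<notin> K \<Longrightarrow> \<phi> x = 0"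
    "\<And>x. x \<notin> K \<Longrightarrow> partial_deriv i \<phi> x = 0" using test_functionD[OF assms] by metis
  have *: "h \<in> L2_real \<Omega>" if h: "continuous_on UNIV h" "\<And>x. x \<notin> K \<Longrightarrow> h x = 0" for h
  proof -
    have "integrable M (\<lambda>x. (h x)\<^sup>2)"
      by (rule integrable_lebesgue_on_continuous[OF domain_open _ K(1)])
         (use h in \<open>auto intro!: continuous_intros\<close>)
    moreover have "integrable M h"
      by (rule integrable_lebesgue_on_continuous[OF domain_open _ K(1)]) (use h in auto)
    ultimately show ?thesis by (auto simp: L2_real_def)
  qed
  show "\<phi> \<in> L2_real \<Omega>" by (intro * test_function_continuous[OF assms] K)
  show "partial_deriv i \<phi> \<in> L2_real \<Omega>"
    by (intro * test_function_continuous_deriv[OF assms] K)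
qed

lemma has_weak_partial_lincomb:
  assumes "u \<in> L2_real \<Omega>" "g \<in> L2_real \<Omega>" "has_weak_partial \<Omega> i u g"
    "v \<in> L2_real \<Omega>" "h \<in> L2_real \<Omega>" "has_weak_partial \<Omega> i v h"
  shows "has_weak_partial \<Omega> i (a *\<^sub>R u + b *\<^sub>R v) (a *\<^sub>R g + b *\<^sub>R h)"
  unfolding has_weak_partial_def
proof
  fix \<phi> assume p: "\<phi> \<in> test_functions \<Omega>"
  note t = test_function_L2[OF p]
  have "(LINT x|M. (a *\<^sub>R u + b *\<^sub>R v) x * partial_deriv i \<phi> x)
    = a * (LINT x|M. u x * partial_deriv i \<phi> x) + b * (LINT x|M. v x * partial_deriv i \<phi> x)"
    using assms(1,4) t(2)[of i]
    by (simp only: L2.ip_add L2.ip_scale L2.closed_ops)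
  also have "\<dots> = - (a * (LINT x|M. g x * \<phi> x) + b * (LINT x|M. h x * \<phi> x))"
    using assms(3,6) p by (simp add: has_weak_partial_def)
  also have "\<dots> = - (LINT x|M. (a *\<^sub>R g + b *\<^sub>R h) x * \<phi> x)"
    using assms(2,5) t(1)
    by (simp only: L2.ip_add L2.ip_scale L2.closed_ops)
  finally show "(LINT x|M. (a *\<^sub>R u + b *\<^sub>R v) x * partial_deriv i \<phi> x) =
    - (LINT x|M. (a *\<^sub>R g + b *\<^sub>R h) x * \<phi> x)" .
qed

text \<open>Almost everywhere uniqueness of weak derivatives, which makes the chosen representative
\<open>weak_partial\<close> linear up to null sets.\<close>

lemma weak_partial_unique:
  assumes "g \<in> L2_real \<Omega>" "h \<in> L2_real \<Omega>" "has_weak_partial \<Omega> i u g" "has_weak_partial \<Omega> i u h"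
  shows "AE x in M. g x = h x"
proof -
  have gh: "g - h \<in> L2_real \<Omega>" using assms by blast
  have one: "(\<lambda>_. 1) \<in> L2_real \<Omega>"
    using finite_measure_M by (simp add: L2_real_def finite_measure.integrable_const)
  have "AE x in M. (g - h) x = 0"
  proof (rule AE_zero_if_orthogonal_test_functions[OF domain_open])
    show "integrable M (g - h)" using L2_integrable_mult[OF gh one] by (simp add: fun_diff_def)
    show "(LINT x|M. (g - h) x * \<phi> x) = 0" if p: "\<phi> \<in> test_functions \<Omega>" for \<phi>
      using assms p L2.ip_diff[OF assms(1,2) test_function_L2(1)[OF p]]
      by (simp add: has_weak_partial_def)
  qed
  then show ?thesis by simp
qed

lemma H1_D:
  assumes "u \<in> H1_real \<Omega>"
  shows "u \<in> L2_real \<Omega>" "weak_partial \<Omega> i u \<in> L2_real \<Omega>"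
    "has_weak_partial \<Omega> i u (weak_partial \<Omega> i u)"
proof -
  have "\<exists>g. g \<in> L2_real \<Omega> \<and> has_weak_partial \<Omega> i u g" using assms by (auto simp: H1_real_def)
  from someI_ex[OF this] show "weak_partial \<Omega> i u \<in> L2_real \<Omega>"
    "has_weak_partial \<Omega> i u (weak_partial \<Omega> i u)" by (auto simp: weak_partial_def)
  show "u \<in> L2_real \<Omega>" using assms by (simp add: H1_real_def)
qed

lemma weak_partial_measurable [measurable]:
  "u \<in> H1_real \<Omega> \<Longrightarrow> weak_partial \<Omega> i u \<in> borel_measurable M"
  using H1_D(2) by measurable

lemma weak_partial_eqI:
  assumes "u \<in> L2_real \<Omega>" "g \<in> L2_real \<Omega>" "has_weak_partial \<Omega> i u g"
    and "u \<in> H1_real \<Omega>"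
  shows "AE x in M. weak_partial \<Omega> i u x = g x"
  by (rule weak_partial_unique[OF H1_D(2)[OF assms(4)] assms(2) H1_D(3)[OF assms(4)] assms(3)])

lemma H1_lincomb:
  assumes "u \<in> H1_real \<Omega>" "v \<in> H1_real \<Omega>"
  shows "a *\<^sub>R u + b *\<^sub>R v \<in> H1_real \<Omega>"
    and "AE x in M. weak_partial \<Omega> i (a *\<^sub>R u + b *\<^sub>R v) x = a * weak_partial \<Omega> i u x + b * weak_partial \<Omega> i v x"
proof -
  have L: "a *\<^sub>R u + b *\<^sub>R v \<in> L2_real \<Omega>" using assms H1_D(1) by blast
  have g: "a *\<^sub>R weak_partial \<Omega> i u + b *\<^sub>R weak_partial \<Omega> i v \<in> L2_real \<Omega>" for i
    using assms H1_D(2) by blast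
  have w: "has_weak_partial \<Omega> i (a *\<^sub>R u + b *\<^sub>R v) (a *\<^sub>R weak_partial \<Omega> i u + b *\<^sub>R weak_partial \<Omega> i v)" for i
    by (intro has_weak_partial_lincomb H1_D assms)
  show H: "a *\<^sub>R u + b *\<^sub>R v \<in> H1_real \<Omega>" using L g w by (auto simp: H1_real_def)
  show "AE x in M. weak_partial \<Omega> i (a *\<^sub>R u + b *\<^sub>R v) x = a * weak_partial \<Omega> i u x + b * weak_partial \<Omega> i v x"
    using weak_partial_eqI[OF L g w H] by simp
qed

text \<open>The inner product of the Sobolev space; it induces \<open>H1_norm\<close>.\<close>

definition H1_ip :: "(real ^ 'n \<Rightarrow> real) \<Rightarrow> (real ^ 'n \<Rightarrow> real) \<Rightarrow> real" where
  "H1_ip u v = (LINT x|M. u x * v x) + (\<Sum>i\<in>UNIV. LINT x|M. weak_partial \<Omega> i u x * weak_partial \<Omega> i v x)"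

lemma H1_ip_lincomb:
  assumes "u \<in> H1_real \<Omega>" "v \<in> H1_real \<Omega>" "w \<in> H1_real \<Omega>"
  shows "H1_ip (a *\<^sub>R u + b *\<^sub>R v) w = a * H1_ip u w + b * H1_ip v w"
proof -
  have "(LINT x|M. weak_partial \<Omega> i (a *\<^sub>R u + b *\<^sub>R v) x * weak_partial \<Omega> i w x)
      = a * (LINT x|M. weak_partial \<Omega> i u x * weak_partial \<Omega> i w x)
      + b * (LINT x|M. weak_partial \<Omega> i v x * weak_partial \<Omega> i w x)" for i
  proof -
    have "(LINT x|M. weak_partial \<Omega> i (a *\<^sub>R u + b *\<^sub>R v) x * weak_partial \<Omega> i w x)
      = (LINT x|M. (a *\<^sub>R weak_partial \<Omega> i u + b *\<^sub>R weak_partial \<Omega> i v) x * weak_partial \<Omega> i w x)"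
    proof (rule ip_cong_AE)
      show "AE x in M. weak_partial \<Omega> i (a *\<^sub>R u + b *\<^sub>R v) x
          = (a *\<^sub>R weak_partial \<Omega> i u + b *\<^sub>R weak_partial \<Omega> i v) x"
        using H1_lincomb(2)[OF assms(1,2)] by simp
      show "a *\<^sub>R weak_partial \<Omega> i u + b *\<^sub>R weak_partial \<Omega> i v \<in> borel_measurable M"
        using assms H1_D(2) by (intro L2_measurable) blast
    qed (use assms H1_lincomb(1)[OF assms(1,2)] in measurable)
    also have "\<dots> = a * (LINT x|M. weak_partial \<Omega> i u x * weak_partial \<Omega> i w x)
      + b * (LINT x|M. weak_partial \<Omega> i v x * weak_partial \<Omega> i w x)"
      using assms by (simp only: L2.ip_add L2.ip_scale L2.closed_ops H1_D)
    finally show ?thesis .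
  qed
  moreover have "(LINT x|M. (a *\<^sub>R u + b *\<^sub>R v) x * w x) = a * (LINT x|M. u x * w x) + b * (LINT x|M. v x * w x)"
    using assms by (simp only: L2.ip_add L2.ip_scale L2.closed_ops H1_D)
  ultimately show ?thesis
    by (simp only: H1_ip_def sum.distrib sum_distrib_left[symmetric] distrib_left)
qed

lemma zero_H1: "0 \<in> H1_real \<Omega>"
proof -
  have "has_weak_partial \<Omega> i 0 0" for i by (simp add: has_weak_partial_def)
  then show ?thesis using L2.closed_ops(1) by (auto simp: H1_real_def)
qed

lemma subspace_H1: "subspace (H1_real \<Omega>)"
proof (rule subspaceI)
  show "u + v \<in> H1_real \<Omega>" if "u \<in> H1_real \<Omega>" "v \<in> H1_real \<Omega>" for u v
    using H1_lincomb(1)[OF that, of 1 1] by simp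
  show "c *\<^sub>R u \<in> H1_real \<Omega>" if "u \<in> H1_real \<Omega>" for c u
    using H1_lincomb(1)[OF that that, of c 0] by simp
qed (rule zero_H1)

sublocale H1: semi_inner_space "H1_real \<Omega>" H1_ip
proof
  show "subspace (H1_real \<Omega>)" by (rule subspace_H1)
  show "H1_ip (u + v) w = H1_ip u w + H1_ip v w"
    if "u \<in> H1_real \<Omega>" "v \<in> H1_real \<Omega>" "w \<in> H1_real \<Omega>" for u v w
    using H1_ip_lincomb[OF that, of 1 1] by simp
  show "H1_ip (c *\<^sub>R u) v = c * H1_ip u v" if "u \<in> H1_real \<Omega>" "v \<in> H1_real \<Omega>" for c u v
    using H1_ip_lincomb[OF that(1,1,2), of c 0] by simp
qed (auto simp: H1_ip_def mult.commute intro!: add_nonneg_nonneg sum_nonneg)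

lemma H1_norm_eq: "H1_norm \<Omega> u = H1.nrm u"
  by (simp add: H1_norm_def H1.nrm_def H1_ip_def power2_eq_square)

lemma H1_nrm_sq:
  assumes "u \<in> H1_real \<Omega>"
  shows "(H1.nrm u)\<^sup>2 = (L2.nrm u)\<^sup>2 + (\<Sum>i\<in>UNIV. (L2.nrm (weak_partial \<Omega> i u))\<^sup>2)"
  using assms by (simp add: H1.nrm_sq L2.nrm_sq H1_D H1_ip_def)

lemma L2_nrm_le_H1:
  assumes "u \<in> H1_real \<Omega>"
  shows "L2.nrm u \<le> H1.nrm u" "L2.nrm (weak_partial \<Omega> i u) \<le> H1.nrm u"
proof -
  have "(L2.nrm u)\<^sup>2 \<le> (H1.nrm u)\<^sup>2"
    using H1_nrm_sq[OF assms] by (simp add: sum_nonneg)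
  then show "L2.nrm u \<le> H1.nrm u" by (rule power2_le_imp_le) (simp add: assms)
  have "(L2.nrm (weak_partial \<Omega> i u))\<^sup>2 \<le> (\<Sum>i\<in>UNIV. (L2.nrm (weak_partial \<Omega> i u))\<^sup>2)"
    by (rule member_le_sum) auto
  then have "(L2.nrm (weak_partial \<Omega> i u))\<^sup>2 \<le> (H1.nrm u)\<^sup>2"
    unfolding H1_nrm_sq[OF assms] using zero_le_power2[of "L2.nrm u"] by linarith
  then show "L2.nrm (weak_partial \<Omega> i u) \<le> H1.nrm u" by (rule power2_le_imp_le) (simp add: assms)
qed

lemma weak_partial_diff:
  assumes "u \<in> H1_real \<Omega>" "v \<in> H1_real \<Omega>"
  shows "AE x in M. weak_partial \<Omega> i (u - v) x = (weak_partial \<Omega> i u - weak_partial \<Omega> i v) x"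
  using H1_lincomb(2)[OF assms, where a = 1 and b = "-1" and i = i] by simp

lemma L2_nrm_weak_partial_diff:
  assumes "u \<in> H1_real \<Omega>" "v \<in> H1_real \<Omega>"
  shows "L2.nrm (weak_partial \<Omega> i u - weak_partial \<Omega> i v) = L2.nrm (weak_partial \<Omega> i (u - v))"
proof (rule L2_nrm_cong_AE)
  show "weak_partial \<Omega> i u - weak_partial \<Omega> i v \<in> borel_measurable M"
    using assms H1_D(2) by (intro L2_measurable) blast
  show "AE x in M. (weak_partial \<Omega> i u - weak_partial \<Omega> i v) x = weak_partial \<Omega> i (u - v) x"
    using weak_partial_diff[OF assms, of i] by eventually_elim simp
qed (use assms H1.closed_ops(4)[OF assms] in measurable)

text \<open>The weak derivative is a closed operator.\<close>

lemma has_weak_partial_limit: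
  assumes X: "\<And>n. X n \<in> H1_real \<Omega>" and u: "u \<in> L2_real \<Omega>" and g: "g \<in> L2_real \<Omega>"
    and Xu: "(\<lambda>n. L2.nrm (X n - u)) \<longlonglongrightarrow> 0"
    and Xg: "(\<lambda>n. L2.nrm (weak_partial \<Omega> i (X n) - g)) \<longlonglongrightarrow> 0"
  shows "has_weak_partial \<Omega> i u g"
  unfolding has_weak_partial_def
proof
  fix \<phi> assume p: "\<phi> \<in> test_functions \<Omega>"
  have lim: "(\<lambda>n. LINT x|M. Y n x * \<psi> x) \<longlonglongrightarrow> (LINT x|M. y x * \<psi> x)"
    if Y: "\<And>n. Y n \<in> L2_real \<Omega>" and y: "y \<in> L2_real \<Omega>" and \<psi>: "\<psi> \<in> L2_real \<Omega>"
      and Yy: "(\<lambda>n. L2.nrm (Y n - y)) \<longlonglongrightarrow> 0" for Y y \<psi>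
  proof (rule LIM_zero_cancel, rule Lim_null_comparison)
    show "(\<lambda>n. L2.nrm (Y n - y) * L2.nrm \<psi>) \<longlonglongrightarrow> 0"
      by (rule tendsto_mult_left_zero[OF Yy])
    show "\<forall>\<^sub>F n in sequentially. norm ((LINT x|M. Y n x * \<psi> x) - (LINT x|M. y x * \<psi> x))
        \<le> L2.nrm (Y n - y) * L2.nrm \<psi>"
    proof (rule always_eventually, rule allI)
      fix n
      have "Y n - y \<in> L2_real \<Omega>" using Y y by blast
      from L2.Cauchy_Schwarz[OF this \<psi>]
      show "norm ((LINT x|M. Y n x * \<psi> x) - (LINT x|M. y x * \<psi> x)) \<le> L2.nrm (Y n - y) * L2.nrm \<psi>"
        unfolding L2.ip_diff[OF Y y \<psi>] by simp
    qed
  qed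
  have "(\<lambda>n. LINT x|M. X n x * partial_deriv i \<phi> x) \<longlonglongrightarrow> (LINT x|M. u x * partial_deriv i \<phi> x)"
    by (rule lim[OF H1_D(1)[OF X] u test_function_L2(2)[OF p] Xu])
  moreover have "(\<lambda>n. - (LINT x|M. weak_partial \<Omega> i (X n) x * \<phi> x)) \<longlonglongrightarrow> - (LINT x|M. g x * \<phi> x)"
    by (intro tendsto_minus lim[OF H1_D(2)[OF X] g test_function_L2(1)[OF p] Xg])
  moreover have "(LINT x|M. X n x * partial_deriv i \<phi> x) = - (LINT x|M. weak_partial \<Omega> i (X n) x * \<phi> x)" for n
    using H1_D(3)[OF X] p by (simp add: has_weak_partial_def)
  ultimately show "(LINT x|M. u x * partial_deriv i \<phi> x) = - (LINT x|M. g x * \<phi> x)"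
    using LIMSEQ_unique by simp
qed

sublocale H1: complete_semi_inner_space "H1_real \<Omega>" H1_ip
proof (unfold_locales, goal_cases)
  case (1 X)
  then have X: "\<And>n. X n \<in> H1_real \<Omega>" and sm: "summable (\<lambda>n. H1.nrm (X (Suc n) - X n))" by auto
  have dX: "X (Suc n) - X n \<in> H1_real \<Omega>" for n using X by blast
  have "\<exists>u\<in>L2_real \<Omega>. (\<lambda>n. L2.nrm (X n - u)) \<longlonglongrightarrow> 0"
  proof (rule L2.complete)
    show "summable (\<lambda>n. L2.nrm (X (Suc n) - X n))"
      by (rule summable_comparison_test'[OF sm, of 0])
         (use L2_nrm_le_H1(1)[OF dX] H1_D(1)[OF dX] in auto)
  qed (rule H1_D(1)[OF X])
  then obtain u where u: "u \<in> L2_real \<Omega>" "(\<lambda>n. L2.nrm (X n - u)) \<longlonglongrightarrow> 0" by blast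
  have "\<exists>g\<in>L2_real \<Omega>. (\<lambda>n. L2.nrm (weak_partial \<Omega> i (X n) - g)) \<longlonglongrightarrow> 0" for i
  proof (rule L2.complete)
    show "summable (\<lambda>n. L2.nrm (weak_partial \<Omega> i (X (Suc n)) - weak_partial \<Omega> i (X n)))"
      unfolding L2_nrm_weak_partial_diff[OF X X]
      by (rule summable_comparison_test'[OF sm, of 0])
         (use L2_nrm_le_H1(2)[OF dX] H1_D(2)[OF dX] in auto)
  qed (rule H1_D(2)[OF X])
  then have "\<forall>i. \<exists>g. g \<in> L2_real \<Omega> \<and> (\<lambda>n. L2.nrm (weak_partial \<Omega> i (X n) - g)) \<longlonglongrightarrow> 0"
    unfolding Bex_def by (rule allI)
  from choice[OF this] obtain g where "\<forall>i. g i \<in> L2_real \<Omega> \<and>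
      (\<lambda>n. L2.nrm (weak_partial \<Omega> i (X n) - g i)) \<longlonglongrightarrow> 0" ..
  then have g: "\<And>i. g i \<in> L2_real \<Omega>"
      "\<And>i. (\<lambda>n. L2.nrm (weak_partial \<Omega> i (X n) - g i)) \<longlonglongrightarrow> 0"
    by (simp_all only: simp_thms)
  have w: "has_weak_partial \<Omega> i u (g i)" for i
    by (rule has_weak_partial_limit[OF X u(1) g(1) u(2) g(2)])
  have uH: "u \<in> H1_real \<Omega>" using u(1) g(1) w by (auto simp: H1_real_def)
  have eq: "L2.nrm (weak_partial \<Omega> i (X n - u)) = L2.nrm (weak_partial \<Omega> i (X n) - g i)" for i n
    unfolding L2_nrm_weak_partial_diff[OF X uH, symmetric]
  proof (rule L2_nrm_cong_AE)
    show "AE x in M. (weak_partial \<Omega> i (X n) - weak_partial \<Omega> i u) x = (weak_partial \<Omega> i (X n) - g i) x"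
      using weak_partial_eqI[OF u(1) g(1) w uH, of i] by eventually_elim simp
  qed (use X uH g(1) H1_D(2) in \<open>blast intro: L2_measurable L2.closed_ops\<close>)+
  have "(\<lambda>n. (L2.nrm (X n - u))\<^sup>2 + (\<Sum>i\<in>UNIV. (L2.nrm (weak_partial \<Omega> i (X n - u)))\<^sup>2))
      \<longlonglongrightarrow> 0\<^sup>2 + (\<Sum>i\<in>(UNIV :: 'n set). 0\<^sup>2)"
    unfolding eq by (intro tendsto_intros u(2) g(2))
  then have "(\<lambda>n. (H1.nrm (X n - u))\<^sup>2) \<longlonglongrightarrow> 0"
    using X uH by (subst H1_nrm_sq) (auto intro: H1.closed_ops)
  then have "(\<lambda>n. sqrt ((H1.nrm (X n - u))\<^sup>2)) \<longlonglongrightarrow> sqrt 0" by (rule tendsto_real_sqrt)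
  then have "(\<lambda>n. H1.nrm (X n - u)) \<longlonglongrightarrow> 0" using X uH by (simp add: H1.closed_ops)
  then show ?case using uH by blast
qed

lemma test_function_H1: "\<phi> \<in> test_functions \<Omega> \<Longrightarrow> \<phi> \<in> H1_real \<Omega>"
  using test_function_L2 test_function_has_weak_partial[OF domain_open]
  by (fastforce simp: H1_real_def)

lemma H10_real_iff:
  "u \<in> H10_real \<Omega> \<longleftrightarrow> u \<in> H1_real \<Omega> \<and> (\<exists>\<phi>. (\<forall>k. \<phi> k \<in> test_functions \<Omega>)
     \<and> (\<lambda>k. H1.nrm (\<phi> k - u)) \<longlonglongrightarrow> 0)"
  by (simp add: H10_real_def H1_norm_eq fun_diff_def)

lemma H10_imp_H1: "u \<in> H10_real \<Omega> \<Longrightarrow> u \<in> H1_real \<Omega>"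
  by (simp add: H10_real_iff)

lemma H10_lincomb:
  assumes "u \<in> H10_real \<Omega>" "v \<in> H10_real \<Omega>"
  shows "a *\<^sub>R u + b *\<^sub>R v \<in> H10_real \<Omega>"
proof -
  obtain \<phi> \<psi> where \<phi>: "\<And>k. \<phi> k \<in> test_functions \<Omega>" "(\<lambda>k. H1.nrm (\<phi> k - u)) \<longlonglongrightarrow> 0"
    and \<psi>: "\<And>k. \<psi> k \<in> test_functions \<Omega>" "(\<lambda>k. H1.nrm (\<psi> k - v)) \<longlonglongrightarrow> 0"
    using assms by (auto simp: H10_real_iff)
  note uv = assms[THEN H10_imp_H1]
  note H = \<phi>(1)[THEN test_function_H1] \<psi>(1)[THEN test_function_H1]
  define \<eta> where "\<eta> k = a *\<^sub>R \<phi> k + b *\<^sub>R \<psi> k" for k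
  have "\<eta> k \<in> test_functions \<Omega>" for k
    using test_function_lincomb[OF \<phi>(1) \<psi>(1), of a k b k]
    by (simp add: \<eta>_def plus_fun_def scaleR_fun_def)
  moreover have "(\<lambda>k. H1.nrm (\<eta> k - (a *\<^sub>R u + b *\<^sub>R v))) \<longlonglongrightarrow> 0"
  proof (rule Lim_null_comparison)
    show "(\<lambda>k. \<bar>a\<bar> * H1.nrm (\<phi> k - u) + \<bar>b\<bar> * H1.nrm (\<psi> k - v)) \<longlonglongrightarrow> 0"
      using tendsto_add[OF tendsto_mult_right_zero[OF \<phi>(2), of "\<bar>a\<bar>"] tendsto_mult_right_zero[OF \<psi>(2), of "\<bar>b\<bar>"]]
      by simp
    have sc: "H1.nrm (c *\<^sub>R w) = \<bar>c\<bar> * H1.nrm w" if "w \<in> H1_real \<Omega>" for c w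
      using that by (simp add: H1.nrm_def H1.ip_simps mult.assoc[symmetric] real_sqrt_mult)
    have "H1.nrm (\<eta> k - (a *\<^sub>R u + b *\<^sub>R v)) \<le> \<bar>a\<bar> * H1.nrm (\<phi> k - u) + \<bar>b\<bar> * H1.nrm (\<psi> k - v)" for k
    proof -
      have "\<eta> k - (a *\<^sub>R u + b *\<^sub>R v) = a *\<^sub>R (\<phi> k - u) + b *\<^sub>R (\<psi> k - v)"
        by (simp add: \<eta>_def scaleR_diff_right)
      then show ?thesis
        using H1.nrm_triangle[of "a *\<^sub>R (\<phi> k - u)" "b *\<^sub>R (\<psi> k - v)"] H uv
        by (simp add: sc H1.closed_ops)
    qed
    moreover have "\<eta> k - (a *\<^sub>R u + b *\<^sub>R v) \<in> H1_real \<Omega>" for k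
      unfolding \<eta>_def by (intro H1.closed_ops H uv)
    ultimately show "\<forall>\<^sub>F k in sequentially. norm (H1.nrm (\<eta> k - (a *\<^sub>R u + b *\<^sub>R v)))
        \<le> \<bar>a\<bar> * H1.nrm (\<phi> k - u) + \<bar>b\<bar> * H1.nrm (\<psi> k - v)"
      by simp
  qed
  moreover have "a *\<^sub>R u + b *\<^sub>R v \<in> H1_real \<Omega>" by (rule H1_lincomb(1)[OF uv])
  ultimately show ?thesis unfolding H10_real_iff by blast
qed

lemma zero_H10: "0 \<in> H10_real \<Omega>"
proof -
  have "(\<lambda>_. 0) \<in> test_functions \<Omega>" by (rule zero_test_function)
  then have "(0 :: real ^ 'n \<Rightarrow> real) \<in> test_functions \<Omega>" by (simp add: zero_fun_def)
  then show ?thesis unfolding H10_real_iff by (intro conjI zero_H1 exI[of _ "\<lambda>_. 0"]) auto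
qed

lemma subspace_H10: "subspace (H10_real \<Omega>)"
proof (rule subspaceI)
  show "u + v \<in> H10_real \<Omega>" if "u \<in> H10_real \<Omega>" "v \<in> H10_real \<Omega>" for u v
    using H10_lincomb[OF that, of 1 1] by simp
  show "c *\<^sub>R u \<in> H10_real \<Omega>" if "u \<in> H10_real \<Omega>" for c u
    using H10_lincomb[OF that that, of c 0] by simp
qed (rule zero_H10)

text \<open>The closure of the test functions is complete: the \<open>n\<close>-th term of the sequence is replaced by a test
function at distance less than \<open>1 / (n + 1)\<close>.\<close>

lemma H10_complete:
  assumes X: "\<And>n. X n \<in> H10_real \<Omega>" and sm: "summable (\<lambda>n. H1.nrm (X (Suc n) - X n))"
  shows "\<exists>u\<in>H10_real \<Omega>. (\<lambda>n. H1.nrm (X n - u)) \<longlonglongrightarrow> 0"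
proof -
  note XH = X[THEN H10_imp_H1]
  obtain u where u: "u \<in> H1_real \<Omega>" and lim: "(\<lambda>n. H1.nrm (X n - u)) \<longlonglongrightarrow> 0"
    using H1.complete[OF XH sm] by blast
  have "\<exists>\<phi>\<in>test_functions \<Omega>. H1.nrm (\<phi> - X n) < 1 / real (Suc n)" for n
  proof -
    obtain \<phi> where \<phi>: "\<And>k. \<phi> k \<in> test_functions \<Omega>" "(\<lambda>k. H1.nrm (\<phi> k - X n)) \<longlonglongrightarrow> 0"
      using X[of n] by (auto simp: H10_real_iff)
    have "\<forall>\<^sub>F k in sequentially. H1.nrm (\<phi> k - X n) < 1 / real (Suc n)"
      by (rule order_tendstoD(2)[OF \<phi>(2)]) simp
    then show ?thesis using \<phi>(1) by (auto simp: eventually_sequentially)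
  qed
  then obtain \<phi> where \<phi>: "\<And>n. \<phi> n \<in> test_functions \<Omega>" "\<And>n. H1.nrm (\<phi> n - X n) < 1 / real (Suc n)"
    by metis
  note \<phi>H = \<phi>(1)[THEN test_function_H1]
  have "(\<lambda>n. H1.nrm (\<phi> n - u)) \<longlonglongrightarrow> 0"
  proof (rule Lim_null_comparison)
    show "(\<lambda>n. 1 / real (Suc n) + H1.nrm (X n - u)) \<longlonglongrightarrow> 0"
      using tendsto_add[OF LIMSEQ_Suc[OF lim_1_over_n] lim] by simp
    have "H1.nrm (\<phi> n - u) \<le> 1 / real (Suc n) + H1.nrm (X n - u)" for n
    proof -
      have "H1.nrm ((\<phi> n - X n) + (X n - u)) \<le> H1.nrm (\<phi> n - X n) + H1.nrm (X n - u)"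
        by (intro H1.nrm_triangle H1.closed_ops \<phi>H XH u)
      then show ?thesis using \<phi>(2)[of n] by simp
    qed
    then show "\<forall>\<^sub>F n in sequentially. norm (H1.nrm (\<phi> n - u)) \<le> 1 / real (Suc n) + H1.nrm (X n - u)"
      using \<phi>H u by (simp add: H1.closed_ops)
  qed
  then have "u \<in> H10_real \<Omega>" unfolding H10_real_iff using u \<phi>(1) by blast
  then show ?thesis using lim by blast
qed

end


section \<open>Inner product and Clifford multiplication\<close>

lemmas cmult_add_left = bilinear_ladd[OF bilinear_cmult]
  and cmult_add_right = bilinear_radd[OF bilinear_cmult]
  and cmult_scale_left = bilinear_lmul[OF bilinear_cmult]
  and cmult_scale_right = bilinear_rmul[OF bilinear_cmult]

lemma linear_cmult_left: "linear (\<lambda>x. x \<odot> y)" and linear_cmult_right: "linear (\<lambda>y. x \<odot> y)"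
  using bilinear_cmult by (auto simp: bilinear_def)

lemma cmult_sum_left: "(\<Sum>i\<in>I. f i) \<odot> y = (\<Sum>i\<in>I. f i \<odot> y)"
  by (rule linear_sum[OF linear_cmult_left])

lemma cmult_sum_right: "x \<odot> (\<Sum>i\<in>I. f i) = (\<Sum>i\<in>I. x \<odot> f i)"
  by (rule linear_sum[OF linear_cmult_right])

lemma cblade_component: "cblade A $ B = (if A = B then 1 else 0)"
  by (auto simp: cblade_def axis_def)

lemma sym_diff_eq_empty: "sym_diff A B = {} \<longleftrightarrow> A = B" by auto

lemma Sc_cmult: "Sc (x \<odot> y) = (\<Sum>A\<in>UNIV. x $ A * y $ A * csign A A)"
proof -
  have "Sc (x \<odot> y) = (\<Sum>A\<in>UNIV. \<Sum>B\<in>UNIV. if B = A then x $ A * y $ B * csign A B else 0)"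
    unfolding Sc_def cmult_def sum_component vector_scaleR_component cblade_component sym_diff_eq_empty
    by (intro sum.cong refl) auto
  then show ?thesis by simp
qed

lemma cmult_cblade_component: "(x \<odot> cblade A) $ C = x $ (sym_diff C A) * csign (sym_diff C A) A"
proof -
  have eq: "sym_diff B A = C \<longleftrightarrow> B = sym_diff C A" for B by auto
  have "x \<odot> cblade A = (\<Sum>B\<in>UNIV. x $ B *\<^sub>R cblade B) \<odot> cblade A"
    by (simp only: clifford_expansion[symmetric])
  also have "\<dots> = (\<Sum>B\<in>UNIV. x $ B *\<^sub>R (csign B A *\<^sub>R cblade (sym_diff B A)))"
    by (simp only: cmult_sum_left cmult_scale_left cmult_blade)
  finally have "(x \<odot> cblade A) $ C = (\<Sum>B\<in>UNIV. x $ B * (csign B A * (if sym_diff B A = C then 1 else 0)))"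
    by (simp only: sum_component vector_scaleR_component cblade_component real_scaleR_def)
  also have "\<dots> = (\<Sum>B\<in>UNIV. if B = sym_diff C A then x $ B * csign B A else 0)"
    unfolding eq by (intro sum.cong refl) auto
  finally show ?thesis by simp
qed

lemma Sc_cmult_cblade: "Sc (x \<odot> cblade A) = x $ A * csign A A"
  by (simp add: Sc_def cmult_cblade_component)

lemma cconj_cblade_eq: "cconj (cblade A) = csign A A *\<^sub>R cblade A"
proof -
  have "cblade A \<odot> cblade A = csign A A *\<^sub>R cblade {}" by (simp add: cmult_blade)
  then have "csign A A *\<^sub>R cconj (cblade A) = cconj (cblade A) \<odot> (cblade A \<odot> cblade A)"
    by (simp add: cmult_scale_right)
  also have "\<dots> = cblade A" by (simp add: cmult_assoc[symmetric] cconj_cblade_mult)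
  finally have "csign A A *\<^sub>R (csign A A *\<^sub>R cconj (cblade A)) = csign A A *\<^sub>R cblade A" by simp
  then show ?thesis by simp
qed

lemma cconj_component: "cconj x $ A = csign A A * x $ A"
proof -
  have "cconj x = (\<Sum>A\<in>UNIV. x $ A *\<^sub>R (csign A A *\<^sub>R cblade A))"
    unfolding cconj_def by (intro sum.cong refl) (simp only: cconj_cblade[symmetric] cconj_cblade_eq)
  then have "cconj x $ A = (\<Sum>B\<in>UNIV. if B = A then x $ B * csign B B else 0)"
    by (simp only: sum_component vector_scaleR_component cblade_component)
       (intro sum.cong refl, auto)
  then show ?thesis by simp
qed

text \<open>The scalar part of \<open>cconj x \<odot> y\<close> is the Euclidean inner product of the coefficient vectors.\<close>

lemma Sc_cconj_cmult: "Sc (cconj x \<odot> y) = x \<bullet> y"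
proof -
  have "csign A A * x $ A * y $ A * csign A A = x $ A * y $ A" for A
    using csign_sq[of A A] by algebra
  then show ?thesis by (simp only: Sc_cmult cconj_component inner_vec_def inner_real_def)
qed

text \<open>Left multiplication by a generator is skew-adjoint; reindexing by \<open>B \<mapsto> {i} \<triangle> B\<close> changes the sign
because \<open>e\<^sub>i\<^sup>2 = -1\<close>.\<close>

lemma cgen_skew: "(cgen i \<odot> y) \<bullet> z = - (y \<bullet> (cgen i \<odot> z))"
proof -
  let ?t = "\<lambda>B. sym_diff {i} B"
  have ii: "csign {i} {i} = - 1"
    by (simp add: csign_prod)
  have exp: "(cgen i \<odot> y) \<bullet> z = (\<Sum>B\<in>UNIV. y $ B * csign {i} B * z $ ?t B)" for y z :: "'a clifford"
  proof -
    have "cgen i \<odot> y = cgen i \<odot> (\<Sum>B\<in>UNIV. y $ B *\<^sub>R cblade B)"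
      by (simp only: clifford_expansion[symmetric])
    also have "\<dots> = (\<Sum>B\<in>UNIV. y $ B *\<^sub>R (csign {i} B *\<^sub>R cblade (?t B)))"
      by (simp only: cmult_sum_right cmult_scale_right cmult_blade)
    finally show ?thesis
      by (simp add: inner_sum_left cblade_def inner_axis' mult.assoc)
  qed
  have bij: "bij_betw ?t UNIV UNIV"
    by (rule bij_betwI[of _ _ _ ?t]) auto
  have "y \<bullet> (cgen i \<odot> z) = (\<Sum>B\<in>UNIV. z $ B * csign {i} B * y $ ?t B)"
    using exp[of z y] by (simp add: inner_commute)
  also have "\<dots> = (\<Sum>B\<in>UNIV. z $ ?t B * csign {i} (?t B) * y $ ?t (?t B))"
    by (rule sum.reindex_bij_betw[OF bij, symmetric])
  also have "\<dots> = (\<Sum>B\<in>UNIV. - (y $ B * csign {i} B * z $ ?t B))"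
  proof (intro sum.cong refl)
    fix B
    have "?t (?t B) = B" by auto
    then show "z $ ?t B * csign {i} (?t B) * y $ ?t (?t B) = - (y $ B * csign {i} B * z $ ?t B)"
      by (simp only: csign_sym_diff_right ii) simp
  qed
  finally show ?thesis by (simp add: exp sum_negf)
qed

lemma norm_cgen_cmult: "norm (cgen i \<odot> y) = norm y"
proof -
  have "(cgen i \<odot> y) \<bullet> (cgen i \<odot> y) = y \<bullet> y"
    unfolding cgen_skew cmult_assoc[symmetric] cgen_sq
    by (simp add: bilinear_lneg[OF bilinear_cmult])
  then show ?thesis by (simp add: norm_eq_sqrt_inner)
qed

lemma cvec_skew: "(cvec x \<odot> y) \<bullet> z = - (y \<bullet> (cvec x \<odot> z))"
  by (simp add: cvec_def cmult_sum_left cmult_scale_left inner_sum_left inner_sum_right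
      cgen_skew sum_negf)

lemma cvec_sq: "cvec x \<odot> cvec x = - (norm x)\<^sup>2 *\<^sub>R cblade {}"
proof -
  let ?S = "\<Sum>i\<in>UNIV. \<Sum>j\<in>UNIV. (x $ i * x $ j) *\<^sub>R (cgen i \<odot> cgen j)"
  have S: "cvec x \<odot> cvec x = ?S"
    unfolding cvec_def cmult_sum_left cmult_scale_left
    by (simp add: cmult_sum_right cmult_scale_right scaleR_sum_right)
  have "?S + ?S = (\<Sum>i\<in>UNIV. \<Sum>j\<in>UNIV. (x $ i * x $ j) *\<^sub>R (cgen i \<odot> cgen j))
      + (\<Sum>i\<in>UNIV. \<Sum>j\<in>UNIV. (x $ i * x $ j) *\<^sub>R (cgen j \<odot> cgen i))"
    by (subst (2) sum.swap) (simp add: mult.commute)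
  also have "\<dots> = (\<Sum>i\<in>UNIV. \<Sum>j\<in>UNIV. (x $ i * x $ j) *\<^sub>R (cgen i \<odot> cgen j + cgen j \<odot> cgen i))"
    by (simp add: sum.distrib scaleR_add_right)
  also have "\<dots> = (\<Sum>i\<in>UNIV. \<Sum>j\<in>UNIV. if j = i then - (2 * (x $ i * x $ i)) *\<^sub>R cblade {} else 0)"
  proof (intro sum.cong refl)
    fix i j
    show "(x $ i * x $ j) *\<^sub>R (cgen i \<odot> cgen j + cgen j \<odot> cgen i) =
      (if j = i then - (2 * (x $ i * x $ i)) *\<^sub>R cblade {} else 0)"
    proof (cases "j = i")
      case True
      then show ?thesis by (simp add: cgen_sq scaleR_2[symmetric] scaleR_add_left[symmetric])
    next
      case False
      then show ?thesis using cgen_anticommute[of i j] by simp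
    qed
  qed
  also have "\<dots> = (- 2 * (norm x)\<^sup>2) *\<^sub>R cblade {}"
    by (simp add: power2_norm_eq_inner inner_vec_def scaleR_sum_left[symmetric] sum_negf sum_distrib_left)
  finally have "2 *\<^sub>R ?S = 2 *\<^sub>R (- (norm x)\<^sup>2 *\<^sub>R cblade {})" by (simp add: scaleR_2)
  then show ?thesis by (simp only: S scaleR_cancel_left) simp
qed

lemma norm_cvec_cmult: "norm (cvec x \<odot> y) = norm x * norm y"
proof -
  have "(cvec x \<odot> y) \<bullet> (cvec x \<odot> y) = (norm x)\<^sup>2 * (y \<bullet> y)"
    unfolding cvec_skew cmult_assoc[symmetric] cvec_sq
    by (simp add: cmult_scale_left bilinear_lneg[OF bilinear_cmult])
  then show ?thesis by (simp add: norm_eq_sqrt_inner real_sqrt_mult)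
qed

lemma norm_sq_Sc_nonscalar: "(norm s)\<^sup>2 = (Sc s)\<^sup>2 + (norm (nonscalar_part s))\<^sup>2"
proof -
  have u: "cblade {} \<bullet> (cblade {} :: 'a clifford) = 1"
    by (simp add: cblade_def inner_axis_axis)
  have "cblade {} \<bullet> s = Sc s" "s \<bullet> cblade {} = Sc s"
    by (simp_all add: cblade_def Sc_def inner_axis inner_axis')
  then show ?thesis using u unfolding power2_norm_eq_inner nonscalar_part_def
    by (simp add: inner_diff power2_eq_square algebra_simps)
qed

section \<open>Pointwise coercivity and boundedness of the integrand\<close>

text \<open>The Dirac and Euler operators as functions of the gradient, that is, of the vector \<open>p\<close> of the partial
derivatives.\<close>

definition grad_dirac :: "('n::{finite,linorder} clifford) ^ ('n::{finite,linorder}) \<Rightarrow> 'n clifford" where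
  "grad_dirac p = (\<Sum>i\<in>UNIV. cgen i \<odot> p $ i)"

definition grad_euler :: "'n::{finite,linorder} point \<Rightarrow> ('n clifford) ^ ('n::{finite,linorder}) \<Rightarrow> 'n clifford" where
  "grad_euler x p = (\<Sum>i\<in>UNIV. x $ i *\<^sub>R p $ i)"

lemma norm_grad_dirac: 
  fixes p :: "('n::{finite,linorder} clifford) ^ ('n::{finite,linorder})"
  shows "norm (grad_dirac p) \<le> sqrt (real CARD('n)) * norm p"
proof -
  have "norm (grad_dirac p) \<le> (\<Sum>i\<in>UNIV. norm (cgen i \<odot> p $ i))"
    unfolding grad_dirac_def by (rule norm_sum)
  also have "\<dots> = (\<Sum>i\<in>(UNIV::'n set). \<bar>1\<bar> * \<bar>norm (p $ i)\<bar>)" by (simp add: norm_cgen_cmult)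
  also have "\<dots> \<le> L2_set (\<lambda>_. 1) (UNIV::'n set) * L2_set (\<lambda>i. norm (p $ i)) UNIV"
    by (rule L2_set_mult_ineq)
  finally show ?thesis by (simp add: L2_set_def norm_vec_def)
qed

lemma norm_grad_euler: "norm (grad_euler x p) \<le> norm x * norm p"
proof -
  have "norm (grad_euler x p) \<le> (\<Sum>i\<in>UNIV. norm (x $ i *\<^sub>R p $ i))"
    unfolding grad_euler_def by (rule norm_sum)
  also have "\<dots> = (\<Sum>i\<in>UNIV. \<bar>x $ i\<bar> * \<bar>norm (p $ i)\<bar>)" by simp
  also have "\<dots> \<le> L2_set (\<lambda>i. x $ i) UNIV * L2_set (\<lambda>i. norm (p $ i)) UNIV"
    by (rule L2_set_mult_ineq)
  finally show ?thesis by (simp add: L2_set_def norm_vec_def)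
qed

text \<open>The terms of the form that are tested against \<open>G\<close> itself, evaluated at a point \<open>x\<close>, with \<open>v\<close> for the
value and \<open>p\<close> for the gradient of \<open>F\<close>.\<close>

definition lower_order ::
    "'n::{finite,linorder} clifford \<Rightarrow> 'n point \<Rightarrow> 'n clifford \<Rightarrow> ('n clifford) ^ ('n::{finite,linorder}) \<Rightarrow> 'n clifford" where
  "lower_order s x v p =
     (2 * (2 + real CARD('n)) * (1 + (norm x)\<^sup>2)) *\<^sub>R grad_euler x p
     + (2 * (1 + (norm x)\<^sup>2)) *\<^sub>R (cvec x \<odot> grad_dirac p)
     - (2 * Sc s) *\<^sub>R ((1 + (norm x)\<^sup>2) *\<^sub>R grad_dirac p - real CARD('n) *\<^sub>R (cvec x \<odot> v))
     + ((norm s)\<^sup>2 + (real CARD('n))\<^sup>2) *\<^sub>R v"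

text \<open>The integrand of the scalar part of the sesquilinear form; \<open>v\<close> and \<open>p\<close> are the value and the gradient
of the first argument, \<open>w\<close> and \<open>r\<close> those of the second.\<close>

definition form_density ::
    "'n::{finite,linorder} clifford \<Rightarrow> 'n point \<Rightarrow> 'n clifford \<Rightarrow> ('n clifford) ^ ('n::{finite,linorder})
      \<Rightarrow> 'n clifford \<Rightarrow> ('n clifford) ^ ('n::{finite,linorder}) \<Rightarrow> real" where
  "form_density s x v p w r = (1 + (norm x)\<^sup>2)\<^sup>2 * (p \<bullet> r) + lower_order s x v p \<bullet> w"

text \<open>The constant on the left is the smallest eigenvalue of the matrix with rows \<open>(a, -c)\<close> and
\<open>(-c, b)\<close>.\<close>

lemma smallest_eigenvalue:
  fixes a b c v p :: real
  assumes "0 \<le> c"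
  shows "(1/2 * (a + b) - 1/2 * sqrt ((a - b)\<^sup>2 + 4 * c\<^sup>2)) * (v\<^sup>2 + p\<^sup>2)
    \<le> a * v\<^sup>2 + b * p\<^sup>2 - 2 * c * v * p"
proof -
  define D where "D = sqrt ((a - b)\<^sup>2 + 4 * c\<^sup>2)"
  have D2: "D\<^sup>2 = (a - b)\<^sup>2 + 4 * c\<^sup>2" by (simp add: D_def)
  have "\<bar>a - b\<bar> \<le> D" unfolding D_def by (rule real_le_rsqrt) simp
  then have al: "0 \<le> (D + (a - b)) / 2" and be: "0 \<le> (D - (a - b)) / 2" by auto
  have "(D + (a - b)) / 2 * ((D - (a - b)) / 2) = c\<^sup>2"
    using D2 by (simp add: field_simps power2_eq_square)
  then have "sqrt ((D + (a - b)) / 2) * sqrt ((D - (a - b)) / 2) = c"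
    using assms by (simp add: real_sqrt_mult[symmetric])
  moreover have "0 \<le> (sqrt ((D + (a - b)) / 2) * v - sqrt ((D - (a - b)) / 2) * p)\<^sup>2" by simp
  ultimately have "0 \<le> (D + (a - b)) / 2 * v\<^sup>2 + (D - (a - b)) / 2 * p\<^sup>2 - 2 * c * v * p"
    using al be by (simp add: power2_diff power_mult_distrib mult_ac)
  then show ?thesis unfolding D_def[symmetric] by (simp add: field_simps)
qed

text \<open>Estimating each term with \<open>m \<le> norm x \<le> M\<close> bounds the integrand from below by the quadratic form
of the matrix in the preceding lemma, evaluated at \<open>norm v\<close> and \<open>norm p\<close>; its smallest eigenvalue is
\<open>H_const\<close>.\<close>

lemma form_density_coercive:
  fixes s :: "'n::{finite,linorder} clifford"
  assumes m: "0 \<le> m" "m \<le> norm x" and M: "norm x \<le> M"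
  shows "H_const CARD('n) m M s * ((norm v)\<^sup>2 + (norm p)\<^sup>2) \<le> form_density s x v p v p"
proof -
  let ?n = "real CARD('n)" and ?X = "1 + (norm x)\<^sup>2"
  define a where "a = (norm s)\<^sup>2 + ?n\<^sup>2 - 2 * \<bar>Sc s\<bar> * ?n * M"
  define b where "b = (1 + m\<^sup>2)\<^sup>2"
  define c where "c = sqrt ?n * (1 + M\<^sup>2) * ((3 + ?n) * M + \<bar>Sc s\<bar>)"
  have M0: "0 \<le> M" using m M by linarith
  have n1: "1 \<le> sqrt ?n" by (simp add: Suc_leI)
  have c0: "0 \<le> c" using M0 by (simp add: c_def)
  have X: "0 \<le> ?X" "?X \<le> 1 + M\<^sup>2" using M by (auto simp: power_mono)
  have E: "\<bar>grad_euler x p \<bullet> v\<bar> \<le> sqrt ?n * M * (norm v * norm p)"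
  proof -
    have "\<bar>grad_euler x p \<bullet> v\<bar> \<le> norm x * norm p * norm v"
      by (rule order_trans[OF Cauchy_Schwarz_ineq2]) (intro mult_right_mono norm_grad_euler norm_ge_zero)
    also have "\<dots> \<le> M * norm p * norm v" using M by (intro mult_right_mono) auto
    also have "\<dots> \<le> sqrt ?n * (M * norm p * norm v)"
      using M0 n1 mult_right_mono[of 1 "sqrt ?n" "M * norm p * norm v"] by simp
    finally show ?thesis by (simp add: mult_ac)
  qed
  have D: "\<bar>grad_dirac p \<bullet> v\<bar> \<le> sqrt ?n * (norm v * norm p)"
  proof -
    have "\<bar>grad_dirac p \<bullet> v\<bar> \<le> sqrt ?n * norm p * norm v"
      by (rule order_trans[OF Cauchy_Schwarz_ineq2]) (intro mult_right_mono norm_grad_dirac norm_ge_zero)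
    then show ?thesis by (simp add: mult_ac)
  qed
  have xD: "\<bar>(cvec x \<odot> grad_dirac p) \<bullet> v\<bar> \<le> sqrt ?n * M * (norm v * norm p)"
  proof -
    have "\<bar>(cvec x \<odot> grad_dirac p) \<bullet> v\<bar> \<le> (norm x * norm (grad_dirac p)) * norm v"
      by (rule order_trans[OF Cauchy_Schwarz_ineq2]) (simp add: norm_cvec_cmult)
    also have "\<dots> \<le> (M * (sqrt ?n * norm p)) * norm v"
      using M M0 by (intro mult_right_mono mult_mono norm_grad_dirac) auto
    finally show ?thesis by (simp add: mult_ac)
  qed
  have xv: "\<bar>(cvec x \<odot> v) \<bullet> v\<bar> \<le> M * (norm v)\<^sup>2"
  proof -
    have "\<bar>(cvec x \<odot> v) \<bullet> v\<bar> \<le> (norm x * norm v) * norm v"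
      by (rule order_trans[OF Cauchy_Schwarz_ineq2]) (simp add: norm_cvec_cmult)
    also have "\<dots> \<le> (M * norm v) * norm v" using M by (intro mult_right_mono) auto
    finally show ?thesis by (simp add: power2_eq_square)
  qed
  let ?vp = "norm v * norm p"
  have t1: "- (2 * (2 + ?n) * (1 + M\<^sup>2) * (sqrt ?n * M * ?vp))
      \<le> (2 * (2 + ?n) * ?X) * (grad_euler x p \<bullet> v)"
  proof -
    have "\<bar>(2 * (2 + ?n) * ?X) * (grad_euler x p \<bullet> v)\<bar> \<le> (2 * (2 + ?n) * (1 + M\<^sup>2)) * (sqrt ?n * M * ?vp)"
      unfolding abs_mult using E X by (intro mult_mono) auto
    then show ?thesis by linarith
  qed
  have t2: "- (2 * (1 + M\<^sup>2) * (sqrt ?n * M * ?vp)) \<le> (2 * ?X) * ((cvec x \<odot> grad_dirac p) \<bullet> v)"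
  proof -
    have "\<bar>(2 * ?X) * ((cvec x \<odot> grad_dirac p) \<bullet> v)\<bar> \<le> (2 * (1 + M\<^sup>2)) * (sqrt ?n * M * ?vp)"
      unfolding abs_mult using xD X by (intro mult_mono) auto
    then show ?thesis by linarith
  qed
  have t3: "2 * Sc s * (?X * (grad_dirac p \<bullet> v)) \<le> 2 * \<bar>Sc s\<bar> * ((1 + M\<^sup>2) * (sqrt ?n * ?vp))"
  proof -
    have "\<bar>2 * Sc s * (?X * (grad_dirac p \<bullet> v))\<bar> \<le> 2 * \<bar>Sc s\<bar> * ((1 + M\<^sup>2) * (sqrt ?n * ?vp))"
      unfolding abs_mult using D X by (intro mult_mono) auto
    then show ?thesis by linarith
  qed
  have t4: "- (2 * \<bar>Sc s\<bar> * (?n * (M * (norm v)\<^sup>2))) \<le> 2 * Sc s * (?n * ((cvec x \<odot> v) \<bullet> v))"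
  proof -
    have "\<bar>2 * Sc s * (?n * ((cvec x \<odot> v) \<bullet> v))\<bar> \<le> 2 * \<bar>Sc s\<bar> * (?n * (M * (norm v)\<^sup>2))"
      unfolding abs_mult using xv by (intro mult_mono) auto
    then show ?thesis by linarith
  qed
  have t5: "b * (norm p)\<^sup>2 \<le> ?X\<^sup>2 * (norm p)\<^sup>2"
    unfolding b_def using m by (intro mult_right_mono power_mono add_left_mono) auto
  have "a * (norm v)\<^sup>2 + b * (norm p)\<^sup>2 - 2 * c * norm v * norm p
    = b * (norm p)\<^sup>2 - (2 * (2 + ?n) * (1 + M\<^sup>2) * (sqrt ?n * M * ?vp)) - (2 * (1 + M\<^sup>2) * (sqrt ?n * M * ?vp))
      - 2 * \<bar>Sc s\<bar> * ((1 + M\<^sup>2) * (sqrt ?n * ?vp)) - (2 * \<bar>Sc s\<bar> * (?n * (M * (norm v)\<^sup>2)))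
      + ((norm s)\<^sup>2 + ?n\<^sup>2) * (norm v)\<^sup>2"
    by (simp add: a_def c_def algebra_simps)
  also have "\<dots> \<le> ?X\<^sup>2 * (norm p)\<^sup>2 + (2 * (2 + ?n) * ?X) * (grad_euler x p \<bullet> v)
      + (2 * ?X) * ((cvec x \<odot> grad_dirac p) \<bullet> v) - 2 * Sc s * (?X * (grad_dirac p \<bullet> v))
      + 2 * Sc s * (?n * ((cvec x \<odot> v) \<bullet> v)) + ((norm s)\<^sup>2 + ?n\<^sup>2) * (norm v)\<^sup>2"
    using t1 t2 t3 t4 t5 by linarith
  also have "\<dots> = form_density s x v p v p"
    by (simp add: form_density_def lower_order_def inner_add_left inner_diff_left power2_norm_eq_inner
        right_diff_distrib)
  finally have "a * (norm v)\<^sup>2 + b * (norm p)\<^sup>2 - 2 * c * norm v * norm p \<le> form_density s x v p v p" .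
  moreover have "H_const CARD('n) m M s = 1/2 * (a + b) - 1/2 * sqrt ((a - b)\<^sup>2 + 4 * c\<^sup>2)"
    by (simp add: H_const_def a_def b_def c_def)
  ultimately show ?thesis using smallest_eigenvalue[OF c0, of a b "norm v" "norm p"] by simp
qed

text \<open>The two hypotheses say that the matrix underlying \<open>form_density_coercive\<close> has positive trace and
positive determinant.\<close>

lemma H_const_pos:
  fixes s :: "'n::{finite,linorder} clifford"
  assumes M: "0 \<le> M"
    and 1: "(norm s)\<^sup>2 + (real n)\<^sup>2 - 2 * \<bar>Sc s\<bar> * real n * M + (1 + m\<^sup>2)\<^sup>2 > 0"
    and 2: "(norm (nonscalar_part s))\<^sup>2 * (1 + m\<^sup>2)\<^sup>2
           - (Sc s)\<^sup>2 * (real n * (1 + M\<^sup>2)\<^sup>2 - (1 + m\<^sup>2)\<^sup>2)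
           - 2 * real n * M * ((3 + real n) * (1 + M\<^sup>2)\<^sup>2 + (1 + m\<^sup>2)\<^sup>2) * \<bar>Sc s\<bar>
         > real n * (3 + real n)\<^sup>2 * M\<^sup>2 * (1 + M\<^sup>2)\<^sup>2 - (real n)\<^sup>2 * (1 + m\<^sup>2)\<^sup>2"
  shows "H_const n m M s > 0"
proof -
  define a where "a = (norm s)\<^sup>2 + (real n)\<^sup>2 - 2 * \<bar>Sc s\<bar> * real n * M"
  define b where "b = (1 + m\<^sup>2)\<^sup>2"
  define c where "c = sqrt (real n) * (1 + M\<^sup>2) * ((3 + real n) * M + \<bar>Sc s\<bar>)"
  define Y where "Y = (1 + M\<^sup>2)\<^sup>2"
  have c2: "c\<^sup>2 = real n * Y * ((3 + real n) * M + \<bar>Sc s\<bar>)\<^sup>2"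
    by (simp add: c_def Y_def power_mult_distrib)
  have expand: "((3 + real n) * M + \<bar>Sc s\<bar>)\<^sup>2
      = (3 + real n)\<^sup>2 * M\<^sup>2 + 2 * (3 + real n) * M * \<bar>Sc s\<bar> + (Sc s)\<^sup>2"
    unfolding power2_sum power_mult_distrib power2_abs by simp
  \<comment> \<open>The second hypothesis says exactly that the determinant \<open>a * b - c\<^sup>2\<close> is positive.\<close>
  have alg: "(S + N + k - 2 * \<sigma> * r * M) * b - r * Y * (t\<^sup>2 * M\<^sup>2 + 2 * t * M * \<sigma> + S)
      = N * b - S * (r * Y - b) - 2 * r * M * (t * Y + b) * \<sigma> - (r * t\<^sup>2 * M\<^sup>2 * Y - k * b)"
    for S N k r t \<sigma> :: real
    by (simp add: algebra_simps)
  have "a * b - c\<^sup>2 = (norm (nonscalar_part s))\<^sup>2 * b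
           - (Sc s)\<^sup>2 * (real n * Y - b)
           - 2 * real n * M * ((3 + real n) * Y + b) * \<bar>Sc s\<bar>
           - (real n * (3 + real n)\<^sup>2 * M\<^sup>2 * Y - (real n)\<^sup>2 * b)"
    unfolding c2 a_def norm_sq_Sc_nonscalar[of s] expand by (rule alg)
  then have "c\<^sup>2 < a * b" using 2 by (simp add: b_def Y_def)
  then have "(a - b)\<^sup>2 + 4 * c\<^sup>2 < (a + b)\<^sup>2" by (simp add: power2_eq_square algebra_simps)
  then have "sqrt ((a - b)\<^sup>2 + 4 * c\<^sup>2) < a + b"
    using 1 by (intro real_less_lsqrt) (auto simp: a_def b_def)
  then show ?thesis by (simp add: H_const_def a_def b_def c_def)
qed


lemma cmult_diff_left: "(x - y) \<odot> z = x \<odot> z - y \<odot> z"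
  by (rule bilinear_lsub[OF bilinear_cmult])

lemma linear_grad_dirac: "linear (grad_dirac :: _ \<Rightarrow> 'n::{finite,linorder} clifford)"
  by (rule linearI) (simp_all add: grad_dirac_def cmult_add_right cmult_scale_right sum.distrib scaleR_sum_right)

lemma linear_grad_euler: "linear (grad_euler x)"
  by (rule linearI) (simp_all add: grad_euler_def sum.distrib scaleR_sum_right algebra_simps)

lemma lower_order_lincomb:
  "lower_order s x (a *\<^sub>R v + b *\<^sub>R v') (a *\<^sub>R p + b *\<^sub>R p') = a *\<^sub>R lower_order s x v p + b *\<^sub>R lower_order s x v' p'"
  by (simp add: lower_order_def linear_add[OF linear_grad_dirac] linear_cmul[OF linear_grad_dirac]
      linear_add[OF linear_grad_euler] linear_cmul[OF linear_grad_euler]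
      cmult_add_right cmult_scale_right algebra_simps)

lemma form_density_lincomb_left:
  "form_density s x (a *\<^sub>R v + b *\<^sub>R v') (a *\<^sub>R p + b *\<^sub>R p') w r = a * form_density s x v p w r + b * form_density s x v' p' w r"
  by (simp add: form_density_def lower_order_lincomb inner_add_left algebra_simps)

lemma form_density_lincomb_right:
  "form_density s x v p (a *\<^sub>R w + b *\<^sub>R w') (a *\<^sub>R r + b *\<^sub>R r') = a * form_density s x v p w r + b * form_density s x v p w' r'"
  by (simp add: form_density_def inner_add_right algebra_simps)

lemma form_density_bounded:
  fixes s :: "'n::{finite,linorder} clifford"
  assumes R: "0 \<le> R"
  shows "\<exists>K\<ge>0. \<forall>x v p w r. norm x \<le> R \<longrightarrow> \<bar>form_density s x v p w r\<bar> \<le> K * norm (v, p) * norm (w, r)"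
proof -
  let ?n = "real CARD('n)"
  define L where "L = 2 * (2 + ?n) * (1 + R\<^sup>2) * R + 2 * (1 + R\<^sup>2) * (R * sqrt ?n)
    + 2 * \<bar>Sc s\<bar> * ((1 + R\<^sup>2) * sqrt ?n + ?n * R) + ((norm s)\<^sup>2 + ?n\<^sup>2)"
  have L0: "0 \<le> L" unfolding L_def using R by (intro add_nonneg_nonneg mult_nonneg_nonneg) auto
  have main: "\<bar>form_density s x v p w r\<bar> \<le> ((1 + R\<^sup>2)\<^sup>2 + L) * norm (v, p) * norm (w, r)"
    if x: "norm x \<le> R" for x :: "'n point" and v p w r
  proof -
    let ?X = "1 + (norm x)\<^sup>2" and ?N = "norm (v, p)"
    have X: "0 \<le> ?X" "?X \<le> 1 + R\<^sup>2" using x by (auto simp: power_mono)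
    have le: "norm v \<le> ?N" "norm p \<le> ?N" "norm w \<le> norm (w, r)" "norm r \<le> norm (w, r)"
      using norm_fst_le[of "(v, p)"] norm_snd_le[of "(v, p)"] norm_fst_le[of "(w, r)"]
        norm_snd_le[of "(w, r)"] by (auto simp: norm_fst_le norm_snd_le)
    have E: "norm (grad_euler x p) \<le> R * ?N"
      by (rule order_trans[OF norm_grad_euler]) (use x le R in \<open>intro mult_mono; auto\<close>)
    have D: "norm (grad_dirac p) \<le> sqrt ?n * ?N"
      by (rule order_trans[OF norm_grad_dirac]) (use le in \<open>intro mult_left_mono; auto\<close>)
    have xD: "norm (cvec x \<odot> grad_dirac p) \<le> R * (sqrt ?n * ?N)"
      unfolding norm_cvec_cmult using x D R by (intro mult_mono) auto
    have xv: "norm (cvec x \<odot> v) \<le> R * ?N"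
      unfolding norm_cvec_cmult using x le R by (intro mult_mono) auto
    have 1: "norm ((2 * (2 + ?n) * ?X) *\<^sub>R grad_euler x p) \<le> (2 * (2 + ?n) * (1 + R\<^sup>2)) * (R * ?N)"
      unfolding norm_scaleR using E X by (intro mult_mono) auto
    have 2: "norm ((2 * ?X) *\<^sub>R (cvec x \<odot> grad_dirac p)) \<le> (2 * (1 + R\<^sup>2)) * (R * (sqrt ?n * ?N))"
      unfolding norm_scaleR using xD X by (intro mult_mono) auto
    have 3: "norm ((2 * Sc s) *\<^sub>R (?X *\<^sub>R grad_dirac p - ?n *\<^sub>R (cvec x \<odot> v)))
        \<le> (2 * \<bar>Sc s\<bar>) * ((1 + R\<^sup>2) * (sqrt ?n * ?N) + ?n * (R * ?N))"
    proof -
      have "norm (?X *\<^sub>R grad_dirac p) \<le> (1 + R\<^sup>2) * (sqrt ?n * ?N)"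
        unfolding norm_scaleR using D X by (intro mult_mono) auto
      moreover have "norm (?n *\<^sub>R (cvec x \<odot> v)) \<le> ?n * (R * ?N)"
        unfolding norm_scaleR using xv by (intro mult_mono) auto
      ultimately have "norm (?X *\<^sub>R grad_dirac p - ?n *\<^sub>R (cvec x \<odot> v))
          \<le> (1 + R\<^sup>2) * (sqrt ?n * ?N) + ?n * (R * ?N)"
        using norm_triangle_ineq4[of "?X *\<^sub>R grad_dirac p" "?n *\<^sub>R (cvec x \<odot> v)"] by linarith
      then show ?thesis unfolding norm_scaleR by (intro mult_mono) auto
    qed
    have 4: "norm (((norm s)\<^sup>2 + ?n\<^sup>2) *\<^sub>R v) \<le> ((norm s)\<^sup>2 + ?n\<^sup>2) * ?N"
      unfolding norm_scaleR using le by (intro mult_mono) auto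
    have "norm (lower_order s x v p) \<le> (2 * (2 + ?n) * (1 + R\<^sup>2)) * (R * ?N)
        + (2 * (1 + R\<^sup>2)) * (R * (sqrt ?n * ?N))
        + (2 * \<bar>Sc s\<bar>) * ((1 + R\<^sup>2) * (sqrt ?n * ?N) + ?n * (R * ?N)) + ((norm s)\<^sup>2 + ?n\<^sup>2) * ?N"
      unfolding lower_order_def
      by (intro norm_triangle_mono order_trans[OF norm_triangle_ineq4] add_mono 1 2 3 4)
    also have "\<dots> = L * ?N" by (simp add: L_def algebra_simps)
    finally have lo: "norm (lower_order s x v p) \<le> L * ?N" .
    have "\<bar>lower_order s x v p \<bullet> w\<bar> \<le> (L * ?N) * norm (w, r)"
      by (rule order_trans[OF Cauchy_Schwarz_ineq2]) (use lo le L0 in \<open>intro mult_mono; auto\<close>)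
    moreover have "\<bar>?X\<^sup>2 * (p \<bullet> r)\<bar> \<le> (1 + R\<^sup>2)\<^sup>2 * (?N * norm (w, r))"
    proof -
      have "\<bar>p \<bullet> r\<bar> \<le> ?N * norm (w, r)"
        by (rule order_trans[OF Cauchy_Schwarz_ineq2]) (use le in \<open>intro mult_mono; auto\<close>)
      then show ?thesis unfolding abs_mult using X by (intro mult_mono) (auto simp: power_mono)
    qed
    ultimately have "\<bar>form_density s x v p w r\<bar> \<le> (1 + R\<^sup>2)\<^sup>2 * (?N * norm (w, r)) + (L * ?N) * norm (w, r)"
      unfolding form_density_def
      using abs_triangle_ineq[of "?X\<^sup>2 * (p \<bullet> r)" "lower_order s x v p \<bullet> w"] by linarith
    also have "\<dots> = ((1 + R\<^sup>2)\<^sup>2 + L) * ?N * norm (w, r)" by (simp add: distrib_right mult.assoc)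
    finally show ?thesis .
  qed
  then show ?thesis using L0 by (intro exI[of _ "(1 + R\<^sup>2)\<^sup>2 + L"]) auto
qed

section \<open>Clifford-valued Lebesgue and Sobolev spaces\<close>

locale clifford_domain = bounded_domain \<Omega> for \<Omega> :: "'n::{finite,linorder} point set"
begin

lemma continuous_measurable:
  assumes "continuous_on UNIV b"
  shows "b \<in> borel_measurable M"
  using borel_measurable_continuous_onI[OF assms]
  by (intro measurable_restrict_space1 measurable_completion) auto

lemma L2_real_continuous_mult:
  fixes b :: "'n point \<Rightarrow> real"
  assumes b: "continuous_on UNIV b" and u: "u \<in> L2_real \<Omega>"
  shows "(\<lambda>x. b x * u x) \<in> L2_real \<Omega>"
proof -
  have "compact (b ` closure \<Omega>)"
    using domain_bounded by (intro compact_continuous_image continuous_on_subset[OF b]) auto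
  from compact_imp_bounded[OF this] obtain C where C: "\<forall>y\<in>b ` closure \<Omega>. norm y \<le> C"
    unfolding bounded_iff by blast
  have "AE x in M. \<bar>b x\<bar> \<le> C"
    by (rule AE_I2) (use C closure_subset[of \<Omega>] in auto)
  then show ?thesis
    using u continuous_measurable[OF b] unfolding L2_real_eq by (intro L2_space_bounded_mult)
qed

lemma L2_real_sum:
  assumes "finite I" "\<And>i. i \<in> I \<Longrightarrow> f i \<in> L2_real \<Omega>"
  shows "(\<lambda>x. \<Sum>i\<in>I. f i x) \<in> L2_real \<Omega>"
  using assms
proof (induction I rule: finite_induct)
  case empty
  show ?case using L2.closed_ops(1) by (simp add: zero_fun_def)
next
  case (insert i I)
  then have "f i + (\<lambda>x. \<Sum>i\<in>I. f i x) \<in> L2_real \<Omega>" by (intro L2.closed_ops) auto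
  then show ?case using insert by (simp add: plus_fun_def)
qed

lemma L2_clD: "F \<in> L2_cl \<Omega> \<Longrightarrow> (\<lambda>x. F x $ A) \<in> L2_real \<Omega>"
  by (simp add: L2_cl_def)

lemma subspace_L2_cl: "subspace (L2_cl \<Omega>)"
proof (rule subspaceI)
  show "0 \<in> L2_cl \<Omega>" using L2.closed_ops(1) by (simp add: L2_cl_def zero_fun_def)
  show "F + G \<in> L2_cl \<Omega>" if "F \<in> L2_cl \<Omega>" "G \<in> L2_cl \<Omega>" for F G
    using L2.closed_ops(2)[OF L2_clD[OF that(1)] L2_clD[OF that(2)]]
    by (simp add: L2_cl_def plus_fun_def)
  show "c *\<^sub>R F \<in> L2_cl \<Omega>" if "F \<in> L2_cl \<Omega>" for c F
    using L2.closed_ops(3)[OF L2_clD[OF that]] by (simp add: L2_cl_def scaleR_fun_def)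
qed

lemma L2_cl_integrable_inner:
  assumes "F \<in> L2_cl \<Omega>" "G \<in> L2_cl \<Omega>"
  shows "integrable M (\<lambda>x. F x \<bullet> G x)"
  unfolding inner_vec_def inner_real_def
  by (intro Bochner_Integration.integrable_sum L2_integrable_mult L2_clD assms)

sublocale CL: semi_inner_space "L2_cl \<Omega>" "\<lambda>F G. LINT x|M. F x \<bullet> G x"
proof
  show "subspace (L2_cl \<Omega>)" by (rule subspace_L2_cl)
  show "(LINT x|M. (F + G) x \<bullet> K x) = (LINT x|M. F x \<bullet> K x) + (LINT x|M. G x \<bullet> K x)"
    if "F \<in> L2_cl \<Omega>" "G \<in> L2_cl \<Omega>" "K \<in> L2_cl \<Omega>" for F G K
    using that by (simp add: inner_add_left L2_cl_integrable_inner)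
qed (simp_all add: inner_commute)

lemma L2_cl_diff: "F \<in> L2_cl \<Omega> \<Longrightarrow> G \<in> L2_cl \<Omega> \<Longrightarrow> (\<lambda>x. F x - G x) \<in> L2_cl \<Omega>"
  using CL.closed_ops(4)[of F G] by (simp add: fun_diff_def)

lemma L2_cl_scale:
  assumes "continuous_on UNIV b" "F \<in> L2_cl \<Omega>"
  shows "(\<lambda>x. b x *\<^sub>R F x) \<in> L2_cl \<Omega>"
  using L2_real_continuous_mult[OF assms(1) L2_clD[OF assms(2)]] by (simp add: L2_cl_def)

lemma L2_cl_sum:
  assumes "finite I" "\<And>i. i \<in> I \<Longrightarrow> F i \<in> L2_cl \<Omega>"
  shows "(\<lambda>x. \<Sum>i\<in>I. F i x) \<in> L2_cl \<Omega>"
  using L2_real_sum[OF assms(1), of "\<lambda>i x. F i x $ A" for A] assms(2) by (simp add: L2_cl_def)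

lemma L2_cl_linear:
  assumes T: "linear T" and F: "F \<in> L2_cl \<Omega>"
  shows "(\<lambda>x. T (F x)) \<in> L2_cl \<Omega>"
proof -
  have "(\<lambda>x. T (F x) $ C) \<in> L2_real \<Omega>" for C
  proof -
    have "T (F x) $ C = (\<Sum>B\<in>UNIV. T (cblade B) $ C * F x $ B)" for x
    proof -
      have "T (F x) = T (\<Sum>B\<in>UNIV. F x $ B *\<^sub>R cblade B)"
        by (simp only: clifford_expansion[symmetric])
      then show ?thesis by (simp add: linear_sum[OF T] linear_cmul[OF T] mult.commute)
    qed
    then show ?thesis
      using L2_real_sum[of UNIV "\<lambda>B x. T (cblade B) $ C * F x $ B"]
        L2_real_continuous_mult[OF continuous_on_const L2_clD[OF F]] by simp
  qed
  then show ?thesis by (simp add: L2_cl_def)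
qed

lemma L2_cl_cvec:
  assumes F: "F \<in> L2_cl \<Omega>"
  shows "(\<lambda>x. cvec x \<odot> F x) \<in> L2_cl \<Omega>"
proof -
  have "(\<lambda>x. \<Sum>i\<in>UNIV. x $ i *\<^sub>R (cgen i \<odot> F x)) \<in> L2_cl \<Omega>"
    by (intro L2_cl_sum L2_cl_scale L2_cl_linear[OF linear_cmult_right] F continuous_intros) auto
  then show ?thesis by (simp add: cvec_def cmult_sum_left cmult_scale_left)
qed

lemma cl_inner_integrable:
  assumes "F \<in> L2_cl \<Omega>" "G \<in> L2_cl \<Omega>"
  shows "integrable M (\<lambda>x. cconj (F x) \<odot> G x)"
proof -
  have "integrable M (\<lambda>x. (cconj (F x) $ A * G x $ B * csign A B) *\<^sub>R cblade (sym_diff A B))" for A B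
  proof -
    have "integrable M (\<lambda>x. csign A A * csign A B * (F x $ A * G x $ B))"
      by (intro integrable_mult_right L2_integrable_mult L2_clD assms)
    then show ?thesis by (intro integrable_scaleR_left) (simp add: cconj_component mult_ac)
  qed
  then show ?thesis unfolding cmult_def by (intro Bochner_Integration.integrable_sum)
qed

lemma Sc_cl_inner:
  assumes "F \<in> L2_cl \<Omega>" "G \<in> L2_cl \<Omega>"
  shows "Sc (cl_inner \<Omega> F G) = (LINT x|M. F x \<bullet> G x)"
proof -
  have "bounded_linear (Sc :: 'n clifford \<Rightarrow> real)"
    unfolding Sc_def by (rule bounded_linear_vec_nth)
  from integral_bounded_linear[OF this cl_inner_integrable[OF assms]]
  show ?thesis by (simp add: cl_inner_def Sc_cconj_cmult)
qed

lemma cl_inner_right_mult: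
  assumes "F \<in> L2_cl \<Omega>" "G \<in> L2_cl \<Omega>"
  shows "cl_inner \<Omega> F (\<lambda>x. G x \<odot> a) = cl_inner \<Omega> F G \<odot> a"
proof -
  have "bounded_linear (\<lambda>z. z \<odot> a)"
    using linear_cmult_left linear_conv_bounded_linear by blast
  from integral_bounded_linear[OF this cl_inner_integrable[OF assms]]
  show ?thesis by (simp add: cl_inner_def cmult_assoc)
qed

lemma cl_inner_cong_AE:
  assumes "F \<in> L2_cl \<Omega>" "G \<in> L2_cl \<Omega>" "G' \<in> L2_cl \<Omega>" "AE x in M. G x = G' x"
  shows "cl_inner \<Omega> F G = cl_inner \<Omega> F G'"
  unfolding cl_inner_def
proof (rule integral_cong_AE)
  show "AE x in M. cconj (F x) \<odot> G x = cconj (F x) \<odot> G' x"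
    using assms(4) by eventually_elim simp
qed (use cl_inner_integrable[OF assms(1,2)] cl_inner_integrable[OF assms(1,3)] in auto)

lemma cl_norm2_eq: "F \<in> L2_cl \<Omega> \<Longrightarrow> cl_norm2 \<Omega> F = CL.nrm F"
  by (simp add: cl_norm2_def CL.nrm_def Sc_cl_inner)

lemma CL_ip_components:
  assumes "F \<in> L2_cl \<Omega>" "G \<in> L2_cl \<Omega>"
  shows "(LINT x|M. F x \<bullet> G x) = (\<Sum>A\<in>UNIV. LINT x|M. F x $ A * G x $ A)"
  unfolding inner_vec_def inner_real_def
  by (intro Bochner_Integration.integral_sum L2_integrable_mult L2_clD assms)

lemma H10_clD: "F \<in> H10_cl \<Omega> \<Longrightarrow> (\<lambda>x. F x $ A) \<in> H10_real \<Omega>"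
  by (simp add: H10_cl_def)

lemma H10_clD1: "F \<in> H10_cl \<Omega> \<Longrightarrow> (\<lambda>x. F x $ A) \<in> H1_real \<Omega>"
  by (intro H10_imp_H1 H10_clD)

lemma H10_cl_L2: "F \<in> H10_cl \<Omega> \<Longrightarrow> F \<in> L2_cl \<Omega>"
  using H1_D(1)[OF H10_clD1] by (simp add: L2_cl_def)

lemma weak_partial_cl_L2: "F \<in> H10_cl \<Omega> \<Longrightarrow> weak_partial_cl \<Omega> i F \<in> L2_cl \<Omega>"
  using H1_D(2)[OF H10_clD1] by (simp add: L2_cl_def weak_partial_cl_def)

lemma subspace_H10_cl: "subspace (H10_cl \<Omega>)"
proof (rule subspaceI)
  show "0 \<in> H10_cl \<Omega>" using zero_H10 by (simp add: H10_cl_def zero_fun_def)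
  show "F + G \<in> H10_cl \<Omega>" if "F \<in> H10_cl \<Omega>" "G \<in> H10_cl \<Omega>" for F G
    using subspace_add[OF subspace_H10 H10_clD[OF that(1)] H10_clD[OF that(2)]]
    by (simp add: H10_cl_def plus_fun_def)
  show "c *\<^sub>R F \<in> H10_cl \<Omega>" if "F \<in> H10_cl \<Omega>" for c F
    using subspace_scale[OF subspace_H10 H10_clD[OF that]]
    by (simp add: H10_cl_def scaleR_fun_def)
qed

text \<open>The weak gradient.\<close>

definition grad :: "('n point \<Rightarrow> 'n clifford) \<Rightarrow> 'n point \<Rightarrow> ('n clifford, 'n) vec" where
  "grad F x = (\<chi> i. weak_partial_cl \<Omega> i F x)"

lemma grad_lincomb:
  assumes "F \<in> H10_cl \<Omega>" "G \<in> H10_cl \<Omega>"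
  shows "AE x in M. grad (a *\<^sub>R F + b *\<^sub>R G) x = a *\<^sub>R grad F x + b *\<^sub>R grad G x"
proof -
  have "AE x in M. \<forall>i A. weak_partial \<Omega> i (\<lambda>y. (a *\<^sub>R F + b *\<^sub>R G) y $ A) x
      = a * weak_partial \<Omega> i (\<lambda>y. F y $ A) x + b * weak_partial \<Omega> i (\<lambda>y. G y $ A) x"
  proof (intro eventually_all_finite)
    fix i A
    have "(\<lambda>y. (a *\<^sub>R F + b *\<^sub>R G) y $ A) = a *\<^sub>R (\<lambda>y. F y $ A) + b *\<^sub>R (\<lambda>y. G y $ A)"
      by (simp add: plus_fun_def scaleR_fun_def)
    then show "AE x in M. weak_partial \<Omega> i (\<lambda>y. (a *\<^sub>R F + b *\<^sub>R G) y $ A) x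
      = a * weak_partial \<Omega> i (\<lambda>y. F y $ A) x + b * weak_partial \<Omega> i (\<lambda>y. G y $ A) x"
      using H1_lincomb(2)[OF H10_clD1[OF assms(1)] H10_clD1[OF assms(2)]] by simp
  qed
  then show ?thesis
    by eventually_elim (simp add: grad_def weak_partial_cl_def vec_eq_iff)
qed

text \<open>The scalar inner product of \<open>H10_cl\<close>, as the sum of those of the coefficients; its squared norm is
\<open>(cl_norm2 \<Omega> F)\<^sup>2 + (cl_normD \<Omega> F)\<^sup>2\<close>.\<close>

definition H10_ip :: "('n point \<Rightarrow> 'n clifford) \<Rightarrow> ('n point \<Rightarrow> 'n clifford) \<Rightarrow> real" where
  "H10_ip F G = (\<Sum>A\<in>UNIV. H1_ip (\<lambda>x. F x $ A) (\<lambda>x. G x $ A))"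

sublocale H10: semi_inner_space "H10_cl \<Omega>" H10_ip
proof
  show "subspace (H10_cl \<Omega>)" by (rule subspace_H10_cl)
  fix F G assume F: "F \<in> H10_cl \<Omega>" and G: "G \<in> H10_cl \<Omega>"
  show "H10_ip F G = H10_ip G F"
    unfolding H10_ip_def by (intro sum.cong refl H1.ip_commute H10_clD1 F G)
  show "H10_ip (c *\<^sub>R F) G = c * H10_ip F G" for c
    using H1.ip_scale[OF H10_clD1[OF F] H10_clD1[OF G]]
    by (simp add: H10_ip_def scaleR_fun_def sum_distrib_left)
  show "H10_ip (F + G) K = H10_ip F K + H10_ip G K" if "K \<in> H10_cl \<Omega>" for K
    using H1.ip_add[OF H10_clD1[OF F] H10_clD1[OF G] H10_clD1[OF that]]
    by (simp add: H10_ip_def plus_fun_def sum.distrib)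
next
  show "0 \<le> H10_ip F F" if "F \<in> H10_cl \<Omega>" for F
    unfolding H10_ip_def by (intro sum_nonneg H1.ip_nonneg H10_clD1 that)
qed

lemma H10_nrm_sq: "F \<in> H10_cl \<Omega> \<Longrightarrow> (H10.nrm F)\<^sup>2 = (\<Sum>A\<in>UNIV. (H1.nrm (\<lambda>x. F x $ A))\<^sup>2)"
  by (simp add: H10.nrm_sq H10_ip_def H1.nrm_sq H10_clD1)

lemma H1_nrm_le_H10:
  assumes "F \<in> H10_cl \<Omega>"
  shows "H1.nrm (\<lambda>x. F x $ A) \<le> H10.nrm F"
proof (rule power2_le_imp_le)
  show "(H1.nrm (\<lambda>x. F x $ A))\<^sup>2 \<le> (H10.nrm F)\<^sup>2"
    unfolding H10_nrm_sq[OF assms] by (rule member_le_sum) auto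
qed (simp add: assms)

sublocale H10: complete_semi_inner_space "H10_cl \<Omega>" H10_ip
proof (unfold_locales, goal_cases)
  case (1 X)
  then have X: "\<And>n. X n \<in> H10_cl \<Omega>" and sm: "summable (\<lambda>n. H10.nrm (X (Suc n) - X n))" by auto
  have dX: "X (Suc n) - X n \<in> H10_cl \<Omega>" for n using X by (intro H10.closed_ops)
  have cX: "(\<lambda>x. X (Suc n) x $ A) - (\<lambda>x. X n x $ A) = (\<lambda>x. (X (Suc n) - X n) x $ A)" for n A
    by (simp add: fun_diff_def)
  have "\<exists>u\<in>H10_real \<Omega>. (\<lambda>n. H1.nrm ((\<lambda>x. X n x $ A) - u)) \<longlonglongrightarrow> 0" for A
  proof (rule H10_complete)
    show "summable (\<lambda>n. H1.nrm ((\<lambda>x. X (Suc n) x $ A) - (\<lambda>x. X n x $ A)))"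
      unfolding cX
      by (rule summable_comparison_test'[OF sm, of 0])
         (use H1_nrm_le_H10[OF dX] H10_clD1[OF dX] in auto)
  qed (rule H10_clD[OF X])
  then have "\<forall>A. \<exists>u. u \<in> H10_real \<Omega> \<and> (\<lambda>n. H1.nrm ((\<lambda>x. X n x $ A) - u)) \<longlonglongrightarrow> 0"
    unfolding Bex_def by (rule allI)
  from choice[OF this] obtain u where "\<forall>A. u A \<in> H10_real \<Omega> \<and>
      (\<lambda>n. H1.nrm ((\<lambda>x. X n x $ A) - u A)) \<longlonglongrightarrow> 0" ..
  then have u: "\<And>A. u A \<in> H10_real \<Omega>" "\<And>A. (\<lambda>n. H1.nrm ((\<lambda>x. X n x $ A) - u A)) \<longlonglongrightarrow> 0"
    by (simp_all only: simp_thms)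
  define L where "L x = (\<chi> A. u A x)" for x
  have L: "L \<in> H10_cl \<Omega>" using u(1) by (simp add: H10_cl_def L_def)
  have XL: "X n - L \<in> H10_cl \<Omega>" for n using X L by (intro H10.closed_ops)
  have c: "(\<lambda>x. (X n - L) x $ A) = (\<lambda>x. X n x $ A) - u A" for n A
    by (simp add: fun_diff_def L_def)
  have "(\<lambda>n. \<Sum>A\<in>UNIV. (H1.nrm ((\<lambda>x. X n x $ A) - u A))\<^sup>2) \<longlonglongrightarrow> (\<Sum>A\<in>(UNIV :: 'n set set). 0\<^sup>2)"
    by (intro tendsto_sum tendsto_power u(2))
  then have "(\<lambda>n. (H10.nrm (X n - L))\<^sup>2) \<longlonglongrightarrow> 0"
    by (simp only: H10_nrm_sq[OF XL] c) simp
  then have "(\<lambda>n. sqrt ((H10.nrm (X n - L))\<^sup>2)) \<longlonglongrightarrow> sqrt 0" by (rule tendsto_real_sqrt)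
  then have "(\<lambda>n. H10.nrm (X n - L)) \<longlonglongrightarrow> 0" using H10.nrm_nonneg[OF XL] by simp
  then show ?case using L by blast
qed

lemma grad_inner:
  "grad F x \<bullet> grad G x = (\<Sum>i\<in>UNIV. weak_partial_cl \<Omega> i F x \<bullet> weak_partial_cl \<Omega> i G x)"
  unfolding inner_vec_def[of "grad F x"] by (simp add: grad_def)

lemma integrable_grad_inner:
  assumes "F \<in> H10_cl \<Omega>" "G \<in> H10_cl \<Omega>"
  shows "integrable M (\<lambda>x. grad F x \<bullet> grad G x)"
proof -
  have "integrable M (\<lambda>x. weak_partial_cl \<Omega> i F x \<bullet> weak_partial_cl \<Omega> i G x)" for i
    by (intro L2_cl_integrable_inner weak_partial_cl_L2 assms)
  then show ?thesis
    unfolding grad_inner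
    by (intro Bochner_Integration.integrable_sum)
qed

lemma H10_ip_eq:
  assumes F: "F \<in> H10_cl \<Omega>" and G: "G \<in> H10_cl \<Omega>"
  shows "H10_ip F G = (LINT x|M. F x \<bullet> G x) + (\<Sum>i\<in>UNIV. LINT x|M. weak_partial_cl \<Omega> i F x \<bullet> weak_partial_cl \<Omega> i G x)"
    and "H10_ip F G = (LINT x|M. F x \<bullet> G x + grad F x \<bullet> grad G x)"
proof -
  have "(\<Sum>A\<in>UNIV. \<Sum>i\<in>UNIV. LINT x|M. weak_partial \<Omega> i (\<lambda>x. F x $ A) x * weak_partial \<Omega> i (\<lambda>x. G x $ A) x)
    = (\<Sum>i\<in>UNIV. LINT x|M. weak_partial_cl \<Omega> i F x \<bullet> weak_partial_cl \<Omega> i G x)"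
    unfolding CL_ip_components[OF weak_partial_cl_L2[OF F] weak_partial_cl_L2[OF G]]
    unfolding weak_partial_cl_def vec_lambda_beta by (rule sum.swap)
  then show 1: "H10_ip F G = (LINT x|M. F x \<bullet> G x) + (\<Sum>i\<in>UNIV. LINT x|M. weak_partial_cl \<Omega> i F x \<bullet> weak_partial_cl \<Omega> i G x)"
    by (simp add: H10_ip_def H1_ip_def sum.distrib CL_ip_components H10_cl_L2 F G)
  have "(LINT x|M. grad F x \<bullet> grad G x) = (\<Sum>i\<in>UNIV. LINT x|M. weak_partial_cl \<Omega> i F x \<bullet> weak_partial_cl \<Omega> i G x)"
    unfolding grad_inner
    by (intro Bochner_Integration.integral_sum L2_cl_integrable_inner weak_partial_cl_L2 F G)
  then show "H10_ip F G = (LINT x|M. F x \<bullet> G x + grad F x \<bullet> grad G x)"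
    using 1 by (simp add: L2_cl_integrable_inner integrable_grad_inner H10_cl_L2 F G)
qed

lemma norms_le_H10_nrm:
  assumes F: "F \<in> H10_cl \<Omega>"
  shows "(H10.nrm F)\<^sup>2 = (cl_norm2 \<Omega> F)\<^sup>2 + (cl_normD \<Omega> F)\<^sup>2"
    and "cl_norm2 \<Omega> F \<le> H10.nrm F" and "cl_normD \<Omega> F \<le> H10.nrm F"
proof -
  have "(cl_normD \<Omega> F)\<^sup>2 = (\<Sum>i\<in>UNIV. (cl_norm2 \<Omega> (weak_partial_cl \<Omega> i F))\<^sup>2)"
    by (simp add: cl_normD_def sum_nonneg)
  then show eq: "(H10.nrm F)\<^sup>2 = (cl_norm2 \<Omega> F)\<^sup>2 + (cl_normD \<Omega> F)\<^sup>2"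
    using F by (simp add: H10.nrm_sq H10_ip_eq(1) cl_norm2_eq CL.nrm_sq H10_cl_L2 weak_partial_cl_L2)
  show "cl_norm2 \<Omega> F \<le> H10.nrm F" "cl_normD \<Omega> F \<le> H10.nrm F"
    by (rule power2_le_imp_le; use eq F in simp)+
qed

section \<open>The sesquilinear form and its weak solutions\<close>

lemma operators_L2:
  assumes F: "F \<in> H10_cl \<Omega>"
  shows "dirac_euclid \<Omega> F \<in> L2_cl \<Omega>" "euler_op \<Omega> F \<in> L2_cl \<Omega>" "dirac_sphere \<Omega> F \<in> L2_cl \<Omega>"
proof -
  show d: "dirac_euclid \<Omega> F \<in> L2_cl \<Omega>"
    unfolding dirac_euclid_def[abs_def]
    by (intro L2_cl_sum L2_cl_linear[OF linear_cmult_right] weak_partial_cl_L2 F) auto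
  show "euler_op \<Omega> F \<in> L2_cl \<Omega>"
    unfolding euler_op_def[abs_def]
    by (intro L2_cl_sum L2_cl_scale weak_partial_cl_L2 F continuous_intros) auto
  show "dirac_sphere \<Omega> F \<in> L2_cl \<Omega>"
    unfolding dirac_sphere_def[abs_def]
    by (intro L2_cl_diff L2_cl_scale L2_cl_cvec d H10_cl_L2 F continuous_intros)
qed

lemma q_form_arguments_L2:
  assumes F: "F \<in> H10_cl \<Omega>"
  shows "(\<lambda>x. (1 + (norm x)\<^sup>2)\<^sup>2 *\<^sub>R weak_partial_cl \<Omega> i F x) \<in> L2_cl \<Omega>"
    "(\<lambda>x. (1 + (norm x)\<^sup>2) *\<^sub>R euler_op \<Omega> F x) \<in> L2_cl \<Omega>"
    "(\<lambda>x. (1 + (norm x)\<^sup>2) *\<^sub>R (cvec x \<odot> dirac_euclid \<Omega> F x)) \<in> L2_cl \<Omega>"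
  by (intro L2_cl_scale L2_cl_cvec operators_L2 weak_partial_cl_L2 F continuous_intros)+

lemma Sc_q_form:
  assumes F: "F \<in> H10_cl \<Omega>" and G: "G \<in> H10_cl \<Omega>"
  shows "integrable M (\<lambda>x. form_density s x (F x) (grad F x) (G x) (grad G x))"
    and "Sc (q_form \<Omega> s F G) = (LINT x|M. form_density s x (F x) (grad F x) (G x) (grad G x))"
proof -
  note L = q_form_arguments_L2[OF F] operators_L2(3)[OF F] H10_cl_L2[OF F]
  note GL = H10_cl_L2[OF G] weak_partial_cl_L2[OF G]
  let ?D = "\<lambda>x. (\<Sum>i\<in>UNIV. ((1 + (norm x)\<^sup>2)\<^sup>2 *\<^sub>R weak_partial_cl \<Omega> i F x) \<bullet> weak_partial_cl \<Omega> i G x)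
     + (2 * (2 + real CARD('n))) * (((1 + (norm x)\<^sup>2) *\<^sub>R euler_op \<Omega> F x) \<bullet> G x)
     + 2 * (((1 + (norm x)\<^sup>2) *\<^sub>R (cvec x \<odot> dirac_euclid \<Omega> F x)) \<bullet> G x)
     - (2 * Sc s) * (dirac_sphere \<Omega> F x \<bullet> G x)
     + ((norm s)\<^sup>2 + (real CARD('n))\<^sup>2) * (F x \<bullet> G x)"
  have D: "form_density s x (F x) (grad F x) (G x) (grad G x) = ?D x" for x
  proof -
    have "grad_dirac (grad F x) = dirac_euclid \<Omega> F x" "grad_euler x (grad F x) = euler_op \<Omega> F x"
      by (simp_all add: grad_dirac_def grad_euler_def grad_def dirac_euclid_def euler_op_def)
    then show ?thesis
      unfolding form_density_def lower_order_def grad_inner dirac_sphere_def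
      by (simp add: inner_add_left inner_diff_left sum_distrib_left algebra_simps)
  qed
  have int: "integrable M (\<lambda>x. \<Sum>i\<in>UNIV. ((1 + (norm x)\<^sup>2)\<^sup>2 *\<^sub>R weak_partial_cl \<Omega> i F x) \<bullet> weak_partial_cl \<Omega> i G x)"
    "integrable M (\<lambda>x. (2 * (2 + real CARD('n))) * (((1 + (norm x)\<^sup>2) *\<^sub>R euler_op \<Omega> F x) \<bullet> G x))"
    "integrable M (\<lambda>x. 2 * (((1 + (norm x)\<^sup>2) *\<^sub>R (cvec x \<odot> dirac_euclid \<Omega> F x)) \<bullet> G x))"
    "integrable M (\<lambda>x. (2 * Sc s) * (dirac_sphere \<Omega> F x \<bullet> G x))"
    "integrable M (\<lambda>x. ((norm s)\<^sup>2 + (real CARD('n))\<^sup>2) * (F x \<bullet> G x))"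
    by (intro Bochner_Integration.integrable_sum integrable_mult_right L2_cl_integrable_inner L GL)+
  show "integrable M (\<lambda>x. form_density s x (F x) (grad F x) (G x) (grad G x))"
    unfolding D by (intro Bochner_Integration.integrable_add Bochner_Integration.integrable_diff int)
  have lin: "Sc (a + b) = Sc a + Sc b" "Sc (a - b) = Sc a - Sc b" "Sc (c *\<^sub>R a) = c * Sc a"
    "Sc (sum f I) = (\<Sum>i\<in>I. Sc (f i))" for a b :: "'n clifford" and c and f :: "'n \<Rightarrow> 'n clifford" and I
    by (simp_all add: Sc_def)
  have "Sc (q_form \<Omega> s F G) =
     (\<Sum>i\<in>UNIV. LINT x|M. ((1 + (norm x)\<^sup>2)\<^sup>2 *\<^sub>R weak_partial_cl \<Omega> i F x) \<bullet> weak_partial_cl \<Omega> i G x)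
     + (2 * (2 + real CARD('n))) * (LINT x|M. ((1 + (norm x)\<^sup>2) *\<^sub>R euler_op \<Omega> F x) \<bullet> G x)
     + 2 * (LINT x|M. ((1 + (norm x)\<^sup>2) *\<^sub>R (cvec x \<odot> dirac_euclid \<Omega> F x)) \<bullet> G x)
     - (2 * Sc s) * (LINT x|M. dirac_sphere \<Omega> F x \<bullet> G x)
     + ((norm s)\<^sup>2 + (real CARD('n))\<^sup>2) * (LINT x|M. F x \<bullet> G x)"
    unfolding q_form_def lin Sc_cl_inner[OF L(1) GL(2)] Sc_cl_inner[OF L(2) GL(1)]
      Sc_cl_inner[OF L(3) GL(1)] Sc_cl_inner[OF L(4) GL(1)] Sc_cl_inner[OF L(5) GL(1)] by (rule refl)
  also have "\<dots> = (LINT x|M. ?D x)"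
    by (simp only: Bochner_Integration.integral_add Bochner_Integration.integral_diff
        Bochner_Integration.integrable_add Bochner_Integration.integrable_diff int
        integral_mult_right_zero Bochner_Integration.integral_sum L2_cl_integrable_inner L GL)
  finally show "Sc (q_form \<Omega> s F G) = (LINT x|M. form_density s x (F x) (grad F x) (G x) (grad G x))"
    unfolding D .
qed

lemma Sc_q_form_lincomb_left:
  assumes F: "F \<in> H10_cl \<Omega>" and F': "F' \<in> H10_cl \<Omega>" and G: "G \<in> H10_cl \<Omega>"
  shows "Sc (q_form \<Omega> s (a *\<^sub>R F + b *\<^sub>R F') G) = a * Sc (q_form \<Omega> s F G) + b * Sc (q_form \<Omega> s F' G)"
proof -
  let ?d = "\<lambda>F x. form_density s x (F x) (grad F x) (G x) (grad G x)"
  have FF: "a *\<^sub>R F + b *\<^sub>R F' \<in> H10_cl \<Omega>" by (intro H10.closed_ops F F')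
  note int = Sc_q_form(1)[OF F G, of s] Sc_q_form(1)[OF F' G, of s] Sc_q_form(1)[OF FF G, of s]
  have "(LINT x|M. ?d (a *\<^sub>R F + b *\<^sub>R F') x) = (LINT x|M. a * ?d F x + b * ?d F' x)"
  proof (rule integral_cong_AE)
    show "AE x in M. ?d (a *\<^sub>R F + b *\<^sub>R F') x = a * ?d F x + b * ?d F' x"
      using grad_lincomb[OF F F', of a b]
      by eventually_elim (simp add: form_density_lincomb_left)
  qed (use int in auto)
  then show ?thesis using int by (simp add: Sc_q_form(2) F F' G FF)
qed

lemma Sc_q_form_lincomb_right:
  assumes F: "F \<in> H10_cl \<Omega>" and G: "G \<in> H10_cl \<Omega>" and G': "G' \<in> H10_cl \<Omega>"
  shows "Sc (q_form \<Omega> s F (a *\<^sub>R G + b *\<^sub>R G')) = a * Sc (q_form \<Omega> s F G) + b * Sc (q_form \<Omega> s F G')"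
proof -
  let ?d = "\<lambda>G x. form_density s x (F x) (grad F x) (G x) (grad G x)"
  have GG: "a *\<^sub>R G + b *\<^sub>R G' \<in> H10_cl \<Omega>" by (intro H10.closed_ops G G')
  note int = Sc_q_form(1)[OF F G, of s] Sc_q_form(1)[OF F G', of s] Sc_q_form(1)[OF F GG, of s]
  have "(LINT x|M. ?d (a *\<^sub>R G + b *\<^sub>R G') x) = (LINT x|M. a * ?d G x + b * ?d G' x)"
  proof (rule integral_cong_AE)
    show "AE x in M. ?d (a *\<^sub>R G + b *\<^sub>R G') x = a * ?d G x + b * ?d G' x"
      using grad_lincomb[OF G G', of a b]
      by eventually_elim (simp add: form_density_lincomb_right)
  qed (use int in auto)
  then show ?thesis using int by (simp add: Sc_q_form(2) F G G' GG)
qed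

text \<open>The pointwise Euclidean norm of a function together with its gradient; its \<open>L\<^sup>2\<close> norm is the norm of \<open>H10_ip\<close>.\<close>

definition jet_norm :: "('n point \<Rightarrow> 'n clifford) \<Rightarrow> 'n point \<Rightarrow> real" where
  "jet_norm F x = norm (F x, grad F x)"

lemma jet_norm_L2:
  assumes F: "F \<in> H10_cl \<Omega>"
  shows "jet_norm F \<in> L2_real \<Omega>" "L2.nrm (jet_norm F) = H10.nrm F"
proof -
  have eq: "(jet_norm F x)\<^sup>2 = F x \<bullet> F x + grad F x \<bullet> grad F x" for x
    by (simp add: jet_norm_def power2_norm_eq_inner inner_prod_def)
  have int: "integrable M (\<lambda>x. (jet_norm F x)\<^sup>2)"
    unfolding eq by (intro Bochner_Integration.integrable_add L2_cl_integrable_inner H10_cl_L2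
        integrable_grad_inner F)
  then have "(\<lambda>x. sqrt ((jet_norm F x)\<^sup>2)) \<in> borel_measurable M" by measurable
  moreover have "(\<lambda>x. sqrt ((jet_norm F x)\<^sup>2)) = jet_norm F"
    by (rule ext) (simp add: jet_norm_def)
  ultimately show "jet_norm F \<in> L2_real \<Omega>" using int by (simp add: L2_real_def)
  show "L2.nrm (jet_norm F) = H10.nrm F"
    by (simp add: L2_nrm eq H10.nrm_def H10_ip_eq(2) F)
qed

lemma Sc_q_form_bounded:
  "\<exists>K. \<forall>F\<in>H10_cl \<Omega>. \<forall>G\<in>H10_cl \<Omega>. \<bar>Sc (q_form \<Omega> s F G)\<bar> \<le> K * H10.nrm F * H10.nrm G"
proof -
  obtain R where R: "\<And>x. x \<in> \<Omega> \<Longrightarrow> norm x \<le> R" "0 \<le> R"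
    using domain_bounded by (metis bounded_pos less_imp_le)
  obtain K where K0: "0 \<le> K" and K: "\<And>x v p w r. norm x \<le> R \<Longrightarrow>
      \<bar>form_density s x v p w r\<bar> \<le> K * norm (v, p) * norm (w, r)"
    using form_density_bounded[OF R(2)] by blast
  have "\<bar>Sc (q_form \<Omega> s F G)\<bar> \<le> K * H10.nrm F * H10.nrm G"
    if F: "F \<in> H10_cl \<Omega>" and G: "G \<in> H10_cl \<Omega>" for F G
  proof -
    note J = jet_norm_L2[OF F] jet_norm_L2[OF G]
    have "\<bar>Sc (q_form \<Omega> s F G)\<bar> \<le> (LINT x|M. \<bar>form_density s x (F x) (grad F x) (G x) (grad G x)\<bar>)"
      unfolding Sc_q_form(2)[OF F G] by (rule integral_abs_bound)
    also have "\<dots> \<le> (LINT x|M. K * (jet_norm F x * jet_norm G x))"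
    proof (rule integral_mono)
      show "integrable M (\<lambda>x. K * (jet_norm F x * jet_norm G x))"
        by (intro integrable_mult_right L2_integrable_mult J)
      show "\<bar>form_density s x (F x) (grad F x) (G x) (grad G x)\<bar> \<le> K * (jet_norm F x * jet_norm G x)"
        if "x \<in> space M" for x
        using K[OF R(1)[of x]] that by (simp add: jet_norm_def mult.assoc)
    qed (use Sc_q_form(1)[OF F G] in auto)
    also have "\<dots> = K * (LINT x|M. jet_norm F x * jet_norm G x)" by simp
    also have "\<dots> \<le> K * (L2.nrm (jet_norm F) * L2.nrm (jet_norm G))"
      using L2.Cauchy_Schwarz[OF J(1,3)] K0 by (intro mult_left_mono) auto
    finally show ?thesis by (simp add: J mult.assoc)
  qed
  then show ?thesis by blast
qed

lemma Sc_q_form_coercive: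
  assumes m: "0 \<le> m" "\<And>x. x \<in> \<Omega> \<Longrightarrow> m \<le> norm x" and B: "\<And>x. x \<in> \<Omega> \<Longrightarrow> norm x \<le> B"
    and F: "F \<in> H10_cl \<Omega>"
  shows "H_const CARD('n) m B s * H10_ip F F \<le> Sc (q_form \<Omega> s F F)"
proof -
  let ?H = "H_const CARD('n) m B s"
  have "?H * H10_ip F F = (LINT x|M. ?H * (F x \<bullet> F x + grad F x \<bullet> grad F x))"
    by (simp add: H10_ip_eq(2) F)
  also have "\<dots> \<le> (LINT x|M. form_density s x (F x) (grad F x) (F x) (grad F x))"
  proof (rule integral_mono)
    show "integrable M (\<lambda>x. ?H * (F x \<bullet> F x + grad F x \<bullet> grad F x))"
      by (intro integrable_mult_right Bochner_Integration.integrable_add L2_cl_integrable_inner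
          H10_cl_L2 integrable_grad_inner F)
    show "integrable M (\<lambda>x. form_density s x (F x) (grad F x) (F x) (grad F x))"
      by (rule Sc_q_form(1)[OF F F])
    show "?H * (F x \<bullet> F x + grad F x \<bullet> grad F x) \<le> form_density s x (F x) (grad F x) (F x) (grad F x)"
      if "x \<in> space M" for x
      using form_density_coercive[OF m(1) m(2) B, of x s "F x" "grad F x"] that
      by (simp add: power2_norm_eq_inner)
  qed
  finally show ?thesis by (simp add: Sc_q_form(2) F)
qed

text \<open>Right multiplication by a basis element only permutes the coefficients and changes their signs.\<close>

lemma right_mult_H10:
  assumes G: "G \<in> H10_cl \<Omega>"
  shows "(\<lambda>x. G x \<odot> cblade A) \<in> H10_cl \<Omega>"
    and "AE x in M. weak_partial_cl \<Omega> i (\<lambda>x. G x \<odot> cblade A) x = weak_partial_cl \<Omega> i G x \<odot> cblade A"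
proof -
  have c: "(\<lambda>x. (G x \<odot> cblade A) $ C) = csign (sym_diff C A) A *\<^sub>R (\<lambda>x. G x $ (sym_diff C A))" for C
    by (simp add: cmult_cblade_component scaleR_fun_def mult.commute)
  show "(\<lambda>x. G x \<odot> cblade A) \<in> H10_cl \<Omega>"
    unfolding H10_cl_def mem_Collect_eq c by (intro allI subspace_scale[OF subspace_H10] H10_clD G)
  have "AE x in M. \<forall>C. weak_partial \<Omega> i (\<lambda>x. (G x \<odot> cblade A) $ C) x
      = csign (sym_diff C A) A * weak_partial \<Omega> i (\<lambda>x. G x $ (sym_diff C A)) x"
  proof (rule eventually_all_finite)
    fix C
    show "AE x in M. weak_partial \<Omega> i (\<lambda>x. (G x \<odot> cblade A) $ C) x
      = csign (sym_diff C A) A * weak_partial \<Omega> i (\<lambda>x. G x $ (sym_diff C A)) x"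
      unfolding c
      using H1_lincomb(2)[OF H10_clD1[OF G] H10_clD1[OF G], where b = 0] by simp
  qed
  then show "AE x in M. weak_partial_cl \<Omega> i (\<lambda>x. G x \<odot> cblade A) x = weak_partial_cl \<Omega> i G x \<odot> cblade A"
    by eventually_elim (simp add: weak_partial_cl_def vec_eq_iff cmult_cblade_component mult.commute)
qed

lemma q_form_right_mult:
  assumes F: "F \<in> H10_cl \<Omega>" and G: "G \<in> H10_cl \<Omega>"
  shows "q_form \<Omega> s F (\<lambda>x. G x \<odot> cblade A) = q_form \<Omega> s F G \<odot> cblade A"
proof -
  let ?GA = "\<lambda>x. G x \<odot> cblade A"
  have W: "cl_inner \<Omega> P (weak_partial_cl \<Omega> i ?GA) = cl_inner \<Omega> P (weak_partial_cl \<Omega> i G) \<odot> cblade A"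
    if P: "P \<in> L2_cl \<Omega>" for P i
  proof -
    have "cl_inner \<Omega> P (weak_partial_cl \<Omega> i ?GA) = cl_inner \<Omega> P (\<lambda>x. weak_partial_cl \<Omega> i G x \<odot> cblade A)"
      by (intro cl_inner_cong_AE P weak_partial_cl_L2 right_mult_H10 G
          L2_cl_linear[OF linear_cmult_left])
    also have "\<dots> = cl_inner \<Omega> P (weak_partial_cl \<Omega> i G) \<odot> cblade A"
      by (intro cl_inner_right_mult P weak_partial_cl_L2 G)
    finally show ?thesis .
  qed
  note L = q_form_arguments_L2[OF F] operators_L2(3)[OF F] H10_cl_L2[OF F]
  show ?thesis
    unfolding q_form_def W[OF L(1)] cl_inner_right_mult[OF L(2) H10_cl_L2[OF G]]
      cl_inner_right_mult[OF L(3) H10_cl_L2[OF G]] cl_inner_right_mult[OF L(4) H10_cl_L2[OF G]]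
      cl_inner_right_mult[OF L(5) H10_cl_L2[OF G]]
    by (simp only: cmult_add_left cmult_sum_left cmult_scale_left cmult_diff_left)
qed

text \<open>The Clifford-valued equation follows from its scalar part: testing with \<open>G \<odot> cblade A\<close> recovers the
coefficient of index \<open>A\<close> up to a sign.\<close>

lemma weak_solution_iff_Sc:
  assumes f: "f \<in> L2_cl \<Omega>"
  shows "weak_solution \<Omega> s f F \<longleftrightarrow>
    F \<in> H10_cl \<Omega> \<and> (\<forall>G\<in>H10_cl \<Omega>. Sc (q_form \<Omega> s F G) = (LINT x|M. f x \<bullet> G x))"
proof
  assume "weak_solution \<Omega> s f F"
  then show "F \<in> H10_cl \<Omega> \<and> (\<forall>G\<in>H10_cl \<Omega>. Sc (q_form \<Omega> s F G) = (LINT x|M. f x \<bullet> G x))"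
    by (auto simp: weak_solution_def Sc_cl_inner f H10_cl_L2)
next
  assume a: "F \<in> H10_cl \<Omega> \<and> (\<forall>G\<in>H10_cl \<Omega>. Sc (q_form \<Omega> s F G) = (LINT x|M. f x \<bullet> G x))"
  then have F: "F \<in> H10_cl \<Omega>" by blast
  have "q_form \<Omega> s F G = cl_inner \<Omega> f G" if G: "G \<in> H10_cl \<Omega>" for G
  proof -
    have "q_form \<Omega> s F G $ A = cl_inner \<Omega> f G $ A" for A
    proof -
      let ?GA = "\<lambda>x. G x \<odot> cblade A"
      have "Sc (q_form \<Omega> s F ?GA) = Sc (cl_inner \<Omega> f ?GA)"
        using a right_mult_H10(1)[OF G, of A] by (simp add: Sc_cl_inner f H10_cl_L2)
      then have "Sc (q_form \<Omega> s F G \<odot> cblade A) = Sc (cl_inner \<Omega> f G \<odot> cblade A)"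
        by (simp only: q_form_right_mult[OF F G] cl_inner_right_mult[OF f H10_cl_L2[OF G]])
      then show ?thesis
        by (simp add: Sc_cmult_cblade csign_def)
    qed
    then show ?thesis by (simp add: vec_eq_iff)
  qed
  then show "weak_solution \<Omega> s f F" using F by (simp add: weak_solution_def)
qed

lemma inner_le_H10:
  assumes "f \<in> L2_cl \<Omega>" "G \<in> H10_cl \<Omega>"
  shows "\<bar>LINT x|M. f x \<bullet> G x\<bar> \<le> cl_norm2 \<Omega> f * H10.nrm G"
proof -
  have "\<bar>LINT x|M. f x \<bullet> G x\<bar> \<le> CL.nrm f * CL.nrm G"
    by (intro CL.Cauchy_Schwarz H10_cl_L2 assms)
  also have "\<dots> \<le> CL.nrm f * H10.nrm G"
    using norms_le_H10_nrm(2)[OF assms(2)] assms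
    by (intro mult_left_mono) (auto simp: cl_norm2_eq H10_cl_L2)
  finally show ?thesis by (simp add: cl_norm2_eq assms)
qed

lemma H10_ip_zero_imp_AE_zero:
  assumes F: "F \<in> H10_cl \<Omega>" and 0: "H10_ip F F = 0"
  shows "AE x in M. F x = 0"
proof -
  have "AE x in M. \<forall>A. F x $ A = 0"
  proof (rule eventually_all_finite)
    fix A
    have "H1.nrm (\<lambda>x. F x $ A) \<le> 0" using H1_nrm_le_H10[OF F] 0 by (simp add: H10.nrm_def)
    then have "L2.nrm (\<lambda>x. F x $ A) = 0"
      using L2_nrm_le_H1(1)[OF H10_clD1[OF F], of A] L2.nrm_nonneg[OF H1_D(1)[OF H10_clD1[OF F]], of A]
      by linarith
    then show "AE x in M. F x $ A = 0" by (rule L2_nrm_zero_AE[OF H1_D(1)[OF H10_clD1[OF F]]])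
  qed
  then show ?thesis by (simp add: vec_eq_iff)
qed

text \<open>With \<open>N = H10.nrm F\<close>, coercivity gives \<open>H * N\<^sup>2 \<le> cl_norm2 \<Omega> f * N\<close> for every solution, whence the
bound.\<close>

theorem weak_solution_exists_unique_bounded:
  assumes coercive: "\<forall>F\<in>H10_cl \<Omega>. H * H10_ip F F \<le> Sc (q_form \<Omega> s F F)" and H: "0 < H"
    and f: "f \<in> L2_cl \<Omega>"
  shows "\<exists>F. weak_solution \<Omega> s f F"
    and "weak_solution \<Omega> s f F \<Longrightarrow> weak_solution \<Omega> s f F' \<Longrightarrow> AE x in M. F' x = F x"
    and "weak_solution \<Omega> s f F \<Longrightarrow> H10.nrm F \<le> 1 / H * cl_norm2 \<Omega> f"
proof -
  obtain K where K: "\<And>F G. F \<in> H10_cl \<Omega> \<Longrightarrow> G \<in> H10_cl \<Omega> \<Longrightarrow>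
      \<bar>Sc (q_form \<Omega> s F G)\<bar> \<le> K * H10.nrm F * H10.nrm G"
    using Sc_q_form_bounded by blast
  have "\<exists>F\<in>H10_cl \<Omega>. \<forall>G\<in>H10_cl \<Omega>. Sc (q_form \<Omega> s F G) = (LINT x|M. f x \<bullet> G x)"
  proof (rule H10.Lax_Milgram[where K = K and H = H and C = "cl_norm2 \<Omega> f"])
    fix F G L assume FGL: "F \<in> H10_cl \<Omega>" "G \<in> H10_cl \<Omega>" "L \<in> H10_cl \<Omega>"
    show "Sc (q_form \<Omega> s (F + G) L) = Sc (q_form \<Omega> s F L) + Sc (q_form \<Omega> s G L)"
      using Sc_q_form_lincomb_left[OF FGL, of s 1 1] by simp
    show "Sc (q_form \<Omega> s L (F + G)) = Sc (q_form \<Omega> s L F) + Sc (q_form \<Omega> s L G)"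
      using Sc_q_form_lincomb_right[OF FGL(3,1,2), of s 1 1] by simp
  next
    fix c F G assume FG: "F \<in> H10_cl \<Omega>" "G \<in> H10_cl \<Omega>"
    show "Sc (q_form \<Omega> s (c *\<^sub>R F) G) = c * Sc (q_form \<Omega> s F G)"
      using Sc_q_form_lincomb_left[OF FG(1,1,2), of s c 0] by simp
    show "Sc (q_form \<Omega> s G (c *\<^sub>R F)) = c * Sc (q_form \<Omega> s G F)"
      using Sc_q_form_lincomb_right[OF FG(2,1,1), of s c 0] by simp
    show "(LINT x|M. f x \<bullet> (F + G) x) = (LINT x|M. f x \<bullet> F x) + (LINT x|M. f x \<bullet> G x)"
      by (rule CL.ip_add_right) (intro H10_cl_L2 FG f)+
    show "(LINT x|M. f x \<bullet> (c *\<^sub>R F) x) = c * (LINT x|M. f x \<bullet> F x)" by simp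
  qed (use K coercive H inner_le_H10[OF f] in auto)
  then show "\<exists>F. weak_solution \<Omega> s f F" by (auto simp: weak_solution_iff_Sc[OF f])
next
  assume F: "weak_solution \<Omega> s f F" and F': "weak_solution \<Omega> s f F'"
  have FH: "F \<in> H10_cl \<Omega>" "F' \<in> H10_cl \<Omega>" using F F' by (auto simp: weak_solution_def)
  define D where "D = 1 *\<^sub>R F' + (- 1) *\<^sub>R F"
  have D: "D \<in> H10_cl \<Omega>" unfolding D_def by (intro H10.closed_ops FH)
  have "Sc (q_form \<Omega> s D D) = 0"
    using Sc_q_form_lincomb_left[OF FH(2,1) D, of s 1 "- 1"] F F' D
    unfolding D_def[symmetric] weak_solution_iff_Sc[OF f] by simp
  then have "H * H10_ip D D \<le> 0" using bspec[OF coercive D] by simp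
  then have "H10_ip D D = 0" using H H10.ip_nonneg[OF D] by (simp add: mult_le_0_iff)
  from H10_ip_zero_imp_AE_zero[OF D this] show "AE x in M. F' x = F x"
    by (simp add: D_def)
next
  assume F: "weak_solution \<Omega> s f F"
  then have FH: "F \<in> H10_cl \<Omega>" by (simp add: weak_solution_def)
  have "H * (H10.nrm F)\<^sup>2 \<le> Sc (q_form \<Omega> s F F)" using bspec[OF coercive FH] FH by (simp add: H10.nrm_sq)
  also have "\<dots> = (LINT x|M. f x \<bullet> F x)" using F FH by (simp add: weak_solution_iff_Sc[OF f])
  also have "\<dots> \<le> cl_norm2 \<Omega> f * H10.nrm F" using inner_le_H10[OF f FH] by linarith
  finally have *: "H * H10.nrm F * H10.nrm F \<le> cl_norm2 \<Omega> f * H10.nrm F"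
    by (simp add: power2_eq_square mult.assoc)
  show "H10.nrm F \<le> 1 / H * cl_norm2 \<Omega> f"
  proof (cases "H10.nrm F = 0")
    case True
    then show ?thesis using H f by (simp add: cl_norm2_eq)
  next
    case False
    then have "0 < H10.nrm F" using H10.nrm_nonneg[OF FH] by linarith
    then have "H * H10.nrm F \<le> cl_norm2 \<Omega> f" using * by simp
    then show ?thesis using H by (simp add: field_simps)
  qed
qed

end

theorem theorem6p6:
  fixes \<Omega> :: "'n::{finite,linorder} point set"
    and s :: "'n clifford"
    and n :: nat
    and m M :: real
  assumes "n = CARD('n)" and "n \<ge> 2"
    and "open \<Omega>" and "bounded \<Omega>" and "\<Omega> \<noteq> {}" and "smooth_boundary \<Omega>"
    and "m = (INF x\<in>\<Omega>. norm x)" and "M = (SUP x\<in>\<Omega>. norm x)"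
    and "0 \<le> m" and "m < M"
    and "s \<in> paravectors"
    and "(norm s)\<^sup>2 + (real n)\<^sup>2 - 2 * \<bar>Sc s\<bar> * real n * M + (1 + m\<^sup>2)\<^sup>2 > 0"
    and "(norm (nonscalar_part s))\<^sup>2 * (1 + m\<^sup>2)\<^sup>2
           - (Sc s)\<^sup>2 * (real n * (1 + M\<^sup>2)\<^sup>2 - (1 + m\<^sup>2)\<^sup>2)
           - 2 * real n * M * ((3 + real n) * (1 + M\<^sup>2)\<^sup>2 + (1 + m\<^sup>2)\<^sup>2) * \<bar>Sc s\<bar>
         > real n * (3 + real n)\<^sup>2 * M\<^sup>2 * (1 + M\<^sup>2)\<^sup>2 - (real n)\<^sup>2 * (1 + m\<^sup>2)\<^sup>2"
  shows "\<forall>f\<in>L2_cl \<Omega>.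
           (\<exists>F. weak_solution \<Omega> s f F
              \<and> (\<forall>F'. weak_solution \<Omega> s f F' \<longrightarrow> (AE x in lebesgue_on \<Omega>. F' x = F x)))
         \<and> cl_norm2 \<Omega> (Q_inverse \<Omega> s f) \<le> 1 / H_const n m M s * cl_norm2 \<Omega> f
         \<and> cl_normD \<Omega> (Q_inverse \<Omega> s f) \<le> 1 / H_const n m M s * cl_norm2 \<Omega> f"
proof
  fix f assume f: "f \<in> L2_cl \<Omega>"
  interpret clifford_domain \<Omega> by unfold_locales fact+
  let ?H = "H_const n m M s"
  have m_le: "m \<le> norm x" if "x \<in> \<Omega>" for x
    unfolding assms(7) by (rule cINF_lower[OF _ that]) (auto intro: bdd_belowI2[of _ 0])
  have le_M: "norm x \<le> M" if "x \<in> \<Omega>" for x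
    unfolding assms(8) using assms(4)
    by (intro cSUP_upper that) (auto simp: bounded_iff bdd_above_def)
  have coercive: "\<forall>F\<in>H10_cl \<Omega>. ?H * H10_ip F F \<le> Sc (q_form \<Omega> s F F)"
    unfolding assms(1) by (intro ballI Sc_q_form_coercive assms(9) m_le le_M)
  have H: "0 < ?H"
    using assms(9,10,12,13) by (intro H_const_pos) auto
  note sol = weak_solution_exists_unique_bounded[OF coercive H f]
  obtain F where F: "weak_solution \<Omega> s f F" using sol(1) by blast
  have "weak_solution \<Omega> s f (Q_inverse \<Omega> s f)"
    unfolding Q_inverse_def by (rule someI[of "weak_solution \<Omega> s f", OF F])
  note Q = this
  have N: "H10.nrm (Q_inverse \<Omega> s f) \<le> 1 / ?H * cl_norm2 \<Omega> f"
    by (rule sol(3)[OF Q])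
  note le = norms_le_H10_nrm(2,3)[OF conjunct1[OF Q[unfolded weak_solution_def]]]
  show "(\<exists>F. weak_solution \<Omega> s f F
              \<and> (\<forall>F'. weak_solution \<Omega> s f F' \<longrightarrow> (AE x in lebesgue_on \<Omega>. F' x = F x)))
         \<and> cl_norm2 \<Omega> (Q_inverse \<Omega> s f) \<le> 1 / ?H * cl_norm2 \<Omega> f
         \<and> cl_normD \<Omega> (Q_inverse \<Omega> s f) \<le> 1 / ?H * cl_norm2 \<Omega> f"
    using F sol(2)[OF F] order_trans[OF le(1) N] order_trans[OF le(2) N] by blast
qed

end
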